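(* Let $M\subset\mathbb R^n$ be a smooth closed submanifold of dimension $m$. The meromorphic function $B_M(z)$ has the following residue at $z=-m-2j$: $$R_M(-m-2j)=(m+2j)\int_M b_{M,m+2j}(x)\,dx,\qquad j\in\mathbb Z,\ j\ge0.$$ If $\int_M b_{M,k}(x)\,dx=0$, then $B_M$ has no pole at $z=-k$.
   Context: A closed submanifold is a compact submanifold of $\mathbb R^n$ without boundary; $dx,dy$ denote the Riemannian volume element of $M$; $B_t(x)$ is the ball of center $x$ and radius $t$ in $\mathbb R^n$. Let $\psi_{M,x}(t)=\mathrm{vol}(M\cap B_t(x))$ for $x\in M$, $t\ge0$; there is $d>0$ such that for all $x\in M$ this function is smooth on $[0,d)$ (including at $0$). Its Taylor coefficients at $0$ are $b_{M,k}(x)=\frac1{k!}\frac{d^k}{dt^k}\big|_{t=0}\psi_{M,x}(t)$. The integral $\int_{M\times M}|x-y|^z\,dxdy$ converges absolutely for $\mathrm{Re}\,z>-m$ and extends by analytic continuation to a meromorphic function on $\mathbb C$, denoted $B_M(z)$ (the beta function of $M$), with possible poles at $z=-m-2j$, $j\in\mathbb Z$, $j\ge0$. $R_M(z_0)$ denotes the residue of $B_M$ at $z_0$. *)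

theory Defs
  imports "HOL-Complex_Analysis.Complex_Analysis"
begin

(* C^k for maps on an open set S: all iterated directional derivatives of order up to k
   exist and are continuous. *)
primrec Ck_on :: "nat \<Rightarrow> 'a::euclidean_space set \<Rightarrow> ('a \<Rightarrow> 'b::euclidean_space) \<Rightarrow> bool" where
  "Ck_on 0 S f \<longleftrightarrow> continuous_on S f"
| "Ck_on (Suc k) S f \<longleftrightarrow> (\<forall>x\<in>S. f differentiable (at x)) \<and>
     (\<forall>v. Ck_on k S (\<lambda>x. frechet_derivative f (at x) v))"

definition smooth_on :: "'a::euclidean_space set \<Rightarrow> ('a \<Rightarrow> 'b::euclidean_space) \<Rightarrow> bool" where
  "smooth_on S f \<longleftrightarrow> (\<forall>k. Ck_on k S f)"

(* phi (with inverse psi) is a diffeomorphism of an open set U onto an open set V that flattens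
   M \<inter> U onto V \<inter> R^m.  The copy of R^m is the coordinate subspace spanned by m standard basis
   vectors, collected in I. *)
definition slice_chart ::
  "nat \<Rightarrow> 'a::euclidean_space set \<Rightarrow> 'a set \<Rightarrow> 'a set \<Rightarrow> 'a set \<Rightarrow> ('a \<Rightarrow> 'a) \<Rightarrow> ('a \<Rightarrow> 'a) \<Rightarrow> bool" where
  "slice_chart m M I U V \<phi> \<psi> \<longleftrightarrow>
     I \<subseteq> Basis \<and> card I = m \<and> open U \<and> open V \<and>
     homeomorphism U V \<phi> \<psi> \<and> smooth_on U \<phi> \<and> smooth_on V \<psi> \<and>
     \<phi> ` (M \<inter> U) = V \<inter> span I"

definition closed_submanifold :: "nat \<Rightarrow> 'a::euclidean_space set \<Rightarrow> bool" where
  "closed_submanifold m M \<longleftrightarrow> compact M \<and>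
     (\<forall>p\<in>M. \<exists>I U V \<phi> \<psi>. p \<in> U \<and> slice_chart m M I U V \<phi> \<psi>)"

(* Lebesgue measure of the coordinate subspace span I, as a measure on the ambient space: lborel
   for I = Basis, the unit point mass at 0 for empty I. *)
definition lborel_span :: "'a::euclidean_space set \<Rightarrow> 'a measure" where
  "lborel_span I = distr (Pi\<^sub>M I (\<lambda>_. lborel :: real measure)) borel (\<lambda>f. \<Sum>b\<in>I. f b *\<^sub>R b)"

(* det (g_bc) for b, c in I, where g_bc = <d psi b, d psi c> is the first fundamental form of the
   parametrization psi at v.  The determinant is written out by the Leibniz formula because its
   index set I is a set, not a type. *)
definition gram_det :: "'a::euclidean_space set \<Rightarrow> ('a \<Rightarrow> 'a) \<Rightarrow> 'a \<Rightarrow> real" where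
  "gram_det I \<psi> v = (\<Sum>p | p permutes I. of_int (sign p) *
     (\<Prod>b\<in>I. frechet_derivative \<psi> (at v) b \<bullet> frechet_derivative \<psi> (at v) (p b)))"

(* The Riemannian volume of M: the Borel measure on M whose density in every chart is
   sqrt (det g). *)
definition riemannian_volume :: "nat \<Rightarrow> 'a::euclidean_space set \<Rightarrow> 'a measure" where
  "riemannian_volume m M = (THE \<mu>.
     sets \<mu> = sets (restrict_space borel M) \<and>
     (\<forall>I U V \<phi> \<psi> A. slice_chart m M I U V \<phi> \<psi> \<longrightarrow> A \<in> sets \<mu> \<longrightarrow> A \<subseteq> U \<longrightarrow>
        emeasure \<mu> A = (\<integral>\<^sup>+v\<in>\<phi> ` A. ennreal (sqrt (gram_det I \<psi> v)) \<partial>lborel_span I)))"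

(* Closed balls: this only matters for m = 0, where open balls would make the function
   discontinuous at t = 0. *)
definition ball_volume :: "nat \<Rightarrow> 'a::euclidean_space set \<Rightarrow> 'a \<Rightarrow> real \<Rightarrow> real" where
  "ball_volume m M x t = measure (riemannian_volume m M) (M \<inter> cball x t)"

(* The function lives on [0,d), so the derivatives at 0 are one-sided. *)
definition ball_coeff :: "nat \<Rightarrow> 'a::euclidean_space set \<Rightarrow> nat \<Rightarrow> 'a \<Rightarrow> real" where
  "ball_coeff m M k x =
     (((\<lambda>f t. vector_derivative f (at t within {0..})) ^^ k) (ball_volume m M x)) 0 / fact k"

(* The meromorphic continuation to the whole plane of the integral of |x - y|^z over M \<times> M;
   nicely_meromorphic_on normalizes the values at removable singularities and poles, which makes
   the continuation unique as a total function. *)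
definition beta_function :: "nat \<Rightarrow> 'a::euclidean_space set \<Rightarrow> complex \<Rightarrow> complex" where
  "beta_function m M = (THE B. B nicely_meromorphic_on UNIV \<and>
     (\<forall>z. Re z > - real m \<longrightarrow>
        B z = (LINT (x, y)|(riemannian_volume m M \<Otimes>\<^sub>M riemannian_volume m M).
                 complex_of_real (norm (x - y)) powr z)))"

end

theory Submission
  imports Defs
begin

text \<open>
  Put \<open>F(t) = \<integral>\<^sub>M vol (M \<inter> B\<^sub>t(x)) dx\<close>, the volume of the pairs at distance at most \<open>t\<close>. By the layer cake
  formula \<open>B\<^sub>M(z) = D\<^sup>z vol(M)\<^sup>2 - z \<integral>\<^sub>0\<^sup>D t\<^sup>z\<^sup>-\<^sup>1 F(t) dt\<close> with \<open>D\<close> at least the diameter of \<open>M\<close>. If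
  \<open>F(t) \<sim> \<Sum> \<beta>\<^sub>k t\<^sup>k\<close> at \<open>t = 0\<close>, then subtracting the first terms of the expansion continues the integral to
  the left and exhibits simple poles at \<open>z = -k\<close> with residues \<open>k \<beta>\<^sub>k\<close>; no parity consideration is needed.
  The expansion of \<open>F\<close> is the integral of the Taylor expansions of the ball volumes, once their remainders
  are bounded uniformly in \<open>x\<close>. For this the ball volume is written, in a chart \<open>\<psi>\<close> with \<open>\<psi>(v) = x\<close>, as an
  integral over directions \<open>u\<close> of \<open>\<integral>\<^sub>0\<^sup>\<rho> \<surd>g(v + s u) s\<^sup>m\<^sup>-\<^sup>1 ds\<close>, where the exit time \<open>\<rho> = \<rho>(t)\<close> is the inverse
  function of \<open>s \<mapsto> |\<psi>(v + s u) - \<psi>(v)|\<close>, which by Hadamard's lemma is \<open>s\<close> times a positive smooth function.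
\<close>

section \<open>Change of variables in a Euclidean space\<close>

text \<open>The volume and the beta function are both given by definite descriptions, so existence
  and uniqueness have to be established before anything can be computed; for the volume this rests
  on independence of the chart. Charts parametrize \<open>M\<close> over an
  \<open>m\<close>-dimensional coordinate subspace of the ambient space, whereas the change of
  variables formula is full-dimensional. Therefore subspaces are thickened by unit cubes and Gram
  matrices are padded by an identity block, so that ordinary determinants apply. In the parameters
  (base point and direction) only bounds are propagated through the estimates; measurability is
  recovered afterwards, from integrals or from limits of quotients. The remainder estimates hold on
  an interval that may depend on the order of the expansion, which suffices because each half plane
  involves finitely many Taylor coefficients. Poles with real part above \<open>- m\<close> are
  excluded by a bound \<open>C * t ^ m\<close> for the ball volumes, which makes the mean
  coefficients below order \<open>m\<close> vanish.\<close>

no_notation fps_nth (infixl "$" 75)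

text \<open>For nonnegative integrands integrability and absolute integrability coincide. The
  absolute version, applied to \<open>f\<close> as a function into \<open>real^1\<close>, therefore
  becomes an equivalence of plain \<open>has_integral\<close> statements.\<close>

lemma has_integral_change_of_variables_nonneg:
  fixes g :: "real^'n::{finite,wellorder} \<Rightarrow> real^'n::_" and f :: "real^'n::_ \<Rightarrow> real"
  assumes S: "S \<in> sets lebesgue"
    and der: "\<And>x. x \<in> S \<Longrightarrow> (g has_derivative g' x) (at x within S)"
    and inj: "inj_on g S"
    and nn: "\<And>x. 0 \<le> f x"
  shows "((\<lambda>x. \<bar>det (matrix (g' x))\<bar> * f (g x)) has_integral b) S \<longleftrightarrow> (f has_integral b) (g ` S)"
  using has_absolute_integral_change_of_variables [OF S der inj, of "\<lambda>x. vec (f x) :: real^1" "vec b"] nn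
  unfolding absolutely_integrable_on_1_iff integral_on_1_eq integrable_on_1_iff
  by (auto simp: has_integral_iff absolutely_integrable_on_iff_nonneg)

text \<open>By the preceding equivalence one side has the finite value \<open>b\<close> exactly when
  the other does, so both are infinite together. Working in \<open>ennreal\<close> removes
  integrability from the later uses.\<close>

lemma nn_integral_change_of_variables_cart:
  fixes g :: "real^'n::{finite,wellorder} \<Rightarrow> real^'n::_" and f :: "real^'n::_ \<Rightarrow> real"
  assumes S: "S \<in> sets borel"
    and der: "\<And>x. x \<in> S \<Longrightarrow> (g has_derivative g' x) (at x within S)"
    and inj: "inj_on g S"
    and nn: "\<And>x. 0 \<le> f x"
    and m1: "(\<lambda>x. indicator (g ` S) x * f x) \<in> borel_measurable borel"
    and m2: "(\<lambda>x. indicator S x * (\<bar>det (matrix (g' x))\<bar> * f (g x))) \<in> borel_measurable borel"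
  shows "(\<integral>\<^sup>+x. ennreal (indicator (g ` S) x * f x) \<partial>lborel) =
         (\<integral>\<^sup>+x. ennreal (indicator S x * (\<bar>det (matrix (g' x))\<bar> * f (g x))) \<partial>lborel)"
    (is "?L = ?R")
proof -
  have ind: "(h has_integral b) T \<longleftrightarrow> ((\<lambda>x. indicator T x * h x) has_integral b) UNIV" for h :: "real^'n::_ \<Rightarrow> real" and b T
    proof -
    have "(\<lambda>x. indicator T x * h x) = (\<lambda>x. if x \<in> T then h x else 0)" by auto
    thus ?thesis by (simp add: has_integral_restrict_UNIV)
  qed
  have key: "?L = ennreal b \<and> 0 \<le> b \<longleftrightarrow> ?R = ennreal b \<and> 0 \<le> b" for b
  proof -
    have S': "S \<in> sets lebesgue" using S by simp
    have "((\<lambda>x. indicator S x * (\<bar>det (matrix (g' x))\<bar> * f (g x))) has_integral b) UNIV \<longleftrightarrow>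
       ((\<lambda>x. indicator (g ` S) x * f x) has_integral b) UNIV"
      unfolding ind[symmetric] by (rule has_integral_change_of_variables_nonneg[OF S' der inj nn])
    moreover have "((\<lambda>x. indicator (g ` S) x * f x) has_integral b) UNIV \<longleftrightarrow> ?L = ennreal b \<and> 0 \<le> b"
      using m1 nn by (subst has_integral_iff_nn_integral_lebesgue) (auto simp: nn_integral_completion measurable_completion)
    moreover have "((\<lambda>x. indicator S x * (\<bar>det (matrix (g' x))\<bar> * f (g x))) has_integral b) UNIV
        \<longleftrightarrow> ?R = ennreal b \<and> 0 \<le> b"
      using m2 nn by (subst has_integral_iff_nn_integral_lebesgue) (auto simp: nn_integral_completion measurable_completion)
    ultimately show ?thesis by blast
  qed
  show ?thesis
  proof (cases "?L" rule: ennreal_cases)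
    case (real r)
    thus ?thesis using key[of r] by simp
  next
    case top
    thus ?thesis by (cases "?R" rule: ennreal_cases) (use key in auto)
  qed
qed

text \<open>Turning the basis into a type makes \<open>real^'a basis_index\<close> a copy of
  \<open>'a\<close> to which the change of variables formula and the determinants of matrices
  apply.\<close>

typedef (overloaded) 'a basis_index = "Basis :: 'a::euclidean_space set"
  by (rule nonempty_Basis[unfolded ex_in_conv[symmetric]])

instance basis_index :: (euclidean_space) finite
proof
  have "(UNIV :: 'a basis_index set) = Abs_basis_index ` Basis"
    using type_definition.Abs_image[OF type_definition_basis_index] by (rule sym)
  thus "finite (UNIV :: 'a basis_index set)" by (metis finite_Basis finite_imageI)
qed

text \<open>The order is pulled back from an arbitrary injection into \<open>nat\<close>; it is
  there to meet the sort constraint on the index type in the change of variables formula.\<close>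

instantiation basis_index :: (euclidean_space) wellorder
begin
definition less_eq_basis_index :: "'a basis_index \<Rightarrow> 'a basis_index \<Rightarrow> bool" where
  "less_eq_basis_index x y \<longleftrightarrow> (SOME r. inj r) x \<le> ((SOME r. inj r) y :: nat)"
definition less_basis_index :: "'a basis_index \<Rightarrow> 'a basis_index \<Rightarrow> bool" where
  "less_basis_index x y \<longleftrightarrow> (SOME r. inj r) x < ((SOME r. inj r) y :: nat)"
instance
proof
  define r :: "'a basis_index \<Rightarrow> nat" where "r = (SOME r. inj r)"
  have "\<exists>r :: 'a basis_index \<Rightarrow> nat. inj r"
    using finite_imp_inj_to_nat_seg[OF finite[of "UNIV :: 'a basis_index set"]] by metis
  hence inj: "inj r" unfolding r_def by (rule someI_ex)
  fix x y z :: "'a basis_index"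
  note d = less_eq_basis_index_def less_basis_index_def r_def[symmetric]
  show "(x < y) = (x \<le> y \<and> \<not> y \<le> x)" "x \<le> x" "x \<le> y \<Longrightarrow> y \<le> z \<Longrightarrow> x \<le> z" "x \<le> y \<or> y \<le> x"
    unfolding d by auto
  show "x \<le> y \<Longrightarrow> y \<le> x \<Longrightarrow> x = y" unfolding d using inj by (auto dest: injD)
  fix P :: "'a basis_index \<Rightarrow> bool" and a
  assume "\<And>x. (\<And>y. y < x \<Longrightarrow> P y) \<Longrightarrow> P x"
  thus "P a" unfolding d by (induction a rule: measure_induct_rule[where f = r]) blast
qed
end

definition to_cart :: "'a::euclidean_space \<Rightarrow> real^'a basis_index" where
  "to_cart x = (\<chi> i. x \<bullet> Rep_basis_index i)"

definition from_cart :: "real^'a basis_index \<Rightarrow> 'a::euclidean_space" where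
  "from_cart y = (\<Sum>b\<in>Basis. (y $ Abs_basis_index b) *\<^sub>R b)"

lemma from_to_cart [simp]: "from_cart (to_cart x) = x"
  by (simp add: from_cart_def to_cart_def Abs_basis_index_inverse euclidean_representation)

lemma inner_from_cart: "b \<in> Basis \<Longrightarrow> from_cart y \<bullet> b = y $ Abs_basis_index b"
  by (simp add: from_cart_def)

lemma to_from_cart [simp]: "to_cart (from_cart y) = y"
  by (simp add: to_cart_def vec_eq_iff inner_from_cart Rep_basis_index Rep_basis_index_inverse)

lemma linear_to_cart: "linear to_cart"
  by (rule linearI) (auto simp: to_cart_def vec_eq_iff inner_simps)

lemma linear_from_cart: "linear from_cart"
  by (rule linearI) (auto simp: from_cart_def scaleR_left_distrib sum.distrib scaleR_sum_right)

lemma to_cart_basis: "to_cart (Rep_basis_index i) = axis i 1"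
  by (auto simp: to_cart_def vec_eq_iff axis_def inner_Basis Rep_basis_index Rep_basis_index_inject)

lemma from_cart_axis: "from_cart (axis i 1) = Rep_basis_index i"
  by (metis from_to_cart to_cart_basis)

lemma measurable_from_cart [measurable]: "from_cart \<in> borel_measurable borel"
  by (rule borel_measurable_continuous_onI[OF linear_continuous_on[OF
        linear_conv_bounded_linear[THEN iffD1, OF linear_from_cart]]])

lemma bij_Abs_basis_index: "bij_betw Abs_basis_index Basis UNIV"
  by (rule bij_betwI[where g = Rep_basis_index])
     (auto simp: Rep_basis_index Abs_basis_index_inverse Rep_basis_index_inverse)

text \<open>Preimages of boxes are boxes with the same side lengths, and Lebesgue measure is
  determined by its values on boxes.\<close>

lemma distr_from_cart: "distr lborel borel from_cart = lborel"
proof (rule lborel_eqI[symmetric])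
  fix l u :: 'a
  assume le: "\<And>b. b \<in> Basis \<Longrightarrow> l \<bullet> b \<le> u \<bullet> b"
  have "from_cart -` box l u = box (to_cart l) (to_cart u)"
  proof (intro set_eqI)
    fix y :: "real^'a basis_index"
    have "y \<in> from_cart -` box l u \<longleftrightarrow> (\<forall>b\<in>Basis. l \<bullet> b < y $ Abs_basis_index b \<and> y $ Abs_basis_index b < u \<bullet> b)"
      by (simp add: box_def inner_from_cart)
    also have "\<dots> \<longleftrightarrow> (\<forall>i. l \<bullet> Rep_basis_index i < y $ i \<and> y $ i < u \<bullet> Rep_basis_index i)"
      by (metis Abs_basis_index_inverse Rep_basis_index Rep_basis_index_inverse)
    finally show "y \<in> from_cart -` box l u \<longleftrightarrow> y \<in> box (to_cart l) (to_cart u)"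
      by (simp add: mem_box_cart to_cart_def)
  qed
  hence "emeasure (distr lborel borel from_cart) (box l u) = emeasure lborel (box (to_cart l) (to_cart u))"
    by (simp add: emeasure_distr)
  also have "\<dots> = ennreal (\<Prod>b\<in>Basis. (to_cart u - to_cart l) \<bullet> b)"
  proof (rule emeasure_lborel_box)
    fix b :: "real^'a basis_index"
    assume "b \<in> Basis"
    then obtain i where "b = axis i 1" using axis_inverse by blast
    thus "to_cart l \<bullet> b \<le> to_cart u \<bullet> b"
      using le[OF Rep_basis_index[of i]] by (simp add: inner_axis to_cart_def)
  qed
  also have "(\<Prod>b\<in>Basis. (to_cart u - to_cart l) \<bullet> b) = (\<Prod>i\<in>UNIV. (u - l) \<bullet> Rep_basis_index i)"
  proof (rule prod.reindex_bij_witness[of _ "\<lambda>i. axis i 1" axis_index])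
    fix b :: "real^'a basis_index"
    assume "b \<in> Basis"
    then obtain i where b: "b = axis i 1" using axis_inverse by blast
    thus "axis (axis_index b) 1 = b" "(u - l) \<bullet> Rep_basis_index (axis_index b) = (to_cart u - to_cart l) \<bullet> b"
      by (auto simp: inner_axis to_cart_def inner_diff_left)
  qed auto
  also have "\<dots> = (\<Prod>b\<in>Basis. (u - l) \<bullet> b)"
    by (rule prod.reindex_bij_witness[of _ Abs_basis_index Rep_basis_index])
       (auto simp: Rep_basis_index Abs_basis_index_inverse Rep_basis_index_inverse)
  finally show "emeasure (distr lborel borel from_cart) (box l u) = ennreal (\<Prod>b\<in>Basis. (u - l) \<bullet> b)" .
qed simp

definition edet :: "('a::euclidean_space \<Rightarrow> 'a) \<Rightarrow> real" where
  "edet f = det (\<chi> i j. f (Rep_basis_index j) \<bullet> Rep_basis_index i :: real^'a basis_index^'a basis_index)"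

lemma edet_eq: "edet f = det (matrix (to_cart \<circ> f \<circ> from_cart))"
  unfolding edet_def matrix_def
  by (intro arg_cong[of _ _ det]) (simp add: vec_eq_iff from_cart_axis to_cart_def)

text \<open>The Cartesian formula, conjugated by the measure preserving linear isomorphism
  \<open>from_cart\<close>.\<close>

lemma nn_integral_change_of_variables:
  fixes g :: "'a::euclidean_space \<Rightarrow> 'a" and f :: "'a \<Rightarrow> real"
  assumes S: "S \<in> sets borel"
    and der: "\<And>x. x \<in> S \<Longrightarrow> (g has_derivative g' x) (at x within S)"
    and inj: "inj_on g S"
    and nn: "\<And>x. 0 \<le> f x"
    and m1: "(\<lambda>x. indicator (g ` S) x * f x) \<in> borel_measurable borel"
    and m2: "(\<lambda>x. indicator S x * (\<bar>edet (g' x)\<bar> * f (g x))) \<in> borel_measurable borel"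
  shows "(\<integral>\<^sup>+x. ennreal (indicator (g ` S) x * f x) \<partial>lborel) =
         (\<integral>\<^sup>+x. ennreal (indicator S x * (\<bar>edet (g' x)\<bar> * f (g x))) \<partial>lborel)"
proof -
  define T where "T = from_cart -` S"
  define G where "G = to_cart \<circ> g \<circ> from_cart"
  define G' where "G' y = to_cart \<circ> g' (from_cart y) \<circ> from_cart" for y
  have Tim: "from_cart ` T = S" unfolding T_def by (metis UNIV_I from_to_cart surj_def surj_image_vimage_eq)
  have GT: "y \<in> G ` T \<longleftrightarrow> from_cart y \<in> g ` S" for y
  proof
    assume "y \<in> G ` T"
    thus "from_cart y \<in> g ` S" by (auto simp: G_def T_def)
  next
    assume "from_cart y \<in> g ` S"
    then obtain x where "x \<in> S" "from_cart y = g x" by auto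
    hence "y = G (to_cart x)" "to_cart x \<in> T" 
      by (auto simp: G_def T_def) (metis to_from_cart)
    thus "y \<in> G ` T" by blast
  qed
  have m1': "(\<lambda>y. indicator (g ` S) (from_cart y) * f (from_cart y)) \<in> borel_measurable borel"
    by (rule measurable_compose[OF measurable_from_cart m1])
  have m2': "(\<lambda>y. indicator S (from_cart y) * (\<bar>edet (g' (from_cart y))\<bar> * f (g (from_cart y)))) \<in> borel_measurable borel"
    by (rule measurable_compose[OF measurable_from_cart m2])
  have "(\<integral>\<^sup>+x. ennreal (indicator (g ` S) x * f x) \<partial>lborel) = 
      (\<integral>\<^sup>+y. ennreal (indicator (g ` S) (from_cart y) * f (from_cart y)) \<partial>lborel)"
    by (subst distr_from_cart[symmetric], rule nn_integral_distr) (use m1 in auto)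
  also have "\<dots> = (\<integral>\<^sup>+y. ennreal (indicator (G ` T) y * f (from_cart y)) \<partial>lborel)"
    by (intro nn_integral_cong) (simp add: indicator_def GT)
  also have "\<dots> = (\<integral>\<^sup>+y. ennreal (indicator T y * (\<bar>det (matrix (G' y))\<bar> * f (from_cart (G y)))) \<partial>lborel)"
  proof (rule nn_integral_change_of_variables_cart)
    show "T \<in> sets borel" using measurable_sets_borel[OF measurable_from_cart S] by (simp add: T_def)
    show "(G has_derivative G' y) (at y within T)" if "y \<in> T" for y
    proof -
      have 1: "(from_cart has_derivative from_cart) (at y within T)"
        by (rule linear_imp_has_derivative[OF linear_from_cart])
      have 2: "(g has_derivative g' (from_cart y)) (at (from_cart y) within from_cart ` T)"
        unfolding Tim using der that by (simp add: T_def)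
      have 3: "(to_cart has_derivative to_cart) (at (g (from_cart y)) within g ` from_cart ` T)"
        by (rule linear_imp_has_derivative[OF linear_to_cart])
      have 4: "(g \<circ> from_cart has_derivative g' (from_cart y) \<circ> from_cart) (at y within T)"
        by (rule diff_chain_within[OF 1 2])
      show ?thesis
        using diff_chain_within[OF 4, of to_cart to_cart] 3 
        by (simp add: G_def G'_def image_comp comp_assoc)
    qed
    show "inj_on G T" 
      unfolding G_def T_def inj_on_def o_def
      by (metis from_to_cart inj inj_onD to_from_cart vimageE)
    show "0 \<le> f (from_cart y)" for y by (rule nn)
    show "(\<lambda>x. indicator (G ` T) x * f (from_cart x)) \<in> borel_measurable borel"
      using m1' by (simp add: indicator_def GT)
    show "(\<lambda>x. indicator T x * (\<bar>det (matrix (G' x))\<bar> * f (from_cart (G x)))) \<in> borel_measurable borel"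
      using m2' by (simp add: indicator_def T_def edet_eq G'_def G_def)
  qed
  also have "\<dots> = (\<integral>\<^sup>+y. ennreal (indicator S (from_cart y) * (\<bar>edet (g' (from_cart y))\<bar> * f (g (from_cart y)))) \<partial>lborel)"
    by (simp add: indicator_def T_def edet_eq G'_def G_def)
  also have "\<dots> = (\<integral>\<^sup>+x. ennreal (indicator S x * (\<bar>edet (g' x)\<bar> * f (g x))) \<partial>lborel)"
    by (subst (2) distr_from_cart[symmetric], rule nn_integral_distr[symmetric]) (use m2 in auto)
  finally show ?thesis .
qed

section \<open>Gram determinants\<close>

definition coord_proj :: "'a::euclidean_space set \<Rightarrow> 'a \<Rightarrow> 'a" where
  "coord_proj I x = (\<Sum>b\<in>I. (x \<bullet> b) *\<^sub>R b)"

lemma linear_coord_proj: "linear (coord_proj I)"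
  by (rule linearI) (auto simp: coord_proj_def inner_simps scaleR_left_distrib sum.distrib scaleR_sum_right)

lemma coord_proj_inner:
  assumes "I \<subseteq> Basis" "b \<in> Basis"
  shows "coord_proj I x \<bullet> b = (if b \<in> I then x \<bullet> b else 0)"
proof -
  have fin: "finite I" using assms(1) finite_subset finite_Basis by blast
  have "coord_proj I x \<bullet> b = (\<Sum>c\<in>I. if c = b then x \<bullet> b else 0)"
    unfolding coord_proj_def inner_sum_left
    by (intro sum.cong refl) (use assms in \<open>auto simp: inner_Basis subset_iff\<close>)
  thus ?thesis using fin by simp
qed

lemma coord_proj_basis:
  assumes "I \<subseteq> Basis" "b \<in> Basis"
  shows "coord_proj I b = (if b \<in> I then b else 0)"
  by (rule euclidean_eqI) (use assms in \<open>auto simp: coord_proj_inner inner_Basis\<close>)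

lemma coord_proj_compl: "I \<subseteq> Basis \<Longrightarrow> coord_proj I x + coord_proj (Basis - I) x = x"
  by (rule euclidean_eqI) (auto simp: coord_proj_inner inner_add_left)

lemma coord_proj_in_span: "coord_proj I x \<in> span I"
  unfolding coord_proj_def by (intro span_sum span_scale span_base)

lemma coord_proj_span:
  assumes "I \<subseteq> Basis" "x \<in> span I"
  shows "coord_proj I x = x"
  using assms(2)
proof (induction rule: span_induct_alt)
  case base
  show ?case by (simp add: coord_proj_def)
next
  case (step c b y)
  have "b \<in> Basis" using step assms(1) by auto
  hence "coord_proj I b = b" using step assms(1) by (simp add: coord_proj_basis)
  thus ?case using step linear_coord_proj[of I] by (simp add: linear_add linear_scale)
qed

lemma coord_proj_span_disjoint:
  assumes "I \<subseteq> Basis" "x \<in> span (Basis - I)"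
  shows "coord_proj I x = 0"
proof -
  have "coord_proj (Basis - I) x = x" using assms by (intro coord_proj_span) auto
  thus ?thesis using coord_proj_compl[OF assms(1), of x] by simp
qed

lemma coord_proj_add_span:
  assumes "I \<subseteq> Basis" "u \<in> span I" "w \<in> span (Basis - I)"
  shows "coord_proj I (u + w) = u"
  using assms by (simp add: linear_add[OF linear_coord_proj] coord_proj_span coord_proj_span_disjoint)

lemma coord_proj_compl_add_span:
  assumes "I \<subseteq> Basis" "u \<in> span I" "w \<in> span (Basis - I)"
  shows "coord_proj (Basis - I) (u + w) = w"
  using coord_proj_add_span[OF assms] coord_proj_compl[OF assms(1), of "u + w"] by simp

lemma measurable_coord_proj [measurable]: "coord_proj I \<in> borel_measurable borel"
  unfolding coord_proj_def[abs_def] by measurable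

section \<open>Matrices of endomorphisms and padded Gram matrices\<close>

definition mat_of :: "('a::euclidean_space \<Rightarrow> 'a) \<Rightarrow> real^'a basis_index^'a basis_index" where
  "mat_of f = matrix (to_cart \<circ> f \<circ> from_cart)"

lemma mat_of_nth: "mat_of f $ i $ j = f (Rep_basis_index j) \<bullet> Rep_basis_index i"
  by (simp add: mat_of_def matrix_def from_cart_axis to_cart_def)

lemma edet_mat_of: "edet f = det (mat_of f)"
  by (simp add: edet_eq mat_of_def)

lemma mat_of_comp:
  assumes "linear f" "linear g"
  shows "mat_of (f \<circ> g) = mat_of f ** mat_of g"
proof -
  have "to_cart \<circ> (f \<circ> g) \<circ> from_cart = (to_cart \<circ> f \<circ> from_cart) \<circ> (to_cart \<circ> g \<circ> from_cart)"
    by (auto simp: fun_eq_iff)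
  thus ?thesis
    unfolding mat_of_def using assms
    by (simp add: matrix_compose linear_compose linear_to_cart linear_from_cart)
qed

lemma inner_eq_sum_basis_index:
  "x \<bullet> y = (\<Sum>i\<in>UNIV. (x \<bullet> Rep_basis_index i) * (y \<bullet> Rep_basis_index i))"
proof -
  have "x \<bullet> y = (\<Sum>b\<in>Basis. (x \<bullet> b) * (y \<bullet> b))" by (rule euclidean_inner)
  also have "\<dots> = (\<Sum>i\<in>UNIV. (x \<bullet> Rep_basis_index i) * (y \<bullet> Rep_basis_index i))"
    by (rule sum.reindex_bij_witness[of _ Rep_basis_index Abs_basis_index])
       (auto simp: Rep_basis_index Abs_basis_index_inverse Rep_basis_index_inverse)
  finally show ?thesis .
qed

lemma mat_of_gram_nth:
  "(transpose (mat_of f) ** mat_of f) $ i $ j = f (Rep_basis_index i) \<bullet> f (Rep_basis_index j)"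
  by (subst inner_eq_sum_basis_index) (simp add: matrix_matrix_mult_def transpose_def mat_of_nth)

text \<open>The Gram block of \<open>L\<close> on \<open>span I\<close>, completed by the identity
  on the other coordinates. The result is a full square matrix with the same determinant as the
  block, and it is of the form \<open>transpose A ** A\<close> up to a sum, which makes
  multiplicativity of determinants available.\<close>

definition gram_mat :: "'a::euclidean_space set \<Rightarrow> ('a \<Rightarrow> 'a) \<Rightarrow> real^'a basis_index^'a basis_index" where
  "gram_mat I L = transpose (mat_of (L \<circ> coord_proj I)) ** mat_of (L \<circ> coord_proj I) +
     transpose (mat_of (coord_proj (Basis - I))) ** mat_of (coord_proj (Basis - I))"

lemma gram_mat_nth:
  assumes "I \<subseteq> Basis" "linear L" and that: "b \<in> Basis" "c \<in> Basis"
  shows "gram_mat I L $ Abs_basis_index b $ Abs_basis_index c =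
     (if b \<in> I \<and> c \<in> I then L b \<bullet> L c else if b = c then 1 else 0)"
proof -
  have "gram_mat I L $ Abs_basis_index b $ Abs_basis_index c =
      L (coord_proj I b) \<bullet> L (coord_proj I c) + coord_proj (Basis - I) b \<bullet> coord_proj (Basis - I) c"
    unfolding gram_mat_def vector_add_component mat_of_gram_nth
    by (simp add: Abs_basis_index_inverse that)
  also have "\<dots> = (if b \<in> I \<and> c \<in> I then L b \<bullet> L c else if b = c then 1 else 0)"
    using that linear_0[OF assms(2)] coord_proj_basis[OF assms(1)] coord_proj_basis[of "Basis - I"]
    by (simp add: inner_Basis)
  finally show ?thesis .
qed

text \<open>Outside the \<open>I\<close> block the matrix is the identity, so a permutation moving a
  basis vector outside \<open>I\<close> contributes a vanishing product, and a permutation of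
  \<open>I\<close> contributes only its factors over \<open>I\<close>. The left side sums over
  permutations of the index type, which are matched with permutations of \<open>Basis\<close>
  beforehand.\<close>

lemma det_gram_mat:
  fixes L :: "'a::euclidean_space \<Rightarrow> 'a"
  assumes I: "I \<subseteq> Basis" and L: "linear L"
  shows "det (gram_mat I L) = (\<Sum>p | p permutes I. of_int (sign p) * (\<Prod>b\<in>I. L b \<bullet> L (p b)))"
proof -
  define a where "a b c = (if b \<in> I \<and> c \<in> I then L b \<bullet> L c else if b = c then 1 else 0)" for b c
  let ?B = "Basis :: 'a set"
  have "det (gram_mat I L) = (\<Sum>p | p permutes (UNIV :: 'a basis_index set).
      of_int (sign p) * (\<Prod>i\<in>UNIV. gram_mat I L $ i $ p i))"
    by (simp add: det_def)
  also have "\<dots> = (\<Sum>p | p permutes ?B. of_int (sign p) * (\<Prod>b\<in>?B. a b (p b)))"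
  proof (rule sum.reindex_bij_witness[of _ "map_permutation ?B Abs_basis_index" "map_permutation UNIV Rep_basis_index"])
    fix q assume "q \<in> {q. q permutes (UNIV :: 'a basis_index set)}"
    hence q: "q permutes (UNIV :: 'a basis_index set)" by simp
    have bij: "bij_betw Rep_basis_index UNIV ?B"
      by (rule bij_betwI[where g = Abs_basis_index])
         (auto simp: Rep_basis_index Abs_basis_index_inverse Rep_basis_index_inverse)
    note inj = bij_betw_imp_inj_on[OF bij]
    show "map_permutation ?B Abs_basis_index (map_permutation UNIV Rep_basis_index q) = q"
      by (rule map_permutation_compose_inv[OF bij q]) (simp add: Rep_basis_index_inverse)
    show "map_permutation UNIV Rep_basis_index q \<in> {p. p permutes ?B}"
      using map_permutation_permutes[OF bij q] by simp
    have sg: "sign (map_permutation UNIV Rep_basis_index q) = sign q"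
      by (rule sign_map_permutation[OF inj q]) simp
    have "(\<Prod>b\<in>?B. a b (map_permutation UNIV Rep_basis_index q b)) =
        (\<Prod>i\<in>UNIV. gram_mat I L $ i $ q i)"
    proof (rule prod.reindex_bij_witness[of _ Rep_basis_index Abs_basis_index])
      fix b assume b: "b \<in> ?B"
      have "map_permutation UNIV Rep_basis_index q b = Rep_basis_index (q (Abs_basis_index b))"
        using map_permutation_apply[OF inj, of "Abs_basis_index b" q] b by (simp add: Abs_basis_index_inverse)
      thus "gram_mat I L $ Abs_basis_index b $ q (Abs_basis_index b) = a b (map_permutation UNIV Rep_basis_index q b)"
        using gram_mat_nth[OF I L b Rep_basis_index[of "q (Abs_basis_index b)"]]
        by (simp add: a_def Rep_basis_index_inverse)
    qed (auto simp: Rep_basis_index Abs_basis_index_inverse Rep_basis_index_inverse)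
    thus "of_int (sign (map_permutation UNIV Rep_basis_index q)) *
         (\<Prod>b\<in>?B. a b (map_permutation UNIV Rep_basis_index q b)) =
         of_int (sign q) * (\<Prod>i\<in>UNIV. gram_mat I L $ i $ q i)"
      using sg by simp
  next
    fix p assume "p \<in> {p. p permutes ?B}"
    hence p: "p permutes ?B" by simp
    show "map_permutation UNIV Rep_basis_index (map_permutation ?B Abs_basis_index p) = p"
      by (rule map_permutation_compose_inv[OF bij_Abs_basis_index p]) (simp add: Abs_basis_index_inverse)
    show "map_permutation ?B Abs_basis_index p \<in> {q. q permutes UNIV}"
      using map_permutation_permutes[OF bij_Abs_basis_index p] by simp
  qed
  also have "\<dots> = (\<Sum>p | p permutes I. of_int (sign p) * (\<Prod>b\<in>?B. a b (p b)))"
  proof (rule sum.mono_neutral_right)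
    show "finite {p. p permutes ?B}" by (simp add: finite_permutations)
    show "{p. p permutes I} \<subseteq> {p. p permutes ?B}" using permutes_subset[OF _ I] by auto
    show "\<forall>p\<in>{p. p permutes ?B} - {p. p permutes I}. of_int (sign p) * (\<Prod>b\<in>?B. a b (p b)) = 0"
    proof
      fix p assume "p \<in> {p. p permutes ?B} - {p. p permutes I}"
      hence "p permutes ?B" "\<not> p permutes I" by auto
      then obtain b where b: "b \<in> ?B - I" "p b \<noteq> b" using permutes_superset by blast
      hence "a b (p b) = 0" by (auto simp: a_def)
      hence "(\<Prod>b\<in>?B. a b (p b)) = 0" using b by (intro prod_zero) auto
      thus "of_int (sign p) * (\<Prod>b\<in>?B. a b (p b)) = 0" by simp
    qed
  qed
  also have "\<dots> = (\<Sum>p | p permutes I. of_int (sign p) * (\<Prod>b\<in>I. L b \<bullet> L (p b)))"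
  proof (intro sum.cong refl)
    fix p assume "p \<in> {p. p permutes I}"
    hence p: "p permutes I" by simp
    have "(\<Prod>b\<in>?B. a b (p b)) = (\<Prod>b\<in>I. a b (p b))"
      by (rule prod.mono_neutral_right) (use I permutes_not_in[OF p] in \<open>auto simp: a_def\<close>)
    also have "\<dots> = (\<Prod>b\<in>I. L b \<bullet> L (p b))"
      by (rule prod.cong) (use permutes_in_image[OF p] in \<open>auto simp: a_def\<close>)
    finally show "of_int (sign p) * (\<Prod>b\<in>?B. a b (p b)) = of_int (sign p) * (\<Prod>b\<in>I. L b \<bullet> L (p b))" by simp
  qed
  finally show ?thesis .
qed

lemma gram_det_eq:
  assumes "I \<subseteq> Basis" "\<psi> differentiable (at v)"
  shows "gram_det I \<psi> v = det (gram_mat I (frechet_derivative \<psi> (at v)))"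
  using assms by (simp add: gram_det_def det_gram_mat linear_frechet_derivative)

lemma matrix_matrix_mult_add_rdistrib: "(A + B) ** C = A ** C + B ** (C :: 'a::semiring_1^'n^'m)"
  by (simp add: matrix_matrix_mult_def vec_eq_iff distrib_right sum.distrib)

text \<open>Let \<open>T\<close> be \<open>D\<close> on \<open>span I\<close> and the isometry
  \<open>K\<close> on the complement. Then \<open>gram_mat I L\<close> equals
  \<open>transpose T ** gram_mat J L' ** T\<close> in matrix form: on the first block because
  \<open>L\<close> is \<open>L'\<close> after \<open>D\<close>, on the second because
  \<open>K\<close> preserves inner products. Determinants give the square of \<open>edet\<close>.
  This is the transformation law of the volume density.\<close>

lemma det_gram_mat_transform:
  assumes I: "I \<subseteq> Basis" and J: "J \<subseteq> Basis"
    and lin: "linear L" "linear L'" "linear D" "linear K"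
    and LD: "\<And>x. x \<in> span I \<Longrightarrow> L x = L' (D x)"
    and D: "\<And>x. x \<in> span I \<Longrightarrow> D x \<in> span J"
    and K: "\<And>x. x \<in> span (Basis - I) \<Longrightarrow> K x \<in> span (Basis - J)"
    and iso: "\<And>x y. x \<in> span (Basis - I) \<Longrightarrow> y \<in> span (Basis - I) \<Longrightarrow> K x \<bullet> K y = x \<bullet> y"
  shows "det (gram_mat I L) =
    (edet (\<lambda>x. D (coord_proj I x) + K (coord_proj (Basis - I) x)))\<^sup>2 * det (gram_mat J L')"
proof -
  define T where "T x = D (coord_proj I x) + K (coord_proj (Basis - I) x)" for x
  define P where "P = mat_of (L' \<circ> coord_proj J)"
  define Q where "Q = mat_of (coord_proj (Basis - J))"
  have linT: "linear T" unfolding T_def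
    using linear_compose_add[OF linear_compose[OF linear_coord_proj lin(3)] linear_compose[OF linear_coord_proj lin(4)]]
    by (simp add: o_def)
  have 1: "L \<circ> coord_proj I = (L' \<circ> coord_proj J) \<circ> T"
    using coord_proj_add_span[OF J D[OF coord_proj_in_span] K[OF coord_proj_in_span]] LD[OF coord_proj_in_span]
    by (auto simp: fun_eq_iff T_def)
  have 2: "K \<circ> coord_proj (Basis - I) = coord_proj (Basis - J) \<circ> T"
    using coord_proj_compl_add_span[OF J D[OF coord_proj_in_span] K[OF coord_proj_in_span]]
    by (auto simp: fun_eq_iff T_def)
  have "transpose (mat_of (coord_proj (Basis - I))) ** mat_of (coord_proj (Basis - I)) =
      transpose (mat_of (K \<circ> coord_proj (Basis - I))) ** mat_of (K \<circ> coord_proj (Basis - I))"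
    unfolding vec_eq_iff mat_of_gram_nth by (simp add: iso coord_proj_in_span)
  also have "mat_of (K \<circ> coord_proj (Basis - I)) = Q ** mat_of T"
    unfolding 2 Q_def by (rule mat_of_comp[OF linear_coord_proj linT])
  finally have 3: "transpose (mat_of (coord_proj (Basis - I))) ** mat_of (coord_proj (Basis - I)) =
      transpose (Q ** mat_of T) ** (Q ** mat_of T)" .
  have 4: "mat_of (L \<circ> coord_proj I) = P ** mat_of T"
    unfolding 1 P_def by (rule mat_of_comp[OF linear_compose[OF linear_coord_proj lin(2)] linT])
  have "gram_mat I L = transpose (mat_of T) ** (transpose P ** P + transpose Q ** Q) ** mat_of T"
    unfolding gram_mat_def 3 4 matrix_transpose_mul
    by (simp add: matrix_add_ldistrib matrix_matrix_mult_add_rdistrib matrix_mul_assoc)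
  also have "transpose P ** P + transpose Q ** Q = gram_mat J L'"
    by (simp add: gram_mat_def P_def Q_def)
  finally show ?thesis
    by (simp add: det_mul det_transpose edet_mat_of T_def power2_eq_square)
qed

lemma inner_gram_mat:
  assumes "linear L"
  shows "x \<bullet> (gram_mat I L *v x) =
     (norm (L (coord_proj I (from_cart x))))\<^sup>2 + (norm (coord_proj (Basis - I) (from_cart x)))\<^sup>2"
proof -
  have mv: "mat_of f *v x = to_cart (f (from_cart x))" if "linear f" for f :: "'a \<Rightarrow> 'a"
  proof -
    have "linear (to_cart \<circ> f \<circ> from_cart)"
      by (intro linear_compose linear_to_cart linear_from_cart that)
    from fun_cong[OF matrix_vector_mul(2)[OF this], of x] show ?thesis by (simp add: mat_of_def o_def)
  qed
  have ii: "to_cart y \<bullet> to_cart z = y \<bullet> z" for y z :: 'a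
    by (subst inner_eq_sum_basis_index) (simp add: inner_vec_def to_cart_def)
  have q: "x \<bullet> ((transpose (mat_of f) ** mat_of f) *v x) = (norm (f (from_cart x)))\<^sup>2" if "linear f" for f :: "'a \<Rightarrow> 'a"
  proof -
    have "x \<bullet> ((transpose (mat_of f) ** mat_of f) *v x) = ((mat_of f *v x) v* mat_of f) \<bullet> x"
      by (simp add: matrix_vector_mul_assoc[symmetric] inner_commute)
    thus ?thesis by (simp add: dot_lmul_matrix mv[OF that] ii power2_norm_eq_inner)
  qed
  show ?thesis
    unfolding gram_mat_def
    using q[OF linear_compose[OF linear_coord_proj assms]] q[OF linear_coord_proj]
    by (simp add: matrix_vector_mult_add_rdistrib inner_add_right)
qed

text \<open>The padded Gram matrix is positive definite, and so is every point of the segment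
  joining it to the identity. A nonpositive determinant at the far end would, by the intermediate
  value theorem, force a singular matrix somewhere on the segment.\<close>

lemma det_gram_mat_pos:
  fixes L :: "'a::euclidean_space \<Rightarrow> 'a"
  assumes I: "I \<subseteq> Basis" and L: "linear L" and inj: "\<And>x. x \<in> span I \<Longrightarrow> L x = 0 \<Longrightarrow> x = 0"
  shows "det (gram_mat I L) > 0"
proof (rule ccontr)
  assume neg: "\<not> det (gram_mat I L) > 0"
  define G where "G t = t *\<^sub>R gram_mat I L + (1 - t) *\<^sub>R mat 1" for t :: real
  have "continuous_on {0..1} (\<lambda>t. det (G t))"
    unfolding det_def G_def by (intro continuous_intros)
  moreover have "det (G 1) \<le> 0" "det (G 0) = 1" using neg by (auto simp: G_def)
  ultimately obtain t where t: "0 \<le> t" "t \<le> 1" "det (G t) = 0"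
    using IVT2'[of "\<lambda>t. det (G t)" 1 0 0] by auto
  then obtain x where x: "x \<noteq> 0" "G t *v x = 0"
    using invertible_det_nz[of "G t"] 
    by (auto simp: invertible_left_inverse matrix_left_invertible_ker)
  define y where "y = from_cart x"
  have y: "y \<noteq> 0" using x(1) unfolding y_def
    by (metis linear_0[OF linear_to_cart] to_from_cart)
  have "x \<bullet> (G t *v x) = t * ((norm (L (coord_proj I y)))\<^sup>2 + (norm (coord_proj (Basis - I) y))\<^sup>2)
      + (1 - t) * (norm x)\<^sup>2"
    unfolding G_def y_def inner_gram_mat[OF L, symmetric]
    by (simp add: matrix_vector_mult_add_rdistrib inner_add_right scaleR_matrix_vector_assoc[symmetric]
        power2_norm_eq_inner)
  hence z: "t * ((norm (L (coord_proj I y)))\<^sup>2 + (norm (coord_proj (Basis - I) y))\<^sup>2) + (1 - t) * (norm x)\<^sup>2 = 0"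
    using x(2) by simp
  have "(norm (L (coord_proj I y)))\<^sup>2 + (norm (coord_proj (Basis - I) y))\<^sup>2 > 0"
  proof (rule ccontr)
    assume "\<not> ?thesis"
    hence "L (coord_proj I y) = 0" "coord_proj (Basis - I) y = 0"
      by (smt (verit) zero_le_power2 zero_less_power2 norm_eq_zero)+
    moreover from this have "coord_proj I y = 0" using inj[OF coord_proj_in_span] by blast
    ultimately have "y = 0" using coord_proj_compl[OF I, of y] by simp
    thus False using y by simp
  qed
  moreover have "(norm x)\<^sup>2 > 0" using x(1) by simp
  ultimately show False using z t
    by (smt (verit) mult_nonneg_nonneg mult_pos_pos)
qed

section \<open>Lebesgue measure on coordinate subspaces\<close>

interpretation lborel_prod: product_sigma_finite "\<lambda>_. lborel :: real measure"
  by standard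

lemma finite_Basis_subset: "I \<subseteq> Basis \<Longrightarrow> finite I"
  by (rule finite_subset[OF _ finite_Basis])

lemma sets_lborel_span [simp, measurable_cong]: "sets (lborel_span I) = sets borel"
  by (simp add: lborel_span_def)

lemma space_lborel_span [simp]: "space (lborel_span I) = UNIV"
  by (simp add: lborel_span_def)

lemma measurable_span_sum [measurable]:
  fixes I :: "'a::euclidean_space set"
  shows "(\<lambda>f. \<Sum>b\<in>I. f b *\<^sub>R b) \<in> Pi\<^sub>M I (\<lambda>_. lborel :: real measure) \<rightarrow>\<^sub>M borel"
  by (intro borel_measurable_sum borel_measurable_scaleR borel_measurable_const) simp

lemma nn_integral_lborel_span:
  assumes "f \<in> borel_measurable borel"
  shows "(\<integral>\<^sup>+v. f v \<partial>lborel_span I) = (\<integral>\<^sup>+x. f (\<Sum>b\<in>I. x b *\<^sub>R b) \<partial>Pi\<^sub>M I (\<lambda>_. lborel))"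
  unfolding lborel_span_def using assms by (subst nn_integral_distr) auto

lemma nn_integral_lborel_span_insert:
  assumes [measurable]: "f \<in> borel_measurable borel" and I: "finite I" "b \<notin> I"
  shows "(\<integral>\<^sup>+v. f v \<partial>lborel_span (insert b I)) = (\<integral>\<^sup>+x. (\<integral>\<^sup>+w. f (x *\<^sub>R b + w) \<partial>lborel_span I) \<partial>lborel)"
proof -
  have "(\<integral>\<^sup>+v. f v \<partial>lborel_span (insert b I)) =
     (\<integral>\<^sup>+x. (\<integral>\<^sup>+y. f (\<Sum>c\<in>insert b I. (y(b := x)) c *\<^sub>R c) \<partial>Pi\<^sub>M I (\<lambda>_. lborel)) \<partial>lborel)"
    unfolding nn_integral_lborel_span[OF assms(1)]
    by (rule lborel_prod.product_nn_integral_insert_rev[OF I]) simp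
  also have "\<dots> = (\<integral>\<^sup>+x. (\<integral>\<^sup>+y. f (x *\<^sub>R b + (\<Sum>c\<in>I. y c *\<^sub>R c)) \<partial>Pi\<^sub>M I (\<lambda>_. lborel)) \<partial>lborel)"
  proof (intro nn_integral_cong arg_cong[of _ _ f])
    fix x :: real and y :: "'a \<Rightarrow> real"
    have "(\<Sum>c\<in>I. (y(b := x)) c *\<^sub>R c) = (\<Sum>c\<in>I. y c *\<^sub>R c)"
      using I by (intro sum.cong) auto
    thus "(\<Sum>c\<in>insert b I. (y(b := x)) c *\<^sub>R c) = x *\<^sub>R b + (\<Sum>c\<in>I. y c *\<^sub>R c)"
      using I by simp
  qed
  also have "\<dots> = (\<integral>\<^sup>+x. (\<integral>\<^sup>+w. f (x *\<^sub>R b + w) \<partial>lborel_span I) \<partial>lborel)"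
    by (intro nn_integral_cong nn_integral_lborel_span[symmetric]) simp
  finally show ?thesis .
qed

lemma nn_integral_lborel_span_empty:
  "f \<in> borel_measurable borel \<Longrightarrow> (\<integral>\<^sup>+v. f v \<partial>lborel_span {}) = f 0"
  by (simp add: nn_integral_lborel_span PiM_empty nn_integral_count_space_finite)

lemma emeasure_lborel_span_cube:
  assumes I: "I \<subseteq> Basis" and le: "l \<le> u"
  shows "emeasure (lborel_span I) {x. \<forall>b\<in>I. l \<le> x \<bullet> b \<and> x \<bullet> b \<le> u} = ennreal (u - l) ^ card I"
proof -
  have fin: "finite I" using finite_Basis_subset[OF I] .
  have meas: "{x. \<forall>b\<in>I. l \<le> x \<bullet> b \<and> x \<bullet> b \<le> u} \<in> sets borel"
    using fin by simp
  have "(\<lambda>f. \<Sum>b\<in>I. f b *\<^sub>R b) -` {x. \<forall>b\<in>I. l \<le> x \<bullet> b \<and> x \<bullet> b \<le> u} \<inter> space (Pi\<^sub>M I (\<lambda>_. lborel)) =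
      Pi\<^sub>E I (\<lambda>_. {l..u})"
  proof -
    have "(\<Sum>c\<in>I. f c *\<^sub>R c) \<bullet> b = f b" if "b \<in> I" for f b
    proof -
      have "(\<Sum>c\<in>I. f c *\<^sub>R c) \<bullet> b = (\<Sum>c\<in>I. if c = b then f b else 0)"
        unfolding inner_sum_left using that I by (intro sum.cong) (auto simp: inner_Basis subset_iff)
      thus ?thesis using that fin by simp
    qed
    thus ?thesis by (auto simp: space_PiM PiE_def Pi_def)
  qed
  hence "emeasure (lborel_span I) {x. \<forall>b\<in>I. l \<le> x \<bullet> b \<and> x \<bullet> b \<le> u} = 
      emeasure (Pi\<^sub>M I (\<lambda>_. lborel)) (Pi\<^sub>E I (\<lambda>_. {l..u}))"
    unfolding lborel_span_def by (subst emeasure_distr[OF measurable_span_sum meas]) simp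
  also have "\<dots> = (\<Prod>b\<in>I. emeasure lborel {l..u})"
    by (rule lborel_prod.emeasure_PiM[OF fin]) simp
  finally show ?thesis using le by simp
qed

lemma AE_lborel_span: "AE v in lborel_span I. v \<in> span I" if I: "I \<subseteq> Basis"
proof -
  have "{v \<in> space borel. v \<in> span I} \<in> sets borel"
    using closed_span[of I] by (simp add: borel_closed)
  thus ?thesis
    unfolding lborel_span_def
    by (subst AE_distr_iff) (auto intro!: AE_I2 span_sum span_scale intro: span_base)
qed

lemma emeasure_lborel_span_bounded:
  assumes I: "I \<subseteq> Basis" and "bounded A"
  shows "emeasure (lborel_span I) A < \<infinity>"
proof -
  obtain r where r: "\<And>x. x \<in> A \<Longrightarrow> norm x \<le> r" "r > 0" using assms(2) bounded_pos by metis
  have "A \<subseteq> {x. \<forall>b\<in>I. - r \<le> x \<bullet> b \<and> x \<bullet> b \<le> r}"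
  proof safe
    fix x b assume "x \<in> A" "b \<in> I"
    hence "\<bar>x \<bullet> b\<bar> \<le> r" using Basis_le_norm[of b x] r(1)[of x] I by auto
    thus "- r \<le> x \<bullet> b" "x \<bullet> b \<le> r" by auto
  qed
  moreover have "{x. \<forall>b\<in>I. - r \<le> x \<bullet> b \<and> x \<bullet> b \<le> r} \<in> sets borel"
    using finite_Basis_subset[OF I] by simp
  ultimately have "emeasure (lborel_span I) A \<le> emeasure (lborel_span I) {x. \<forall>b\<in>I. - r \<le> x \<bullet> b \<and> x \<bullet> b \<le> r}"
    by (intro emeasure_mono) auto
  also have "\<dots> < \<infinity>"
    by (subst emeasure_lborel_span_cube) (use I r in \<open>auto simp: power_less_top_ennreal\<close>)
  finally show ?thesis .
qed

lemma sigma_finite_lborel_span: "I \<subseteq> Basis \<Longrightarrow> sigma_finite_measure (lborel_span I)"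
proof
  assume I: "I \<subseteq> Basis"
  show "\<exists>A. countable A \<and> A \<subseteq> sets (lborel_span I) \<and> \<Union>A = space (lborel_span I) \<and>
      (\<forall>a\<in>A. emeasure (lborel_span I) a \<noteq> \<infinity>)"
  proof (intro exI[of _ "range (\<lambda>n. cball 0 (real n))"] conjI ballI)
    show "\<Union> (range (\<lambda>n. cball 0 (real n))) = space (lborel_span I)"
      by (auto intro: real_arch_simple)
    fix a assume "a \<in> range (\<lambda>n. cball (0::'a) (real n))"
    thus "emeasure (lborel_span I) a \<noteq> \<infinity>"
      using emeasure_lborel_span_bounded[OF I, of a] by auto
  qed auto
qed

lemma nn_integral_lborel_span_Un:
  assumes "finite J" "I \<union> J \<subseteq> Basis" "I \<inter> J = {}" and f [measurable]: "f \<in> borel_measurable borel"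
  shows "(\<integral>\<^sup>+v. f v \<partial>lborel_span (I \<union> J)) = (\<integral>\<^sup>+u. (\<integral>\<^sup>+w. f (u + w) \<partial>lborel_span I) \<partial>lborel_span J)"
  using assms
proof (induction J arbitrary: f rule: finite_induct)
  case empty
  interpret sigma_finite_measure "lborel_span I" using empty by (intro sigma_finite_lborel_span) auto
  have [measurable]: "f \<in> borel_measurable borel" by fact
  show ?case
    by (subst nn_integral_lborel_span_empty) auto
next
  case (insert b J)
  have [measurable]: "f \<in> borel_measurable borel" by fact
  interpret sigma_finite_measure "lborel_span I" using insert by (intro sigma_finite_lborel_span) auto
  have fin: "finite I" using insert.prems finite_Basis_subset[of "I \<union> insert b J"] by auto
  have "(\<integral>\<^sup>+v. f v \<partial>lborel_span (I \<union> insert b J)) = (\<integral>\<^sup>+x. (\<integral>\<^sup>+w. f (x *\<^sub>R b + w) \<partial>lborel_span (I \<union> J)) \<partial>lborel)"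
    using insert fin by (subst nn_integral_lborel_span_insert[symmetric]) auto
  also have "\<dots> = (\<integral>\<^sup>+x. (\<integral>\<^sup>+u. (\<integral>\<^sup>+w. f (x *\<^sub>R b + (u + w)) \<partial>lborel_span I) \<partial>lborel_span J) \<partial>lborel)"
    using insert.prems by (intro nn_integral_cong insert.IH) auto
  also have "\<dots> = (\<integral>\<^sup>+x. (\<integral>\<^sup>+u. (\<integral>\<^sup>+w. f ((x *\<^sub>R b + u) + w) \<partial>lborel_span I) \<partial>lborel_span J) \<partial>lborel)"
    by (simp add: add.assoc)
  also have "\<dots> = (\<integral>\<^sup>+u. (\<integral>\<^sup>+w. f (u + w) \<partial>lborel_span I) \<partial>lborel_span (insert b J))"
    using insert by (subst nn_integral_lborel_span_insert) auto
  finally show ?case .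
qed

lemma lborel_span_Basis: "lborel_span Basis = lborel"
  by (simp add: lborel_span_def lborel_eq[symmetric])

lemma nn_integral_lborel_split:
  fixes f :: "'a::euclidean_space \<Rightarrow> ennreal"
  assumes "I \<subseteq> Basis" "f \<in> borel_measurable borel"
  shows "(\<integral>\<^sup>+v. f v \<partial>lborel) = (\<integral>\<^sup>+u. (\<integral>\<^sup>+w. f (u + w) \<partial>lborel_span (Basis - I)) \<partial>lborel_span I)"
  using nn_integral_lborel_span_Un[of I "Basis - I" f] assms finite_Basis_subset[OF assms(1)]
  by (simp add: lborel_span_Basis[symmetric] Un_absorb2 Int_commute[of _ I])

text \<open>Thickening by a unit cube in the complementary directions turns integrals over a coordinate
  subspace into integrals over the whole space, where the change of variables formula is available.\<close>
lemma nn_integral_lborel_span_thicken: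
  fixes f :: "'a::euclidean_space \<Rightarrow> ennreal"
  assumes I: "I \<subseteq> Basis" and [measurable]: "f \<in> borel_measurable borel"
  shows "(\<integral>\<^sup>+v. f v \<partial>lborel_span I) =
     (\<integral>\<^sup>+x. f (coord_proj I x) * indicator {x. \<forall>b\<in>Basis - I. 0 \<le> x \<bullet> b \<and> x \<bullet> b \<le> 1} x \<partial>lborel)"
proof -
  define Q where "Q = {x::'a. \<forall>b\<in>Basis - I. 0 \<le> x \<bullet> b \<and> x \<bullet> b \<le> 1}"
  have [measurable]: "Q \<in> sets borel" unfolding Q_def by simp
  have Q1: "emeasure (lborel_span (Basis - I)) Q = 1"
    unfolding Q_def by (subst emeasure_lborel_span_cube) auto
  have "(\<integral>\<^sup>+x. f (coord_proj I x) * indicator Q x \<partial>lborel) =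
      (\<integral>\<^sup>+u. (\<integral>\<^sup>+w. f (coord_proj I (u + w)) * indicator Q (u + w) \<partial>lborel_span (Basis - I)) \<partial>lborel_span I)"
    by (rule nn_integral_lborel_split[OF I]) simp
  also have "\<dots> = (\<integral>\<^sup>+u. (\<integral>\<^sup>+w. f u * indicator Q w \<partial>lborel_span (Basis - I)) \<partial>lborel_span I)"
  proof (intro nn_integral_cong_AE)
    show "AE u in lborel_span I. (\<integral>\<^sup>+w. f (coord_proj I (u + w)) * indicator Q (u + w) \<partial>lborel_span (Basis - I)) =
       (\<integral>\<^sup>+w. f u * indicator Q w \<partial>lborel_span (Basis - I))"
      using AE_lborel_span[OF I]
    proof eventually_elim
      case (elim u)
      have u0: "u \<bullet> b = 0" if "b \<in> Basis - I" for b
        using coord_proj_inner[OF I, of b u] coord_proj_span[OF I elim] that by auto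
      have "AE w in lborel_span (Basis - I). w \<in> span (Basis - I)" by (rule AE_lborel_span) auto
      thus ?case
      proof (intro nn_integral_cong_AE, eventually_elim)
        fix w assume w: "w \<in> span (Basis - I)"
        show "f (coord_proj I (u + w)) * indicator Q (u + w) = f u * indicator Q w"
          using coord_proj_add_span[OF I \<open>u \<in> span I\<close> w] u0
          by (auto simp: Q_def inner_add_left split: split_indicator)
      qed
    qed
  qed
  also have "\<dots> = (\<integral>\<^sup>+u. f u \<partial>lborel_span I)"
    by (subst nn_integral_cmult_indicator) (auto simp: Q1)
  finally show ?thesis by (simp add: Q_def)
qed

text \<open>One coordinate at a time; each application of the one-dimensional substitution rule
  contributes a factor \<open>s\<close>.\<close>

lemma nn_integral_lborel_span_affine:
  assumes "finite I" "I \<subseteq> Basis" "f \<in> borel_measurable borel" and s: "s > 0" and "t \<in> span I"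
  shows "(\<integral>\<^sup>+v. f v \<partial>lborel_span I) = ennreal s ^ card I * (\<integral>\<^sup>+v. f (t + s *\<^sub>R v) \<partial>lborel_span I)"
  using assms(1-3,5)
proof (induction I arbitrary: f t rule: finite_induct)
  case empty
  have [measurable]: "f \<in> borel_measurable borel" by fact
  show ?case using empty
    by (simp add: nn_integral_lborel_span_empty)
next
  case (insert b I)
  have [measurable]: "f \<in> borel_measurable borel" by fact
  interpret sigma_finite_measure "lborel_span I" using insert by (intro sigma_finite_lborel_span) auto
  \<comment> \<open>The translation is split into its component along the new basis vector and a
    remainder in \<open>span I\<close>, to which the induction hypothesis applies.\<close>
  obtain k where k: "t - k *\<^sub>R b \<in> span I" using insert.prems span_breakdown_eq by metis
  have "(\<integral>\<^sup>+v. f v \<partial>lborel_span (insert b I)) = (\<integral>\<^sup>+x. (\<integral>\<^sup>+w. f (x *\<^sub>R b + w) \<partial>lborel_span I) \<partial>lborel)"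
    using insert by (intro nn_integral_lborel_span_insert) auto
  also have "\<dots> = (\<integral>\<^sup>+x. ennreal s ^ card I * 
      (\<integral>\<^sup>+w. f (x *\<^sub>R b + ((t - k *\<^sub>R b) + s *\<^sub>R w)) \<partial>lborel_span I) \<partial>lborel)"
    using insert.prems k by (intro nn_integral_cong insert.IH) auto
  also have "\<dots> = ennreal s ^ card I * (\<integral>\<^sup>+x. 
      (\<integral>\<^sup>+w. f (x *\<^sub>R b + ((t - k *\<^sub>R b) + s *\<^sub>R w)) \<partial>lborel_span I) \<partial>lborel)"
    by (intro nn_integral_cmult) measurable
  also have "(\<integral>\<^sup>+x. (\<integral>\<^sup>+w. f (x *\<^sub>R b + ((t - k *\<^sub>R b) + s *\<^sub>R w)) \<partial>lborel_span I) \<partial>lborel) =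
     ennreal s * (\<integral>\<^sup>+x. (\<integral>\<^sup>+w. f ((k + s * x) *\<^sub>R b + ((t - k *\<^sub>R b) + s *\<^sub>R w)) \<partial>lborel_span I) \<partial>lborel)"
    using s by (subst nn_integral_real_affine[where c = s and t = k]) auto
  also have "\<dots> = ennreal s * (\<integral>\<^sup>+x. (\<integral>\<^sup>+w. f (t + s *\<^sub>R (x *\<^sub>R b + w)) \<partial>lborel_span I) \<partial>lborel)"
    by (simp add: algebra_simps)
  also have "(\<integral>\<^sup>+x. (\<integral>\<^sup>+w. f (t + s *\<^sub>R (x *\<^sub>R b + w)) \<partial>lborel_span I) \<partial>lborel) =
      (\<integral>\<^sup>+v. f (t + s *\<^sub>R v) \<partial>lborel_span (insert b I))"
    using insert by (intro nn_integral_lborel_span_insert[symmetric]) auto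
  finally show ?case using insert by (simp add: mult_ac)
qed

text \<open>Dilation by 2 fixes the origin but multiplies the measure by \<open>2 ^ card I\<close>,
  which exceeds 1; a finite mass can only survive this if it is 0. In dimension 0 the measure is a
  unit mass at the origin, hence the assumption on \<open>I\<close>.\<close>

lemma emeasure_lborel_span_singleton_0:
  fixes I :: "'a::euclidean_space set"
  assumes I: "I \<subseteq> Basis" "I \<noteq> {}"
  shows "emeasure (lborel_span I) {0} = 0"
proof -
  have fin: "finite I" using finite_Basis_subset[OF I(1)] .
  have "emeasure (lborel_span I) {0} = (\<integral>\<^sup>+v. indicator {0} v \<partial>lborel_span I)" by simp
  also have "\<dots> = ennreal 2 ^ card I * (\<integral>\<^sup>+v. indicator {0} (0 + 2 *\<^sub>R v) \<partial>lborel_span I)"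
    by (rule nn_integral_lborel_span_affine) (use I fin span_zero in auto)
  also have "(\<lambda>v::'a. indicator {0} (0 + 2 *\<^sub>R v) :: ennreal) = indicator {0}"
    by (auto split: split_indicator)
  finally have eq: "emeasure (lborel_span I) {0} = ennreal (2 ^ card I) * emeasure (lborel_span I) {0}" 
    by (simp flip: ennreal_power)
  obtain r where r: "emeasure (lborel_span I) {0} = ennreal r" "r \<ge> 0"
    using emeasure_lborel_span_bounded[OF I(1), of "{0}"] by (cases "emeasure (lborel_span I) {0}" rule: ennreal_cases) auto
  have "(2::real) ^ card I > 1" using I fin by (intro one_less_power) (auto simp: card_gt_0_iff)
  moreover have "r = 2 ^ card I * r" using eq r by (simp add: ennreal_mult[symmetric])
  ultimately have "r = 0" by simp
  thus ?thesis using r by simp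
qed

text \<open>The conditions describe the interval from \<open>r / exp 1\<close> to \<open>r\<close>,
  whose length for \<open>ds / s\<close> is 1. This normalization is the reason for the outer radius
  \<open>exp 1\<close> of the annulus of directions.\<close>

lemma nn_integral_inverse_annulus:
  assumes "r > (0::real)"
  shows "(\<integral>\<^sup>+s. indicator {0<..} s * indicator {1..exp 1} (r / s) * ennreal (1 / s) \<partial>lborel) = 1"
proof -
  have "(\<integral>\<^sup>+s. indicator {0<..} s * indicator {1..exp 1} (r / s) * ennreal (1 / s) \<partial>lborel) =
      (\<integral>\<^sup>+s. ennreal (1 / s) * indicator {r / exp 1..r} s \<partial>lborel)"
  proof (intro nn_integral_cong)
    fix s :: real
    show "indicator {0<..} s * indicator {1..exp 1} (r / s) * ennreal (1 / s) =
       ennreal (1 / s) * indicator {r / exp 1..r} s"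
    proof (cases "s > 0")
      case True
      thus ?thesis using assms by (auto simp: field_simps split: split_indicator)
    next
      case False
      moreover have "r / exp 1 > 0" using assms by simp
      ultimately show ?thesis by (auto split: split_indicator)
    qed
  qed
  also have "\<dots> = ennreal (ln r - ln (r / exp 1))"
  proof (rule nn_integral_FTC_Icc)
    fix x assume "x \<in> {r / exp 1..r}"
    moreover have "r / exp 1 > 0" using assms by simp
    ultimately have "x > 0" unfolding atLeastAtMost_iff by linarith
    thus "(ln has_real_derivative 1 / x) (at x)" "0 \<le> 1 / x"
      by (auto intro!: DERIV_ln_divide)
  next
    show "r / exp 1 \<le> r" using assms by (simp add: field_simps)
  qed simp
  also have "ln r - ln (r / exp 1) = 1" using assms by (simp add: ln_div)
  finally show ?thesis by simp
qed

text \<open>A substitute for polar coordinates that needs no measure on the sphere: the direction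
  \<open>u\<close> ranges over the annulus \<open>1 \<le> norm u \<le> exp 1\<close>, and every point \<open>w \<noteq> 0\<close> is hit by the pairs
  \<open>(s, w / s)\<close>, a set of \<open>ds / s\<close>-measure one.\<close>
lemma nn_integral_lborel_span_radial:
  fixes I :: "'a::euclidean_space set"
  assumes I: "I \<subseteq> Basis" "I \<noteq> {}" and [measurable]: "h \<in> borel_measurable borel"
  shows "(\<integral>\<^sup>+w. h w \<partial>lborel_span I) =
    (\<integral>\<^sup>+u. indicator {u. 1 \<le> norm u \<and> norm u \<le> exp 1} u *
       (\<integral>\<^sup>+s. h (s *\<^sub>R u) * ennreal (s ^ (card I - 1)) * indicator {0<..} s \<partial>lborel) \<partial>lborel_span I)"
proof -
  define A where "A = {u::'a. 1 \<le> norm u \<and> norm u \<le> exp 1}"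
  have [measurable]: "A \<in> sets borel" unfolding A_def by simp
  have fin: "finite I" using finite_Basis_subset[OF I(1)] .
  interpret S: sigma_finite_measure "lborel_span I" by (rule sigma_finite_lborel_span[OF I(1)])
  interpret P: pair_sigma_finite lborel "lborel_span I" ..
  define k where "k s u = indicator A u * (h (s *\<^sub>R u) * ennreal (s ^ (card I - 1)) * indicator {0<..} s)"
    for s and u :: 'a
  have [measurable]: "(\<lambda>(s, u). k s u) \<in> borel_measurable (lborel \<Otimes>\<^sub>M lborel_span I)"
    unfolding k_def by measurable
  have "(\<integral>\<^sup>+u. indicator A u * (\<integral>\<^sup>+s. h (s *\<^sub>R u) * ennreal (s ^ (card I - 1)) * indicator {0<..} s \<partial>lborel) \<partial>lborel_span I)
     = (\<integral>\<^sup>+u. (\<integral>\<^sup>+s. k s u \<partial>lborel) \<partial>lborel_span I)"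
    unfolding k_def by (intro nn_integral_cong nn_integral_cmult[symmetric]) measurable
  also have "\<dots> = (\<integral>\<^sup>+s. (\<integral>\<^sup>+u. k s u \<partial>lborel_span I) \<partial>lborel)"
    by (rule P.Fubini') measurable
  also have "\<dots> = (\<integral>\<^sup>+s. (\<integral>\<^sup>+w. h w * (indicator {0<..} s * indicator {1..exp 1} (norm w / s) * ennreal (1 / s))
      \<partial>lborel_span I) \<partial>lborel)"
  proof (rule nn_integral_cong)
    fix s :: real
    show "(\<integral>\<^sup>+u. k s u \<partial>lborel_span I) =
      (\<integral>\<^sup>+w. h w * (indicator {0<..} s * indicator {1..exp 1} (norm w / s) * ennreal (1 / s)) \<partial>lborel_span I)"
    proof (cases "s > 0")
      case True
      \<comment> \<open>Scaling by \<open>s\<close> produces \<open>s ^ card I\<close>; together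
        with the factor \<open>1 / s\<close> on the left this is exactly the polar weight
        \<open>s ^ (card I - 1)\<close>.\<close>
      have "(\<integral>\<^sup>+w. h w * (indicator {0<..} s * indicator {1..exp 1} (norm w / s) * ennreal (1 / s)) \<partial>lborel_span I)
        = ennreal s ^ card I * (\<integral>\<^sup>+u. h (0 + s *\<^sub>R u) * (indicator {0<..} s * 
            indicator {1..exp 1} (norm (0 + s *\<^sub>R u) / s) * ennreal (1 / s)) \<partial>lborel_span I)"
        by (rule nn_integral_lborel_span_affine[OF fin I(1) _ True span_zero]) measurable
      also have "\<dots> = (\<integral>\<^sup>+u. ennreal s ^ card I * (h (0 + s *\<^sub>R u) * (indicator {0<..} s * 
            indicator {1..exp 1} (norm (0 + s *\<^sub>R u) / s) * ennreal (1 / s))) \<partial>lborel_span I)"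
        by (intro nn_integral_cmult[symmetric]) measurable
      also have "\<dots> = (\<integral>\<^sup>+u. k s u \<partial>lborel_span I)"
      proof (intro nn_integral_cong)
        fix u :: 'a
        have "card I > 0" using I fin by (simp add: card_gt_0_iff)
        then obtain n where n: "card I = Suc n" using gr0_implies_Suc by blast
        have "ennreal s ^ Suc n * ennreal (1 / s) = ennreal (s ^ Suc n * (1 / s))"
          using True by (simp only: ennreal_power ennreal_mult zero_le_power less_imp_le
              zero_le_divide_1_iff)
        hence "ennreal s ^ card I * ennreal (1 / s) = ennreal (s ^ (card I - 1))"
          using True by (simp add: n)
        hence eq: "ennreal s ^ card I * (x * ennreal (1 / s)) = x * ennreal (s ^ (card I - 1))" for x
          by (metis mult.assoc mult.commute)
        show "ennreal s ^ card I * (h (0 + s *\<^sub>R u) * (indicator {0<..} s * 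
            indicator {1..exp 1} (norm (0 + s *\<^sub>R u) / s) * ennreal (1 / s))) = k s u"
          using True eq[of "h (s *\<^sub>R u)"] by (auto simp: k_def A_def split: split_indicator)
      qed
      finally show ?thesis by simp
    next
      case False
      thus ?thesis by (simp add: k_def)
    qed
  qed
  also have "\<dots> = (\<integral>\<^sup>+w. (\<integral>\<^sup>+s. h w * (indicator {0<..} s * indicator {1..exp 1} (norm w / s) * ennreal (1 / s))
      \<partial>lborel) \<partial>lborel_span I)"
    by (rule P.Fubini'[symmetric]) measurable
  also have "\<dots> = (\<integral>\<^sup>+w. h w \<partial>lborel_span I)"
  proof (intro nn_integral_cong_AE)
    \<comment> \<open>Open rays miss the origin, which is a null set because the dimension is
      positive.\<close>
    have "AE w in lborel_span I. w \<noteq> 0"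
      using emeasure_lborel_span_singleton_0[OF I] by (intro AE_I[of _ _ "{0}"]) auto
    thus "AE w in lborel_span I. (\<integral>\<^sup>+s. h w * (indicator {0<..} s * indicator {1..exp 1} (norm w / s) * ennreal (1 / s))
      \<partial>lborel) = h w"
    proof eventually_elim
      case (elim w)
      thus ?case using nn_integral_inverse_annulus[of "norm w"]
        by (subst nn_integral_cmult) auto
    qed
  qed
  finally show ?thesis by (simp add: A_def)
qed

section \<open>Charts\<close>

lemma smooth_on_imp_has_derivative:
  assumes "smooth_on S f" "x \<in> S"
  shows "(f has_derivative frechet_derivative f (at x)) (at x)"
  using assms unfolding smooth_on_def
  by (metis Ck_on.simps(2) frechet_derivative_works)

lemma smooth_on_imp_differentiable: "smooth_on S f \<Longrightarrow> x \<in> S \<Longrightarrow> f differentiable (at x)"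
  using smooth_on_imp_has_derivative unfolding differentiable_def by blast

lemma smooth_on_frechet_derivative: "smooth_on S f \<Longrightarrow> smooth_on S (\<lambda>x. frechet_derivative f (at x) v)"
  unfolding smooth_on_def by (metis Ck_on.simps(2))

lemma smooth_on_imp_continuous_on: "smooth_on S f \<Longrightarrow> continuous_on S f"
  unfolding smooth_on_def by (metis Ck_on.simps(1))

lemma slice_chartD:
  assumes "slice_chart m M I U V \<phi> \<psi>"
  shows "I \<subseteq> Basis" "card I = m" "open U" "open V" "smooth_on U \<phi>" "smooth_on V \<psi>"
    "\<And>x. x \<in> U \<Longrightarrow> \<phi> x \<in> V" "\<And>v. v \<in> V \<Longrightarrow> \<psi> v \<in> U"
    "\<And>x. x \<in> U \<Longrightarrow> \<psi> (\<phi> x) = x" "\<And>v. v \<in> V \<Longrightarrow> \<phi> (\<psi> v) = v"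
    "continuous_on U \<phi>" "continuous_on V \<psi>"
    "\<phi> ` (M \<inter> U) = V \<inter> span I"
proof -
  have h: "homeomorphism U V \<phi> \<psi>" and "I \<subseteq> Basis" "card I = m" "open U" "open V" "smooth_on U \<phi>" "smooth_on V \<psi>"
    "\<phi> ` (M \<inter> U) = V \<inter> span I"
    using assms unfolding slice_chart_def by blast+
  thus "I \<subseteq> Basis" "card I = m" "open U" "open V" "smooth_on U \<phi>" "smooth_on V \<psi>"
    "\<phi> ` (M \<inter> U) = V \<inter> span I" by blast+
  show "\<And>x. x \<in> U \<Longrightarrow> \<phi> x \<in> V" "\<And>v. v \<in> V \<Longrightarrow> \<psi> v \<in> U"
    "\<And>x. x \<in> U \<Longrightarrow> \<psi> (\<phi> x) = x" "\<And>v. v \<in> V \<Longrightarrow> \<phi> (\<psi> v) = v"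
    "continuous_on U \<phi>" "continuous_on V \<psi>"
    using h unfolding homeomorphism_def by auto
qed

lemma slice_chart_image:
  assumes "slice_chart m M I U V \<phi> \<psi>" "A \<subseteq> U"
  shows "\<phi> ` A = {v \<in> V. \<psi> v \<in> A}"
proof (intro equalityI subsetI)
  fix v assume "v \<in> \<phi> ` A"
  then obtain x where x: "x \<in> A" "v = \<phi> x" by blast
  thus "v \<in> {v \<in> V. \<psi> v \<in> A}"
    using slice_chartD(7,9)[OF assms(1), of x] assms(2) by auto
next
  fix v assume "v \<in> {v \<in> V. \<psi> v \<in> A}"
  thus "v \<in> \<phi> ` A" using slice_chartD(10)[OF assms(1), of v] by (metis (no_types, lifting) image_eqI mem_Collect_eq)
qed

lemma slice_chart_image_borel:
  assumes "slice_chart m M I U V \<phi> \<psi>" "A \<subseteq> U" "A \<in> sets borel"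
  shows "\<phi> ` A \<in> sets borel"
proof -
  note D = slice_chartD[OF assms(1)]
  have V: "V \<in> sets borel" using D(4) by (rule borel_open)
  have "\<psi> \<in> borel_measurable (restrict_space borel V)"
    by (rule borel_measurable_continuous_on_restrict[OF D(12)])
  hence "\<psi> -` A \<inter> V \<in> sets (restrict_space borel V)"
    using measurable_sets[of \<psi> "restrict_space borel V" borel A] assms(3) by (simp add: space_restrict_space)
  hence "\<psi> -` A \<inter> V \<in> sets borel"
    using V by (subst (asm) sets_restrict_space_iff) auto
  moreover have "\<phi> ` A = \<psi> -` A \<inter> V" using slice_chart_image[OF assms(1,2)] by auto
  ultimately show ?thesis by simp
qed

lemma slice_chart_derivative_inverse:
  assumes c: "slice_chart m M I U V \<phi> \<psi>" and v: "v \<in> V"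
  shows "frechet_derivative \<phi> (at (\<psi> v)) (frechet_derivative \<psi> (at v) x) = x"
proof -
  note D = slice_chartD[OF c]
  have "(\<phi> \<circ> \<psi> has_derivative frechet_derivative \<phi> (at (\<psi> v)) \<circ> frechet_derivative \<psi> (at v)) (at v)"
    by (intro diff_chain_at smooth_on_imp_has_derivative[OF D(6) v] smooth_on_imp_has_derivative[OF D(5) D(8)[OF v]])
  hence "(id has_derivative frechet_derivative \<phi> (at (\<psi> v)) \<circ> frechet_derivative \<psi> (at v)) (at v)"
    by (rule has_derivative_transform_within_open[OF _ D(4) v]) (simp add: D)
  hence "frechet_derivative \<phi> (at (\<psi> v)) \<circ> frechet_derivative \<psi> (at v) = id"
    using has_derivative_unique has_derivative_id by blast
  thus ?thesis by (metis comp_apply id_apply)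
qed

text \<open>The derivative of \<psi> has the derivative of \<phi> as a left inverse, so it is
  injective and its Gram determinant is positive.\<close>

lemma slice_chart_gram_pos:
  assumes c: "slice_chart m M I U V \<phi> \<psi>" and v: "v \<in> V"
  shows "gram_det I \<psi> v > 0"
proof -
  note D = slice_chartD[OF c]
  have diff: "\<psi> differentiable (at v)" "\<phi> differentiable (at (\<psi> v))"
    using smooth_on_imp_differentiable[OF D(6) v] smooth_on_imp_differentiable[OF D(5) D(8)[OF v]] by auto
  have "det (gram_mat I (frechet_derivative \<psi> (at v))) > 0"
  proof (rule det_gram_mat_pos[OF D(1) linear_frechet_derivative[OF diff(1)]])
    fix x assume "frechet_derivative \<psi> (at v) x = 0"
    thus "x = 0" using slice_chart_derivative_inverse[OF c v, of x] 
      linear_0[OF linear_frechet_derivative[OF diff(2)]] by simp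
  qed
  thus ?thesis using gram_det_eq[OF D(1) diff(1)] by simp
qed

lemma slice_chart_gram_continuous:
  assumes c: "slice_chart m M I U V \<phi> \<psi>"
  shows "continuous_on V (gram_det I \<psi>)"
proof -
  note D = slice_chartD[OF c]
  have "continuous_on V (\<lambda>v. frechet_derivative \<psi> (at v) b)" for b
    using smooth_on_imp_continuous_on[OF smooth_on_frechet_derivative[OF D(6)]] .
  thus ?thesis unfolding gram_det_def[abs_def] by (intro continuous_intros)
qed

lemma slice_chart_density_measurable:
  assumes c: "slice_chart m M I U V \<phi> \<psi>" and "B \<in> sets borel" "B \<subseteq> V"
  shows "(\<lambda>v. indicator B v * sqrt (gram_det I \<psi> v)) \<in> borel_measurable borel"
proof -
  have "continuous_on B (\<lambda>v. sqrt (gram_det I \<psi> v))"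
    using slice_chart_gram_continuous[OF c] assms(3) 
    by (intro continuous_on_real_sqrt) (rule continuous_on_subset)
  from borel_measurable_continuous_on_indicator[OF assms(2) this] show ?thesis by simp
qed

text \<open>The first two claims are the chain rule for the transition map. For the third, a line
  through \<open>v\<close> inside \<open>span I\<close> is mapped for small times into
  \<open>span J\<close>, so its coordinates outside \<open>J\<close> are constantly 0 and their
  derivatives vanish.\<close>

lemma slice_chart_transition:
  assumes c1: "slice_chart m M I U V \<phi> \<psi>" and c2: "slice_chart m M J U' V' \<phi>' \<psi>'"
    and v: "v \<in> V" "v \<in> span I" "\<psi> v \<in> U'"
  defines "D \<equiv> frechet_derivative \<phi>' (at (\<psi> v)) \<circ> frechet_derivative \<psi> (at v)"
  shows "((\<phi>' \<circ> \<psi>) has_derivative D) (at v)"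
    and "frechet_derivative \<psi> (at v) x = frechet_derivative \<psi>' (at (\<phi>' (\<psi> v))) (D x)"
    and "x \<in> span I \<Longrightarrow> D x \<in> span J"
proof -
  note D1 = slice_chartD[OF c1] and D2 = slice_chartD[OF c2]
  define W where "W = V \<inter> \<psi> -` U'"
  have W: "open W" "v \<in> W"
    using continuous_open_preimage[OF D1(12) D1(4) D2(3)] v by (auto simp: W_def)
  show der: "((\<phi>' \<circ> \<psi>) has_derivative D) (at v)"
    unfolding D_def
    by (intro diff_chain_at smooth_on_imp_has_derivative[OF D1(6) v(1)] smooth_on_imp_has_derivative[OF D2(5) v(3)])
  have "(\<psi>' has_derivative frechet_derivative \<psi>' (at (\<phi>' (\<psi> v)))) (at ((\<phi>' \<circ> \<psi>) v))"
    using smooth_on_imp_has_derivative[OF D2(6)] D2(7)[OF v(3)] by simp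
  from diff_chain_at[OF der this]
  have "(\<psi>' \<circ> (\<phi>' \<circ> \<psi>) has_derivative frechet_derivative \<psi>' (at (\<phi>' (\<psi> v))) \<circ> D) (at v)" .
  hence "(\<psi> has_derivative frechet_derivative \<psi>' (at (\<phi>' (\<psi> v))) \<circ> D) (at v)"
    by (rule has_derivative_transform_within_open[OF _ W]) (auto simp: W_def D2)
  hence "frechet_derivative \<psi> (at v) = frechet_derivative \<psi>' (at (\<phi>' (\<psi> v))) \<circ> D"
    using frechet_derivative_at by metis
  thus "frechet_derivative \<psi> (at v) x = frechet_derivative \<psi>' (at (\<phi>' (\<psi> v))) (D x)" by simp
  assume x: "x \<in> span I"
  have "D x \<bullet> c = 0" if c: "c \<in> Basis - J" for c
  proof -
    define r where "r t = v + t *\<^sub>R x" for t :: real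
    have r: "(r has_derivative (\<lambda>t. t *\<^sub>R x)) (at 0)"
      unfolding r_def by (auto intro!: derivative_eq_intros)
    have "((\<lambda>t. (\<phi>' \<circ> \<psi>) (r t) \<bullet> c) has_derivative (\<lambda>t. D (t *\<^sub>R x) \<bullet> c)) (at 0)"
    proof (rule has_derivative_inner_left)
      have "((\<phi>' \<circ> \<psi>) has_derivative D) (at (r 0))" using der by (simp add: r_def)
      from diff_chain_at[OF r this]
      show "((\<lambda>t. (\<phi>' \<circ> \<psi>) (r t)) has_derivative (\<lambda>t. D (t *\<^sub>R x))) (at 0)" by (simp add: o_def)
    qed
    hence "((\<lambda>t. 0) has_derivative (\<lambda>t. D (t *\<^sub>R x) \<bullet> c)) (at 0)"
    proof (rule has_derivative_transform_within_open)
      have "continuous_on UNIV r" unfolding r_def by (intro continuous_intros)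
      thus "open (r -` W)" using W by (simp add: open_vimage)
      show "0 \<in> r -` W" using W by (simp add: r_def)
      fix t assume "t \<in> r -` W"
      hence rt: "r t \<in> V" "\<psi> (r t) \<in> U'" by (auto simp: W_def)
      have "r t \<in> span I" unfolding r_def using v x by (intro span_add span_scale)
      hence "r t \<in> \<phi> ` (M \<inter> U)" using rt D1(13) by auto
      hence "\<psi> (r t) \<in> M" using D1(9) by auto
      hence "\<phi>' (\<psi> (r t)) \<in> span J" using rt D2(13) by blast
      hence "coord_proj J (\<phi>' (\<psi> (r t))) = \<phi>' (\<psi> (r t))" using coord_proj_span[OF D2(1)] by blast
      thus "(\<phi>' \<circ> \<psi>) (r t) \<bullet> c = 0" using coord_proj_inner[OF D2(1), of c "\<phi>' (\<psi> (r t))"] c by auto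
    qed
    hence "(\<lambda>t. D (t *\<^sub>R x) \<bullet> c) = (\<lambda>t. 0)"
      using has_derivative_unique has_derivative_const by blast
    from fun_cong[OF this, of 1] show ?thesis by simp
  qed
  hence "coord_proj J (D x) = D x"
    by - (rule euclidean_eqI, auto simp: coord_proj_inner[OF D2(1)])
  thus "D x \<in> span J" using coord_proj_in_span[of J "D x"] by simp
qed

text \<open>\<open>K\<close> transports basis vectors along a bijection from \<open>I\<close> to
  \<open>J\<close>. The predicate \<open>P\<close> records that conditions imposed on every
  coordinate are preserved; with \<open>P\<close> describing the interval from 0 to 1, unit cubes
  correspond to unit cubes.\<close>

lemma coordinate_isometry:
  fixes I J :: "'a::euclidean_space set"
  assumes "I \<subseteq> Basis" "J \<subseteq> Basis" "card I = card J"
  obtains K :: "'a \<Rightarrow> 'a" where "linear K" "\<And>x. K x \<in> span J"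
    "\<And>x y. x \<in> span I \<Longrightarrow> y \<in> span I \<Longrightarrow> K x \<bullet> K y = x \<bullet> y"
    "\<And>y. y \<in> span J \<Longrightarrow> \<exists>x\<in>span I. K x = y"
    "\<And>x. (\<forall>c\<in>J. P (K x \<bullet> c)) \<longleftrightarrow> (\<forall>b\<in>I. P (x \<bullet> b))"
proof -
  have fin: "finite I" "finite J" using assms finite_Basis_subset by auto
  obtain k where k: "bij_betw k I J" using finite_same_card_bij[OF fin assms(3)] by blast
  define K where "K x = (\<Sum>b\<in>I. (x \<bullet> b) *\<^sub>R k b)" for x
  have kJ: "k b \<in> J" if "b \<in> I" for b using k that by (auto simp: bij_betw_def)
  have lin: "linear K"
    by (rule linearI) (auto simp: K_def inner_simps scaleR_left_distrib sum.distrib scaleR_sum_right)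
  have Kk: "K x \<bullet> k b = x \<bullet> b" if "b \<in> I" for x b
  proof -
    have "K x \<bullet> k b = (\<Sum>a\<in>I. if a = b then x \<bullet> b else 0)"
      unfolding K_def inner_sum_left
    proof (intro sum.cong refl)
      fix a assume a: "a \<in> I"
      have "k a = k b \<longleftrightarrow> a = b" using k a that by (auto simp: bij_betw_def inj_on_def)
      thus "(x \<bullet> a) *\<^sub>R k a \<bullet> k b = (if a = b then x \<bullet> b else 0)"
        using kJ[OF a] kJ[OF that] assms(2) by (auto simp: inner_Basis subset_iff)
    qed
    thus ?thesis using that fin by simp
  qed
  have KJ: "K x \<in> span J" for x
    unfolding K_def by (intro span_sum span_scale span_base kJ)
  show ?thesis
  proof (rule that[OF lin KJ])
    fix x y assume xy: "x \<in> span I" "y \<in> span I"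
    have "K x \<bullet> K y = (\<Sum>b\<in>I. (x \<bullet> b) * (K y \<bullet> k b))"
      unfolding K_def[of x] by (simp add: inner_sum_left inner_commute[of "k _" "K y"])
    also have "\<dots> = (\<Sum>b\<in>I. (x \<bullet> b) * (y \<bullet> b))" by (simp add: Kk)
    also have "\<dots> = coord_proj I x \<bullet> y" by (simp only: coord_proj_def inner_sum_left inner_scaleR_left inner_commute[of y])
    finally show "K x \<bullet> K y = x \<bullet> y" using coord_proj_span[OF assms(1) xy(1)] by simp
  next
    fix y assume y: "y \<in> span J"
    define x where "x = (\<Sum>b\<in>I. (y \<bullet> k b) *\<^sub>R b)"
    have x: "x \<in> span I" unfolding x_def by (intro span_sum span_scale span_base)
    have xb: "x \<bullet> b = y \<bullet> k b" if "b \<in> I" for b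
    proof -
      have "x \<bullet> b = (\<Sum>a\<in>I. if a = b then y \<bullet> k b else 0)"
        unfolding x_def inner_sum_left
        using that assms(1) by (intro sum.cong refl) (auto simp: inner_Basis subset_iff)
      thus ?thesis using that fin by simp
    qed
    have "K x = (\<Sum>b\<in>I. (y \<bullet> k b) *\<^sub>R k b)" unfolding K_def by (simp add: xb)
    also have "\<dots> = coord_proj J y" unfolding coord_proj_def
      by (rule sum.reindex_bij_betw[OF k])
    also have "\<dots> = y" by (rule coord_proj_span[OF assms(2) y])
    finally show "\<exists>x\<in>span I. K x = y" using x by blast
  next
    fix x
    show "(\<forall>c\<in>J. P (K x \<bullet> c)) \<longleftrightarrow> (\<forall>b\<in>I. P (x \<bullet> b))"
      using k Kk by (auto simp: bij_betw_def)
  qed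
qed

text \<open>Both integrals are thickened by unit cubes in the complementary directions. The
  transition map on \<open>span I\<close>, combined with an isometry of the complements, is then a
  bijection between full-dimensional sets, and its Jacobian is exactly the quotient of the two
  densities.\<close>

lemma slice_chart_volume_indep:
  assumes c1: "slice_chart m M I U V \<phi> \<psi>" and c2: "slice_chart m M J U' V' \<phi>' \<psi>'"
    and A: "A \<in> sets borel" "A \<subseteq> M" "A \<subseteq> U" "A \<subseteq> U'"
  shows "(\<integral>\<^sup>+v\<in>\<phi> ` A. ennreal (sqrt (gram_det I \<psi> v)) \<partial>lborel_span I) =
     (\<integral>\<^sup>+v\<in>\<phi>' ` A. ennreal (sqrt (gram_det J \<psi>' v)) \<partial>lborel_span J)"
proof -
  note D1 = slice_chartD[OF c1] and D2 = slice_chartD[OF c2]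
  have finI: "finite I" "finite J" using D1(1) D2(1) finite_Basis_subset by auto
  have card: "card (Basis - I) = card (Basis - J)"
    using D1(1,2) D2(1,2) finI by (simp add: card_Diff_subset)
  obtain K :: "'a \<Rightarrow> 'a" where K: "linear K" "\<And>x. K x \<in> span (Basis - J)"
    "\<And>x y. x \<in> span (Basis - I) \<Longrightarrow> y \<in> span (Basis - I) \<Longrightarrow> K x \<bullet> K y = x \<bullet> y"
    "\<And>y. y \<in> span (Basis - J) \<Longrightarrow> \<exists>x\<in>span (Basis - I). K x = y"
    "\<And>x. (\<forall>c\<in>Basis - J. 0 \<le> K x \<bullet> c \<and> K x \<bullet> c \<le> 1) \<longleftrightarrow> (\<forall>b\<in>Basis - I. 0 \<le> x \<bullet> b \<and> x \<bullet> b \<le> 1)"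
    by (rule coordinate_isometry[of "Basis - I" "Basis - J" "\<lambda>r. 0 \<le> r \<and> r \<le> 1"]) (use card in auto)
  define B where "B = \<phi> ` A"
  define B' where "B' = \<phi>' ` A"
  have B: "B \<in> sets borel" "B \<subseteq> V" "B \<subseteq> span I" "B' \<in> sets borel" "B' \<subseteq> V'" "B' \<subseteq> span J"
    unfolding B_def B'_def using slice_chart_image_borel[OF c1 A(3,1)] slice_chart_image_borel[OF c2 A(4,1)] A
      D1(7) D2(7) D1(13) D2(13) by blast+
  define QI where "QI = {x::'a. \<forall>b\<in>Basis - I. 0 \<le> x \<bullet> b \<and> x \<bullet> b \<le> 1}"
  define QJ where "QJ = {x::'a. \<forall>b\<in>Basis - J. 0 \<le> x \<bullet> b \<and> x \<bullet> b \<le> 1}"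
  have Qm [measurable]: "QI \<in> sets borel" "QJ \<in> sets borel" unfolding QI_def QJ_def by simp_all
  have QI_proj: "coord_proj (Basis - I) x \<in> QI \<longleftrightarrow> x \<in> QI" for x
    unfolding QI_def by (simp add: coord_proj_inner)
  have QJ_proj: "coord_proj (Basis - J) x \<in> QJ \<longleftrightarrow> x \<in> QJ" for x
    unfolding QJ_def by (simp add: coord_proj_inner)
  \<comment> \<open>The densities are extended constantly along the complementary directions and
    vanish off the chart images.\<close>
  define f where "f y = indicator B' (coord_proj J y) * sqrt (gram_det J \<psi>' (coord_proj J y))" for y
  define f0 where "f0 x = indicator B (coord_proj I x) * sqrt (gram_det I \<psi> (coord_proj I x))" for x
  have [measurable]: "f \<in> borel_measurable borel" unfolding f_def
    by (rule measurable_compose[OF measurable_coord_proj slice_chart_density_measurable[OF c2 B(4,5)]])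
  have [measurable]: "f0 \<in> borel_measurable borel" unfolding f0_def
    by (rule measurable_compose[OF measurable_coord_proj slice_chart_density_measurable[OF c1 B(1,2)]])
  define S where "S = {x. coord_proj I x \<in> B \<and> x \<in> QI}"
  \<comment> \<open>The transition map acts on the component in \<open>span I\<close>, the isometry
    on the complementary component; the two parts of the value remain separated because they lie in
    \<open>span J\<close> and its complement.\<close>
  define g where "g x = \<phi>' (\<psi> (coord_proj I x)) + K (coord_proj (Basis - I) x)" for x
  define E where "E v = frechet_derivative \<phi>' (at (\<psi> v)) \<circ> frechet_derivative \<psi> (at v)" for v
  define g' where "g' x = (\<lambda>y. E (coord_proj I x) (coord_proj I y) + K (coord_proj (Basis - I) y))" for x
  have Sm [measurable]: "S \<in> sets borel"
    using measurable_sets_borel[OF measurable_coord_proj[of I] B(1)] Qm(1)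
    unfolding S_def vimage_def by (simp add: sets.Int Collect_conj_eq)
  have inB: "v \<in> V" "v \<in> span I" "\<psi> v \<in> U'" "\<psi> v \<in> A" "\<phi>' (\<psi> v) \<in> B'" "\<phi>' (\<psi> v) \<in> V'" "\<phi>' (\<psi> v) \<in> span J" if "v \<in> B" for v
    using that B A D1(9) D2(7) unfolding B_def B'_def by fastforce+
  have gJ: "coord_proj J (g x) = \<phi>' (\<psi> (coord_proj I x))" 
    "coord_proj (Basis - J) (g x) = K (coord_proj (Basis - I) x)" if "x \<in> S" for x
  proof -
    have "\<phi>' (\<psi> (coord_proj I x)) \<in> span J" using that inB(7) by (simp add: S_def)
    thus "coord_proj J (g x) = \<phi>' (\<psi> (coord_proj I x))"
      "coord_proj (Basis - J) (g x) = K (coord_proj (Basis - I) x)"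
      unfolding g_def using coord_proj_add_span[OF D2(1)] coord_proj_compl_add_span[OF D2(1)] K(2) by blast+
  qed
  have gS: "g ` S = {y. coord_proj J y \<in> B' \<and> y \<in> QJ}"
  proof (intro equalityI subsetI)
    fix y assume "y \<in> g ` S"
    then obtain x where x: "x \<in> S" "y = g x" by blast
    hence "coord_proj (Basis - I) x \<in> QI" using QI_proj by (simp add: S_def)
    hence "K (coord_proj (Basis - I) x) \<in> QJ" using K(5) unfolding QI_def QJ_def by blast
    hence "y \<in> QJ" using gJ(2)[OF x(1)] QJ_proj[of y] x(2) by simp
    thus "y \<in> {y. coord_proj J y \<in> B' \<and> y \<in> QJ}" using gJ(1)[OF x(1)] x inB(5) by (auto simp: S_def)
  next
    fix y assume y: "y \<in> {y. coord_proj J y \<in> B' \<and> y \<in> QJ}"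
    then obtain a where a: "a \<in> A" "coord_proj J y = \<phi>' a" unfolding B'_def by auto
    obtain z where z: "z \<in> span (Basis - I)" "K z = coord_proj (Basis - J) y"
      using K(4)[OF coord_proj_in_span] by blast
    have pa: "\<phi> a \<in> B" "\<psi> (\<phi> a) = a" using a A D1(9) by (auto simp: B_def)
    have p: "coord_proj I (\<phi> a + z) = \<phi> a" "coord_proj (Basis - I) (\<phi> a + z) = z"
      using coord_proj_add_span[OF D1(1)] coord_proj_compl_add_span[OF D1(1)] pa(1) B(3) z(1) by auto
    have "K z \<in> QJ" using y z QJ_proj by auto
    hence "z \<in> QI" using K(5) unfolding QI_def QJ_def by blast
    hence "\<phi> a + z \<in> QI" using QI_proj[of "\<phi> a + z"] p by simp
    hence "\<phi> a + z \<in> S" using p pa by (simp add: S_def)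
    moreover have "g (\<phi> a + z) = y"
      unfolding g_def p pa z(2) a(2)[symmetric] by (rule coord_proj_compl[OF D2(1)])
    ultimately show "y \<in> g ` S" by blast
  qed
  have der: "(g has_derivative g' x) (at x within S)" if x: "x \<in> S" for x
  proof -
    have v: "coord_proj I x \<in> B" using x by (simp add: S_def)
    have "((\<phi>' \<circ> \<psi>) has_derivative E (coord_proj I x)) (at (coord_proj I x))"
      unfolding E_def by (rule slice_chart_transition(1)[OF c1 c2]) (use inB[OF v] in auto)
    from diff_chain_at[OF linear_imp_has_derivative[OF linear_coord_proj] this]
    have 1: "((\<lambda>x. \<phi>' (\<psi> (coord_proj I x))) has_derivative (\<lambda>y. E (coord_proj I x) (coord_proj I y))) (at x)"
      by (simp add: o_def)
    have 2: "((\<lambda>x. K (coord_proj (Basis - I) x)) has_derivative (\<lambda>y. K (coord_proj (Basis - I) y))) (at x)"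
      using linear_imp_has_derivative[OF linear_compose[OF linear_coord_proj K(1)]] by (simp add: o_def)
    show ?thesis unfolding g_def g'_def
      by (rule has_derivative_at_withinI[OF has_derivative_add[OF 1 2]])
  qed
  have inj: "inj_on g S"
  proof (rule inj_onI)
    fix x y assume xy: "x \<in> S" "y \<in> S" "g x = g y"
    have "\<phi>' (\<psi> (coord_proj I x)) = \<phi>' (\<psi> (coord_proj I y))" using gJ(1) xy by metis
    hence "\<psi> (coord_proj I x) = \<psi> (coord_proj I y)"
      using D2(9) inB(3) xy by (metis (mono_tags, lifting) S_def mem_Collect_eq)
    hence 1: "coord_proj I x = coord_proj I y"
      using D1(10) inB(1) xy by (metis (mono_tags, lifting) S_def mem_Collect_eq)
    define z where "z = coord_proj (Basis - I) x - coord_proj (Basis - I) y"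
    have "z \<in> span (Basis - I)" unfolding z_def by (intro span_diff coord_proj_in_span)
    moreover have "K z = 0" using gJ(2) xy unfolding z_def by (metis K(1) linear_diff right_minus_eq)
    ultimately have "z = 0" using K(3)[of z z] by simp
    thus "x = y" using 1 coord_proj_compl[OF D1(1)] unfolding z_def by (metis right_minus_eq)
  qed
  \<comment> \<open>This is the transformation law for Gram determinants: the Jacobian absorbs the
    change of density.\<close>
  have key: "\<bar>edet (g' x)\<bar> * f (g x) = sqrt (gram_det I \<psi> (coord_proj I x))" if x: "x \<in> S" for x
  proof -
    define v where "v = coord_proj I x"
    have v: "v \<in> B" using x by (simp add: S_def v_def)
    note tr = slice_chart_transition[OF c1 c2 inB(1)[OF v] inB(2)[OF v] inB(3)[OF v], folded E_def]
    have lin: "linear (frechet_derivative \<psi> (at v))" "linear (frechet_derivative \<psi>' (at (\<phi>' (\<psi> v))))" "linear (E v)"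
      using smooth_on_imp_differentiable[OF D1(6) inB(1)[OF v]] 
        smooth_on_imp_differentiable[OF D2(6) inB(6)[OF v]] has_derivative_linear[OF tr(1)]
      by (auto intro: linear_frechet_derivative)
    have "gram_det I \<psi> v = (edet (g' x))\<^sup>2 * gram_det J \<psi>' (\<phi>' (\<psi> v))"
      unfolding gram_det_eq[OF D1(1) smooth_on_imp_differentiable[OF D1(6) inB(1)[OF v]]]
        gram_det_eq[OF D2(1) smooth_on_imp_differentiable[OF D2(6) inB(6)[OF v]]]
        g'_def v_def[symmetric]
      by (rule det_gram_mat_transform[OF D1(1) D2(1) lin K(1) tr(2) tr(3) K(2) K(3)]) auto
    moreover have "f (g x) = sqrt (gram_det J \<psi>' (\<phi>' (\<psi> v)))"
      unfolding f_def gJ(1)[OF x] v_def[symmetric] using inB(5)[OF v] by simp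
    ultimately show ?thesis by (simp add: v_def[symmetric] real_sqrt_mult)
  qed
  have "(\<integral>\<^sup>+v\<in>B'. ennreal (sqrt (gram_det J \<psi>' v)) \<partial>lborel_span J) =
      (\<integral>\<^sup>+v. ennreal (indicator B' v * sqrt (gram_det J \<psi>' v)) \<partial>lborel_span J)"
    by (intro nn_integral_cong) (auto split: split_indicator)
  also have "\<dots> = (\<integral>\<^sup>+y. ennreal (f y) * indicator QJ y \<partial>lborel)"
    unfolding f_def QJ_def
    by (rule nn_integral_lborel_span_thicken[OF D2(1)])
       (intro measurable_compose[OF slice_chart_density_measurable[OF c2 B(4,5)]], simp)
  also have "\<dots> = (\<integral>\<^sup>+y. ennreal (indicator (g ` S) y * f y) \<partial>lborel)"
    unfolding gS by (intro nn_integral_cong) (auto simp: f_def split: split_indicator)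
  also have "\<dots> = (\<integral>\<^sup>+x. ennreal (indicator S x * (\<bar>edet (g' x)\<bar> * f (g x))) \<partial>lborel)"
  proof (rule nn_integral_change_of_variables[OF Sm der inj])
    show "0 \<le> f y" for y using slice_chart_gram_pos[OF c2] B(5)
      by (auto simp: f_def less_imp_le split: split_indicator)
    have "g ` S \<in> sets borel"
      using measurable_sets_borel[OF measurable_coord_proj[of J] B(4)] Qm(2)
      unfolding gS vimage_def by (simp add: sets.Int Collect_conj_eq)
    thus "(\<lambda>x. indicator (g ` S) x * f x) \<in> borel_measurable borel" by measurable
    have "(\<lambda>x. indicator S x * (\<bar>edet (g' x)\<bar> * f (g x))) = (\<lambda>x. indicator S x * f0 x)"
      using key by (auto simp: f0_def S_def split: split_indicator)
    thus "(\<lambda>x. indicator S x * (\<bar>edet (g' x)\<bar> * f (g x))) \<in> borel_measurable borel" by simp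
  qed
  also have "\<dots> = (\<integral>\<^sup>+x. ennreal (f0 x) * indicator QI x \<partial>lborel)"
    using key by (intro nn_integral_cong) (auto simp: f0_def S_def split: split_indicator)
  also have "\<dots> = (\<integral>\<^sup>+v. ennreal (indicator B v * sqrt (gram_det I \<psi> v)) \<partial>lborel_span I)"
    unfolding f0_def QI_def
    by (rule nn_integral_lborel_span_thicken[OF D1(1), symmetric])
       (intro measurable_compose[OF slice_chart_density_measurable[OF c1 B(1,2)]], simp)
  also have "\<dots> = (\<integral>\<^sup>+v\<in>B. ennreal (sqrt (gram_det I \<psi> v)) \<partial>lborel_span I)"
    by (intro nn_integral_cong) (auto split: split_indicator)
  finally show ?thesis by (simp add: B_def B'_def)
qed

section \<open>The Riemannian volume\<close>

definition chart_volume :: "'a::euclidean_space set \<Rightarrow> ('a \<Rightarrow> 'a) \<Rightarrow> ('a \<Rightarrow> 'a) \<Rightarrow> 'a set \<Rightarrow> ennreal" where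
  "chart_volume I \<phi> \<psi> A = (\<integral>\<^sup>+v\<in>\<phi> ` A. ennreal (sqrt (gram_det I \<psi> v)) \<partial>lborel_span I)"

lemma chart_volume_indep:
  assumes "slice_chart m M I U V \<phi> \<psi>" "slice_chart m M J U' V' \<phi>' \<psi>'"
    and "A \<in> sets borel" "A \<subseteq> M" "A \<subseteq> U" "A \<subseteq> U'"
  shows "chart_volume I \<phi> \<psi> A = chart_volume J \<phi>' \<psi>' A"
  unfolding chart_volume_def by (rule slice_chart_volume_indep[OF assms])

lemma nn_set_integral_suminf:
  assumes "f \<in> borel_measurable N" "\<And>n::nat. B n \<in> sets N" "disjoint_family B"
  shows "(\<integral>\<^sup>+v\<in>(\<Union>n. B n). f v \<partial>N) = (\<Sum>n. \<integral>\<^sup>+v\<in>B n. f v \<partial>N)"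
proof -
  have "(\<integral>\<^sup>+v\<in>(\<Union>n. B n). f v \<partial>N) = emeasure (density N f) (\<Union>n. B n)"
    using assms by (subst emeasure_density) (auto intro: sets.countable_UN)
  also have "\<dots> = (\<Sum>n. emeasure (density N f) (B n))"
    using assms by (intro suminf_emeasure[symmetric]) auto
  also have "\<dots> = (\<Sum>n. \<integral>\<^sup>+v\<in>B n. f v \<partial>N)"
    using assms by (intro suminf_cong emeasure_density) auto
  finally show ?thesis .
qed

lemma chart_volume_suminf:
  assumes c: "slice_chart m M I U V \<phi> \<psi>" and "\<And>n::nat. A n \<in> sets borel" "\<And>n. A n \<subseteq> U"
    and disj: "disjoint_family A"
  shows "chart_volume I \<phi> \<psi> (\<Union>n. A n) = (\<Sum>n. chart_volume I \<phi> \<psi> (A n))"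
proof -
  note D = slice_chartD[OF c]
  \<comment> \<open>Measurability of the density is known on \<open>V\<close> only, so it is cut off
    there; images of subsets of \<open>U\<close> do not see the difference.\<close>
  define f where "f v = ennreal (indicator V v * sqrt (gram_det I \<psi> v))" for v
  have V: "V \<in> sets borel" using D(4) by (rule borel_open)
  have f: "f \<in> borel_measurable (lborel_span I)"
    unfolding f_def using slice_chart_density_measurable[OF c V] by simp
  have eq: "chart_volume I \<phi> \<psi> B = (\<integral>\<^sup>+v\<in>\<phi> ` B. f v \<partial>lborel_span I)" if "B \<subseteq> U" for B
    unfolding chart_volume_def f_def using D(7) that
    by (intro nn_integral_cong) (auto split: split_indicator)
  have "(\<integral>\<^sup>+v\<in>(\<Union>n. \<phi> ` A n). f v \<partial>lborel_span I) = (\<Sum>n. \<integral>\<^sup>+v\<in>\<phi> ` A n. f v \<partial>lborel_span I)"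
  proof (rule nn_set_integral_suminf[OF f])
    show "\<phi> ` A n \<in> sets (lborel_span I)" for n
      using slice_chart_image_borel[OF c assms(3,2)] by simp
    show "disjoint_family (\<lambda>n. \<phi> ` A n)"
      using disj assms(3) D(9) unfolding disjoint_family_on_def
      by (auto simp: disjoint_iff) (metis subsetD)
  qed
  moreover have "(\<Union>n. A n) \<subseteq> U" using assms(3) by blast
  ultimately show ?thesis using assms(3) by (simp add: eq image_UN)
qed

lemma chart_volume_empty [simp]: "chart_volume I \<phi> \<psi> {} = 0"
  by (simp add: chart_volume_def)

lemma chart_volume_sum:
  assumes c: "slice_chart m M I U V \<phi> \<psi>" and "\<And>i. i < N \<Longrightarrow> A i \<in> sets borel" "\<And>i. i < N \<Longrightarrow> A i \<subseteq> U"
    and disj: "disjoint_family_on A {..<N::nat}"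
  shows "chart_volume I \<phi> \<psi> (\<Union>i<N. A i) = (\<Sum>i<N. chart_volume I \<phi> \<psi> (A i))"
proof -
  define B where "B n = (if n < N then A n else {})" for n
  have "chart_volume I \<phi> \<psi> (\<Union>n. B n) = (\<Sum>n. chart_volume I \<phi> \<psi> (B n))"
  proof (rule chart_volume_suminf[OF c])
    show "disjoint_family B" using disj unfolding B_def disjoint_family_on_def by auto
  qed (use assms in \<open>auto simp: B_def\<close>)
  also have "\<dots> = (\<Sum>n<N. chart_volume I \<phi> \<psi> (B n))"
    by (rule suminf_finite) (auto simp: B_def)
  also have "(\<Union>n. B n) = (\<Union>i<N. A i)" by (auto simp: B_def split: if_splits)
  finally show ?thesis by (simp add: B_def)
qed

text \<open>The property described in \<open>riemannian_volume\<close>, named so that its unique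
  solvability can be stated.\<close>

definition riemannian_measure :: "nat \<Rightarrow> 'a::euclidean_space set \<Rightarrow> 'a measure \<Rightarrow> bool" where
  "riemannian_measure m M \<mu> \<longleftrightarrow> sets \<mu> = sets (restrict_space borel M) \<and>
     (\<forall>I U V \<phi> \<psi> A. slice_chart m M I U V \<phi> \<psi> \<longrightarrow> A \<in> sets \<mu> \<longrightarrow> A \<subseteq> U \<longrightarrow>
        emeasure \<mu> A = chart_volume I \<phi> \<psi> A)"

lemma riemannian_volume_eq_The: "riemannian_volume m M = (THE \<mu>. riemannian_measure m M \<mu>)"
  by (simp add: riemannian_volume_def riemannian_measure_def chart_volume_def)

lemma closed_submanifold_finite_atlas:
  assumes M: "closed_submanifold m M"
  obtains N :: nat and I U V \<phi> \<psi> where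
    "\<And>i. i < N \<Longrightarrow> slice_chart m M (I i) (U i) (V i) (\<phi> i) (\<psi> i)" "M \<subseteq> (\<Union>i<N. U i)"
proof -
  have "\<forall>p. \<exists>I U V \<phi> \<psi>. p \<in> M \<longrightarrow> p \<in> U \<and> slice_chart m M I U V \<phi> \<psi>"
    using M unfolding closed_submanifold_def by blast
  then obtain I U V \<phi> \<psi> where ch: "\<And>p. p \<in> M \<Longrightarrow> p \<in> U p \<and> slice_chart m M (I p) (U p) (V p) (\<phi> p) (\<psi> p)"
    by metis
  have "compact M" using M by (simp add: closed_submanifold_def)
  moreover have "\<forall>B\<in>U ` M. open B" using ch slice_chartD(3) by blast
  moreover have "M \<subseteq> \<Union>(U ` M)" using ch by blast
  ultimately obtain \<C> where "\<C> \<subseteq> U ` M" "finite \<C>" "M \<subseteq> \<Union>\<C>" by (meson compactE)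
  then obtain P where P: "P \<subseteq> M" "finite P" "M \<subseteq> (\<Union>p\<in>P. U p)"
    by (metis finite_subset_image)
  obtain N and e where e: "P = e ` {i. i < (N::nat)}"
    using finite_imp_nat_seg_image_inj_on[OF P(2)] by blast
  show ?thesis
  proof (rule that[of N "\<lambda>i. I (e i)" "\<lambda>i. U (e i)" "\<lambda>i. V (e i)" "\<lambda>i. \<phi> (e i)" "\<lambda>i. \<psi> (e i)"])
    show "slice_chart m M (I (e i)) (U (e i)) (V (e i)) (\<phi> (e i)) (\<psi> (e i))" if "i < N" for i
      using ch[of "e i"] P(1) that unfolding e by auto
    show "M \<subseteq> (\<Union>i<N. U (e i))" using P(3) unfolding e by auto
  qed
qed

text \<open>A finite atlas cuts \<open>M\<close> into disjoint Borel pieces, each inside one chart.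
  The values on subsets of the pieces are forced, which gives uniqueness; the sum of these values
  defines a measure, and chart independence on each piece shows that it has the required density in
  every chart, not only in those of the atlas.\<close>

lemma ex1_riemannian_measure:
  assumes M: "closed_submanifold m M"
  shows "\<exists>!\<mu>. riemannian_measure m M \<mu>"
proof -
  obtain N :: nat and I U V \<phi> \<psi> where
    ch: "\<And>i. i < N \<Longrightarrow> slice_chart m M (I i) (U i) (V i) (\<phi> i) (\<psi> i)" and cov: "M \<subseteq> (\<Union>i<N. U i)"
    using closed_submanifold_finite_atlas[OF M] by metis
  have Mc: "M \<in> sets borel" using M by (simp add: closed_submanifold_def compact_imp_closed borel_closed)
  have sets_M: "A \<in> sets (restrict_space borel M) \<longleftrightarrow> A \<in> sets borel \<and> A \<subseteq> M" for A
    using Mc by (auto simp: sets_restrict_space_iff)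
  \<comment> \<open>Every point is assigned to the first chart domain that contains it, which makes
    the pieces disjoint.\<close>
  define E where "E i = U i - (\<Union>j<i. U j)" for i
  have E: "E i \<in> sets borel" "E i \<subseteq> U i" if "i < N" for i
    using slice_chartD(3)[OF ch] that unfolding E_def by (auto intro!: borel_open open_UN)
  have Edisj: "disjoint_family E" 
    unfolding disjoint_family_on_def E_def by (auto simp: disjoint_iff) (metis lessThan_iff linorder_neqE_nat)
  have Ecov: "x \<in> (\<Union>i<N. E i)" if x: "x \<in> M" for x
  proof -
    define k where "k = (LEAST k. k < N \<and> x \<in> U k)"
    have "\<exists>k. k < N \<and> x \<in> U k" using cov x by auto
    hence k: "k < N \<and> x \<in> U k" unfolding k_def by (rule LeastI_ex)
    have "x \<notin> U j" if "j < k" for j using not_less_Least[of j "\<lambda>k. k < N \<and> x \<in> U k"] that k unfolding k_def by auto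
    thus ?thesis using k by (auto simp: E_def)
  qed
  have split: "A = (\<Union>i<N. A \<inter> E i)" if "A \<subseteq> M" for A using Ecov that by blast
  have uniq: "\<mu> = \<nu>" if mu: "riemannian_measure m M \<mu>" and nu: "riemannian_measure m M \<nu>" for \<mu> \<nu>
  proof (rule measure_eqI)
    show s: "sets \<mu> = sets \<nu>" using mu nu by (simp add: riemannian_measure_def)
    fix A assume "A \<in> sets \<mu>"
    hence A: "A \<in> sets borel" "A \<subseteq> M" using mu sets_M by (auto simp: riemannian_measure_def)
    have *: "emeasure \<rho> A = (\<Sum>i<N. chart_volume (I i) (\<phi> i) (\<psi> i) (A \<inter> E i))"
      if \<rho>: "riemannian_measure m M \<rho>" for \<rho>
    proof -
      have \<rho>': "sets \<rho> = sets (restrict_space borel M)"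
        "\<And>I U V \<phi> \<psi> A. slice_chart m M I U V \<phi> \<psi> \<Longrightarrow> A \<in> sets \<rho> \<Longrightarrow> A \<subseteq> U \<Longrightarrow>
          emeasure \<rho> A = chart_volume I \<phi> \<psi> A"
        using \<rho> unfolding riemannian_measure_def by blast+
      have sets: "A \<inter> E i \<in> sets \<rho>" if "i < N" for i 
        using \<rho>' A E(1)[OF that] sets_M[of "A \<inter> E i"] by auto
      have "emeasure \<rho> A = emeasure \<rho> (\<Union>i<N. A \<inter> E i)" by (rule arg_cong[OF split[OF A(2)]])
      also have "\<dots> = (\<Sum>i<N. emeasure \<rho> (A \<inter> E i))"
        using sets Edisj by (intro sum_emeasure[symmetric]) (auto simp: disjoint_family_on_def)
      also have "\<dots> = (\<Sum>i<N. chart_volume (I i) (\<phi> i) (\<psi> i) (A \<inter> E i))"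
        using E(2) by (intro sum.cong refl \<rho>'(2)[OF ch sets]) auto
      finally show ?thesis .
    qed
    show "emeasure \<mu> A = emeasure \<nu> A" using *[OF mu] *[OF nu] by simp
  qed
  define F where "F A = (\<Sum>i<N. chart_volume (I i) (\<phi> i) (\<psi> i) (A \<inter> E i))" for A
  define \<mu> where "\<mu> = measure_of M (sets (restrict_space borel M)) F"
  have sp: "space (restrict_space borel M) = M" by (simp add: space_restrict_space)
  have sets_mu: "sets \<mu> = sets (restrict_space borel M)"
    unfolding \<mu>_def using sets.sigma_sets_eq[of "restrict_space borel M"] sets.space_closed[of "restrict_space borel M"] sp by simp
  have em: "emeasure \<mu> A = F A" if "A \<in> sets (restrict_space borel M)" for A
    unfolding \<mu>_def
  proof (rule emeasure_measure_of_sigma[OF _ _ _ that])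
    show "sigma_algebra M (sets (restrict_space borel M))"
      using sets.sigma_algebra_axioms[of "restrict_space borel M"] sp by simp
    show "positive (sets (restrict_space borel M)) F" by (simp add: positive_def F_def)
    show "countably_additive (sets (restrict_space borel M)) F"
    proof (rule countably_additiveI)
      fix A :: "nat \<Rightarrow> 'a set"
      assume A: "range A \<subseteq> sets (restrict_space borel M)" "disjoint_family A"
      have "(\<Sum>n. F (A n)) = (\<Sum>i<N. \<Sum>n. chart_volume (I i) (\<phi> i) (\<psi> i) (A n \<inter> E i))"
        unfolding F_def by (intro suminf_sum) auto
      also have "\<dots> = (\<Sum>i<N. chart_volume (I i) (\<phi> i) (\<psi> i) (\<Union>n. A n \<inter> E i))"
      proof (intro sum.cong refl chart_volume_suminf[symmetric])
        fix i n assume "i \<in> {..<N}"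
        hence i: "i < N" by simp
        show "slice_chart m M (I i) (U i) (V i) (\<phi> i) (\<psi> i)" by (rule ch[OF i])
        show "A n \<inter> E i \<in> sets borel" using A(1) E(1)[OF i] sets_M by blast
        show "A n \<inter> E i \<subseteq> U i" using E(2)[OF i] by blast
        show "disjoint_family (\<lambda>n. A n \<inter> E i)" using A(2) by (auto simp: disjoint_family_on_def)
      qed
      finally show "(\<Sum>n. F (A n)) = F (\<Union> (range A))" by (simp add: F_def)
    qed
  qed
  have "riemannian_measure m M \<mu>"
    unfolding riemannian_measure_def
  proof (intro conjI allI impI sets_mu)
    fix J U' V' \<phi>' \<psi>' A
    assume c: "slice_chart m M J U' V' \<phi>' \<psi>'" and "A \<in> sets \<mu>" and AU: "A \<subseteq> U'"
    hence A: "A \<in> sets (restrict_space borel M)" "A \<in> sets borel" "A \<subseteq> M" using sets_mu sets_M by auto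
    have "emeasure \<mu> A = (\<Sum>i<N. chart_volume (I i) (\<phi> i) (\<psi> i) (A \<inter> E i))"
      using em[OF A(1)] by (simp add: F_def)
    \<comment> \<open>Each \<open>A \<inter> E i\<close> lies both in the atlas chart
      \<open>U i\<close> and in the given chart \<open>U'\<close>, so its two volumes agree.\<close>
    also have "\<dots> = (\<Sum>i<N. chart_volume J \<phi>' \<psi>' (A \<inter> E i))"
      using A E AU by (intro sum.cong refl chart_volume_indep[OF ch c]) auto
    also have "\<dots> = chart_volume J \<phi>' \<psi>' (\<Union>i<N. A \<inter> E i)"
    proof (rule chart_volume_sum[OF c, symmetric])
      show "disjoint_family_on (\<lambda>i. A \<inter> E i) {..<N}"
        using Edisj by (auto simp: disjoint_family_on_def disjoint_iff)
    qed (use A E AU in auto)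
    finally show "emeasure \<mu> A = chart_volume J \<phi>' \<psi>' A" unfolding split[OF A(3), symmetric] .
  qed
  with uniq show ?thesis by blast
qed

lemma riemannian_measure_volume:
  "closed_submanifold m M \<Longrightarrow> riemannian_measure m M (riemannian_volume m M)"
  unfolding riemannian_volume_eq_The by (rule theI'[OF ex1_riemannian_measure])

context
  fixes m :: nat and M :: "'a::euclidean_space set"
  assumes M: "closed_submanifold m M"
begin

lemma closed_submanifold_borel: "M \<in> sets borel"
  using M by (simp add: closed_submanifold_def compact_imp_closed borel_closed)

lemma sets_riemannian_volume: "sets (riemannian_volume m M) = sets (restrict_space borel M)"
  using riemannian_measure_volume[OF M] by (simp add: riemannian_measure_def)

lemma space_riemannian_volume: "space (riemannian_volume m M) = M"
  using sets_eq_imp_space_eq[OF sets_riemannian_volume] by (simp add: space_restrict_space)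

lemma in_sets_riemannian_volume: "A \<in> sets (riemannian_volume m M) \<longleftrightarrow> A \<in> sets borel \<and> A \<subseteq> M"
  using closed_submanifold_borel by (auto simp: sets_riemannian_volume sets_restrict_space_iff)

lemma emeasure_riemannian_volume_chart:
  assumes "slice_chart m M I U V \<phi> \<psi>" "A \<in> sets borel" "A \<subseteq> M" "A \<subseteq> U"
  shows "emeasure (riemannian_volume m M) A = chart_volume I \<phi> \<psi> A"
  using riemannian_measure_volume[OF M] assms in_sets_riemannian_volume
  unfolding riemannian_measure_def by blast

text \<open>Near every point the density is continuous on a compact chart image, hence bounded, and
  that image has finite measure; finitely many such neighbourhoods cover the compact set
  \<open>M\<close>.\<close>

lemma finite_measure_riemannian_volume: "finite_measure (riemannian_volume m M)"
proof
  have "\<exists>r>0. emeasure (riemannian_volume m M) (M \<inter> cball p r) < \<infinity>" if p: "p \<in> M" for p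
  proof -
    obtain I U V \<phi> \<psi> where pU: "p \<in> U" and c: "slice_chart m M I U V \<phi> \<psi>"
      using M p unfolding closed_submanifold_def by blast
    note D = slice_chartD[OF c]
    obtain r where r: "r > 0" "cball p r \<subseteq> U" using D(3) pU open_contains_cball by blast
    define A where "A = M \<inter> cball p r"
    have A: "compact A" "A \<subseteq> M" "A \<subseteq> U" 
      using M r unfolding A_def closed_submanifold_def by (auto intro: compact_Int_closed)
    have cA: "compact (\<phi> ` A)" using A D(11) by (intro compact_continuous_image) (auto intro: continuous_on_subset)
    have AV: "\<phi> ` A \<subseteq> V" using A D(7) by blast
    have "continuous_on (\<phi> ` A) (\<lambda>v. sqrt (gram_det I \<psi> v))"
      using slice_chart_gram_continuous[OF c] AV by (intro continuous_on_real_sqrt) (rule continuous_on_subset)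
    hence "bounded ((\<lambda>v. sqrt (gram_det I \<psi> v)) ` \<phi> ` A)"
      by (intro compact_imp_bounded compact_continuous_image cA)
    then obtain C where C: "\<And>v. v \<in> \<phi> ` A \<Longrightarrow> sqrt (gram_det I \<psi> v) \<le> C"
      unfolding bounded_iff by (auto simp: abs_le_iff)
    have Ab: "A \<in> sets borel" using A by (simp add: compact_imp_closed borel_closed)
    have "emeasure (riemannian_volume m M) A = chart_volume I \<phi> \<psi> A"
      by (rule emeasure_riemannian_volume_chart[OF c Ab A(2,3)])
    also have "\<dots> \<le> (\<integral>\<^sup>+v\<in>\<phi> ` A. ennreal C \<partial>lborel_span I)"
      unfolding chart_volume_def using C
      by (intro nn_integral_mono) (auto simp: ennreal_leI split: split_indicator)
    also have "\<dots> = ennreal C * emeasure (lborel_span I) (\<phi> ` A)"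
      using cA by (intro nn_integral_cmult_indicator) (simp add: compact_imp_closed borel_closed)
    also have "\<dots> < \<infinity>"
      using emeasure_lborel_span_bounded[OF D(1) compact_imp_bounded[OF cA]]
      by (simp add: ennreal_mult_less_top)
    finally show ?thesis using r unfolding A_def by blast
  qed
  then obtain r where r: "\<And>p. p \<in> M \<Longrightarrow> r p > 0"
    "\<And>p. p \<in> M \<Longrightarrow> emeasure (riemannian_volume m M) (M \<inter> cball p (r p)) < \<infinity>" by metis
  have "compact M" using M by (simp add: closed_submanifold_def)
  moreover have "M \<subseteq> (\<Union>p\<in>M. ball p (r p))" using r by force
  ultimately obtain P where P: "P \<subseteq> M" "finite P" "M \<subseteq> (\<Union>p\<in>P. ball p (r p))"
    by (elim compactE_image) auto
  have "M = (\<Union>p\<in>P. M \<inter> cball p (r p))" using P by force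
  hence "emeasure (riemannian_volume m M) M = emeasure (riemannian_volume m M) (\<Union>p\<in>P. M \<inter> cball p (r p))"
    by (rule arg_cong)
  also have "\<dots> \<le> (\<Sum>p\<in>P. emeasure (riemannian_volume m M) (M \<inter> cball p (r p)))"
    using P closed_submanifold_borel in_sets_riemannian_volume
    by (intro emeasure_subadditive_finite) auto
  also have "\<dots> < \<infinity>" using r(2) P by (auto simp: less_top)
  finally show "emeasure (riemannian_volume m M) (space (riemannian_volume m M)) \<noteq> \<infinity>"
    by (simp add: space_riemannian_volume)
qed

end

section \<open>Families with uniformly bounded derivatives\<close>

definition unif_bounded :: "'p set \<Rightarrow> real \<Rightarrow> ('p \<Rightarrow> real \<Rightarrow> real) \<Rightarrow> bool" where
  "unif_bounded P d f \<longleftrightarrow> (\<exists>C. \<forall>p\<in>P. \<forall>t\<in>{0..d}. \<bar>f p t\<bar> \<le> C)"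

text \<open>Only the bounds are uniform in the parameter; no regularity in it is required.\<close>
primrec unif_Ck :: "nat \<Rightarrow> 'p set \<Rightarrow> real \<Rightarrow> ('p \<Rightarrow> real \<Rightarrow> real) \<Rightarrow> bool" where
  "unif_Ck 0 P d f \<longleftrightarrow> unif_bounded P d f \<and> (\<forall>p\<in>P. continuous_on {0..d} (f p))"
| "unif_Ck (Suc k) P d f \<longleftrightarrow> unif_bounded P d f \<and>
     (\<exists>f'. (\<forall>p\<in>P. \<forall>t\<in>{0..d}. (f p has_real_derivative f' p t) (at t within {0..d})) \<and> unif_Ck k P d f')"

lemma unif_boundedE:
  assumes "unif_bounded P d f"
  obtains C where "C > 0" "\<And>p t. p \<in> P \<Longrightarrow> t \<in> {0..d} \<Longrightarrow> \<bar>f p t\<bar> \<le> C"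
proof -
  obtain C where "\<forall>p\<in>P. \<forall>t\<in>{0..d}. \<bar>f p t\<bar> \<le> C" using assms unfolding unif_bounded_def by blast
  thus ?thesis by (intro that[of "max C 1"]) (auto simp: le_max_iff_disj)
qed

lemma unif_Ck_bounded: "unif_Ck k P d f \<Longrightarrow> unif_bounded P d f"
  by (cases k) auto

lemma unif_Ck_continuous: "unif_Ck k P d f \<Longrightarrow> p \<in> P \<Longrightarrow> continuous_on {0..d} (f p)"
  by (cases k) (auto intro: DERIV_continuous_on)

lemma unif_Ck_SucE:
  assumes "unif_Ck (Suc k) P d f"
  obtains f' where "\<And>p t. p \<in> P \<Longrightarrow> t \<in> {0..d} \<Longrightarrow> (f p has_real_derivative f' p t) (at t within {0..d})"
    "unif_Ck k P d f'" "unif_bounded P d f"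
  using assms unfolding unif_Ck.simps by blast

lemma unif_Ck_SucI:
  assumes "unif_bounded P d f" "unif_Ck k P d f'"
    "\<And>p t. p \<in> P \<Longrightarrow> t \<in> {0..d} \<Longrightarrow> (f p has_real_derivative f' p t) (at t within {0..d})"
  shows "unif_Ck (Suc k) P d f"
  using assms unfolding unif_Ck.simps by blast

lemma unif_Ck_Suc_imp: "unif_Ck (Suc k) P d f \<Longrightarrow> unif_Ck k P d f"
proof (induction k arbitrary: f)
  case 0
  thus ?case using unif_Ck_continuous[OF 0] unif_Ck_bounded[OF 0] by simp
next
  case (Suc k)
  from Suc.prems obtain f' where f': "\<And>p t. p \<in> P \<Longrightarrow> t \<in> {0..d} \<Longrightarrow> (f p has_real_derivative f' p t) (at t within {0..d})"
    "unif_Ck (Suc k) P d f'" "unif_bounded P d f" by (rule unif_Ck_SucE) blast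
  show ?case by (rule unif_Ck_SucI[OF f'(3) Suc.IH[OF f'(2)] f'(1)])
qed

lemma unif_Ck_le: "unif_Ck k P d f \<Longrightarrow> j \<le> k \<Longrightarrow> unif_Ck j P d f"
  by (induction k) (auto simp: le_Suc_eq dest: unif_Ck_Suc_imp simp del: unif_Ck.simps)

lemma unif_Ck_cong:
  assumes "unif_Ck k P d f" and eq: "\<And>p t. p \<in> P \<Longrightarrow> t \<in> {0..d} \<Longrightarrow> g p t = f p t"
  shows "unif_Ck k P d g"
proof (cases k)
  case 0
  have "continuous_on {0..d} (g p)" if "p \<in> P" for p
    by (rule continuous_on_eq[OF unif_Ck_continuous[OF assms(1) that]]) (use eq[OF that] in auto)
  thus ?thesis using assms 0 by (auto simp: unif_bounded_def)
next
  case (Suc j)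
  from assms(1)[unfolded Suc] obtain f' where f': "\<And>p t. p \<in> P \<Longrightarrow> t \<in> {0..d} \<Longrightarrow> (f p has_real_derivative f' p t) (at t within {0..d})"
    "unif_Ck j P d f'" "unif_bounded P d f" by (rule unif_Ck_SucE) blast
  show ?thesis unfolding Suc
  proof (rule unif_Ck_SucI[OF _ f'(2)])
    show "unif_bounded P d g" using f'(3) eq by (auto simp: unif_bounded_def)
    fix p t assume pt: "p \<in> P" "t \<in> {0..d}"
    show "(g p has_real_derivative f' p t) (at t within {0..d})"
      using f'(1)[OF pt] pt eq unfolding has_field_derivative_def
      by (auto intro: has_derivative_transform)
  qed
qed

text \<open>With \<open>h\<close> the identity this restricts the family to fewer parameters or a
  shorter interval; with other \<open>h\<close> it adds dummy parameters or passes to a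
  chart.\<close>

lemma unif_Ck_reindex:
  assumes "unif_Ck k P d f" "\<And>q. q \<in> Q \<Longrightarrow> h q \<in> P" "d' \<le> d"
  shows "unif_Ck k Q d' (\<lambda>q. f (h q))"
  using assms(1)
proof (induction k arbitrary: f)
  case 0
  have "continuous_on {0..d'} (f (h q))" if "q \<in> Q" for q
    by (rule continuous_on_subset[OF unif_Ck_continuous[OF 0 assms(2)[OF that]]]) (use assms in auto)
  moreover have "unif_bounded Q d' (\<lambda>q. f (h q))" using unif_Ck_bounded[OF 0] assms(2,3)
    unfolding unif_bounded_def by (meson atLeastAtMost_iff order_trans)
  ultimately show ?case by simp
next
  case (Suc k)
  from Suc.prems obtain f' where f': "\<And>p t. p \<in> P \<Longrightarrow> t \<in> {0..d} \<Longrightarrow> (f p has_real_derivative f' p t) (at t within {0..d})"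
    "unif_Ck k P d f'" "unif_bounded P d f" by (rule unif_Ck_SucE) blast
  show ?case
  proof (rule unif_Ck_SucI[OF _ Suc.IH[OF f'(2)]])
    show "unif_bounded Q d' (\<lambda>q. f (h q))" using f'(3) assms(2,3) unfolding unif_bounded_def
      by (meson atLeastAtMost_iff order_trans)
    fix q t assume qt: "q \<in> Q" "t \<in> {0..d'}"
    have "(f (h q) has_real_derivative f' (h q) t) (at t within {0..d})" 
      by (rule f'(1)) (use qt assms in auto)
    thus "(f (h q) has_real_derivative f' (h q) t) (at t within {0..d'})"
      by (rule DERIV_subset) (use assms in auto)
  qed
qed

lemma unif_Ck_const:
  assumes "\<And>p. p \<in> P \<Longrightarrow> \<bar>c p\<bar> \<le> C"
  shows "unif_Ck k P d (\<lambda>p t. c p)"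
  using assms
proof (induction k arbitrary: c C)
  case 0
  thus ?case by (auto simp: unif_bounded_def)
next
  case (Suc k)
  have "unif_Ck k P d (\<lambda>p t. 0)" by (rule Suc.IH[of _ 0]) simp
  thus ?case by (rule unif_Ck_SucI[rotated]) (use Suc.prems in \<open>auto simp: unif_bounded_def\<close>)
qed

lemma unif_Ck_ident: "unif_Ck k P d (\<lambda>p t. t)"
proof (cases k)
  case 0
  thus ?thesis by (auto simp: unif_bounded_def)
next
  case (Suc j)
  have "unif_bounded P d (\<lambda>p t. t)" by (auto simp: unif_bounded_def)
  thus ?thesis unfolding Suc by (rule unif_Ck_SucI[OF _ unif_Ck_const[of _ "\<lambda>_. 1" 1]]) auto
qed

section \<open>Algebraic operations, composition, reciprocals and square roots\<close>

lemma unif_bounded_add: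
  assumes "unif_bounded P d f" "unif_bounded P d g"
  shows "unif_bounded P d (\<lambda>p t. f p t + g p t)"
proof -
  obtain A where A: "\<And>p t. p \<in> P \<Longrightarrow> t \<in> {0..d} \<Longrightarrow> \<bar>f p t\<bar> \<le> A" using unif_boundedE[OF assms(1)] by metis
  obtain B where B: "\<And>p t. p \<in> P \<Longrightarrow> t \<in> {0..d} \<Longrightarrow> \<bar>g p t\<bar> \<le> B" using unif_boundedE[OF assms(2)] by metis
  show ?thesis unfolding unif_bounded_def
    by (intro exI[of _ "A + B"] ballI) (use A B in \<open>fastforce intro: order_trans[OF abs_triangle_ineq] add_mono\<close>)
qed

lemma unif_bounded_mult:
  assumes "unif_bounded P d f" "unif_bounded P d g"
  shows "unif_bounded P d (\<lambda>p t. f p t * g p t)"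
proof -
  obtain A where A: "A > 0" "\<And>p t. p \<in> P \<Longrightarrow> t \<in> {0..d} \<Longrightarrow> \<bar>f p t\<bar> \<le> A" using unif_boundedE[OF assms(1)] by metis
  obtain B where B: "B > 0" "\<And>p t. p \<in> P \<Longrightarrow> t \<in> {0..d} \<Longrightarrow> \<bar>g p t\<bar> \<le> B" using unif_boundedE[OF assms(2)] by metis
  show ?thesis unfolding unif_bounded_def
    by (intro exI[of _ "A * B"] ballI) (use A B in \<open>auto simp: abs_mult intro!: mult_mono\<close>)
qed

lemma unif_Ck_add:
  assumes "unif_Ck k P d f" "unif_Ck k P d g"
  shows "unif_Ck k P d (\<lambda>p t. f p t + g p t)"
  using assms
proof (induction k arbitrary: f g)
  case 0
  thus ?case by (auto intro: unif_bounded_add continuous_on_add)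
next
  case (Suc k)
  from Suc.prems(1) obtain f' where f': "\<And>p t. p \<in> P \<Longrightarrow> t \<in> {0..d} \<Longrightarrow> (f p has_real_derivative f' p t) (at t within {0..d})"
    "unif_Ck k P d f'" "unif_bounded P d f" by (rule unif_Ck_SucE) blast
  from Suc.prems(2) obtain g' where g': "\<And>p t. p \<in> P \<Longrightarrow> t \<in> {0..d} \<Longrightarrow> (g p has_real_derivative g' p t) (at t within {0..d})"
    "unif_Ck k P d g'" "unif_bounded P d g" by (rule unif_Ck_SucE) blast
  show ?case
    by (rule unif_Ck_SucI[OF unif_bounded_add[OF f'(3) g'(3)] Suc.IH[OF f'(2) g'(2)]])
       (intro DERIV_add f'(1) g'(1))
qed

lemma unif_Ck_mult:
  assumes "unif_Ck k P d f" "unif_Ck k P d g"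
  shows "unif_Ck k P d (\<lambda>p t. f p t * g p t)"
  using assms
proof (induction k arbitrary: f g)
  case 0
  thus ?case by (auto intro: unif_bounded_mult continuous_on_mult)
next
  case (Suc k)
  from Suc.prems(1) obtain f' where f': "\<And>p t. p \<in> P \<Longrightarrow> t \<in> {0..d} \<Longrightarrow> (f p has_real_derivative f' p t) (at t within {0..d})"
    "unif_Ck k P d f'" "unif_bounded P d f" by (rule unif_Ck_SucE) blast
  from Suc.prems(2) obtain g' where g': "\<And>p t. p \<in> P \<Longrightarrow> t \<in> {0..d} \<Longrightarrow> (g p has_real_derivative g' p t) (at t within {0..d})"
    "unif_Ck k P d g'" "unif_bounded P d g" by (rule unif_Ck_SucE) blast
  note fg = Suc.prems[THEN unif_Ck_Suc_imp]
  show ?case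
    by (rule unif_Ck_SucI[OF unif_bounded_mult[OF f'(3) g'(3)]
          unif_Ck_add[OF Suc.IH[OF f'(2) fg(2)] Suc.IH[OF g'(2) fg(1)]]])
       (intro DERIV_mult f'(1) g'(1))
qed

lemma unif_Ck_cmult: "unif_Ck k P d f \<Longrightarrow> unif_Ck k P d (\<lambda>p t. c * f p t)"
  by (intro unif_Ck_mult unif_Ck_const[of _ "\<lambda>_. c" "\<bar>c\<bar>"]) auto

lemma unif_Ck_uminus: "unif_Ck k P d f \<Longrightarrow> unif_Ck k P d (\<lambda>p t. - f p t)"
  using unif_Ck_cmult[of k P d f "-1"] by simp

lemma unif_Ck_diff: "unif_Ck k P d f \<Longrightarrow> unif_Ck k P d g \<Longrightarrow> unif_Ck k P d (\<lambda>p t. f p t - g p t)"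
  using unif_Ck_add[OF _ unif_Ck_uminus, of k P d f g] by simp

lemma unif_Ck_sum:
  "(\<And>i. i \<in> S \<Longrightarrow> unif_Ck k P d (f i)) \<Longrightarrow> unif_Ck k P d (\<lambda>p t. \<Sum>i\<in>S. f i p t)"
proof (induction S rule: infinite_finite_induct)
  case (insert x F)
  thus ?case by (simp add: unif_Ck_add)
qed (simp_all add: unif_Ck_const[of _ _ 0])

lemma unif_Ck_prod:
  "(\<And>i. i \<in> S \<Longrightarrow> unif_Ck k P d (f i)) \<Longrightarrow> unif_Ck k P d (\<lambda>p t. \<Prod>i\<in>S. f i p t)"
proof (induction S rule: infinite_finite_induct)
  case (insert x F)
  thus ?case by (simp add: unif_Ck_mult)
qed (simp_all add: unif_Ck_const[of _ _ 1])

lemma unif_Ck_power: "unif_Ck k P d f \<Longrightarrow> unif_Ck k P d (\<lambda>p t. f p t ^ n)"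
  using unif_Ck_prod[of "{..<n}" k P d "\<lambda>_. f"] by simp

lemma unif_bounded_compose:
  assumes "unif_bounded P d f" "\<And>p t. p \<in> P \<Longrightarrow> t \<in> {0..e} \<Longrightarrow> g p t \<in> {0..d}"
  shows "unif_bounded P e (\<lambda>p t. f p (g p t))"
  using assms unfolding unif_bounded_def by blast

lemma unif_Ck_compose:
  assumes "unif_Ck k P d f" "unif_Ck k P e g" and gd: "\<And>p t. p \<in> P \<Longrightarrow> t \<in> {0..e} \<Longrightarrow> g p t \<in> {0..d}"
  shows "unif_Ck k P e (\<lambda>p t. f p (g p t))"
  using assms(1,2)
proof (induction k arbitrary: f)
  case 0
  have "unif_bounded P e (\<lambda>p t. f p (g p t))" by (rule unif_bounded_compose[OF unif_Ck_bounded[OF 0(1)] gd])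
  moreover have "continuous_on {0..e} (\<lambda>t. f p (g p t))" if "p \<in> P" for p
    by (rule continuous_on_compose2[OF unif_Ck_continuous[OF 0(1) that] unif_Ck_continuous[OF 0(2) that]])
       (use gd that in auto)
  ultimately show ?case by simp
next
  case (Suc k)
  from Suc.prems(1) obtain f' where f': "\<And>p t. p \<in> P \<Longrightarrow> t \<in> {0..d} \<Longrightarrow> (f p has_real_derivative f' p t) (at t within {0..d})"
    "unif_Ck k P d f'" "unif_bounded P d f" by (rule unif_Ck_SucE) blast
  from Suc.prems(2) obtain g' where g': "\<And>p t. p \<in> P \<Longrightarrow> t \<in> {0..e} \<Longrightarrow> (g p has_real_derivative g' p t) (at t within {0..e})"
    "unif_Ck k P e g'" "unif_bounded P e g" by (rule unif_Ck_SucE) blast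
  show ?case
  proof (rule unif_Ck_SucI[OF _ unif_Ck_mult[OF Suc.IH[OF f'(2) unif_Ck_Suc_imp[OF Suc.prems(2)]] g'(2)]])
    show "unif_bounded P e (\<lambda>p t. f p (g p t))" by (rule unif_bounded_compose[OF f'(3) gd])
    fix p t assume pt: "p \<in> P" "t \<in> {0..e}"
    have "(f p has_real_derivative f' p (g p t)) (at (g p t) within g p ` {0..e})"
      by (rule DERIV_subset[OF f'(1)[OF pt(1) gd[OF pt]]]) (use gd pt in auto)
    from DERIV_image_chain[OF this g'(1)[OF pt]]
    show "((\<lambda>t. f p (g p t)) has_real_derivative f' p (g p t) * g' p t) (at t within {0..e})"
      by (simp add: o_def)
  qed
qed

lemma unif_bounded_inverse:
  assumes "c > 0" "\<And>p t. p \<in> P \<Longrightarrow> t \<in> {0..d} \<Longrightarrow> c \<le> f p t"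
  shows "unif_bounded P d (\<lambda>p t. inverse (f p t))"
  unfolding unif_bounded_def
proof (intro exI[of _ "inverse c"] ballI)
  fix p t assume "p \<in> P" "t \<in> {0..d}"
  hence "c \<le> f p t" by (rule assms(2))
  thus "\<bar>inverse (f p t)\<bar> \<le> inverse c" using assms(1) by (simp add: le_imp_inverse_le)
qed

text \<open>A positive lower bound common to all parameters is what keeps the bounds uniform: each
  derivative of the reciprocal is again a product of reciprocals and derivatives of
  \<open>f\<close>.\<close>

lemma unif_Ck_inverse:
  assumes "unif_Ck k P d f" and c: "c > 0" "\<And>p t. p \<in> P \<Longrightarrow> t \<in> {0..d} \<Longrightarrow> c \<le> f p t"
  shows "unif_Ck k P d (\<lambda>p t. inverse (f p t))"
  using assms(1)
proof (induction k)
  case 0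
  have "continuous_on {0..d} (\<lambda>t. inverse (f p t))" if "p \<in> P" for p
    using unif_Ck_continuous[OF 0 that] c that by (intro continuous_on_inverse) force+
  thus ?case using unif_bounded_inverse[OF c] by simp
next
  case (Suc k)
  from Suc.prems(1) obtain f' where f': "\<And>p t. p \<in> P \<Longrightarrow> t \<in> {0..d} \<Longrightarrow> (f p has_real_derivative f' p t) (at t within {0..d})"
    "unif_Ck k P d f'" "unif_bounded P d f" by (rule unif_Ck_SucE) blast
  note inv = Suc.IH[OF unif_Ck_Suc_imp[OF Suc.prems]]
  show ?case
  proof (rule unif_Ck_SucI[OF unif_bounded_inverse[OF c] unif_Ck_uminus[OF unif_Ck_mult[OF unif_Ck_mult[OF inv f'(2)] inv]]])
    fix p t assume pt: "p \<in> P" "t \<in> {0..d}"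
    have "f p t \<noteq> 0" using c(2)[OF pt] c(1) by auto
    from DERIV_inverse'[OF f'(1)[OF pt] this]
    show "((\<lambda>t. inverse (f p t)) has_real_derivative - (inverse (f p t) * f' p t * inverse (f p t))) (at t within {0..d})" .
  qed auto
qed

lemma unif_Ck_sqrt:
  assumes "unif_Ck k P d f" and c: "c > 0" "\<And>p t. p \<in> P \<Longrightarrow> t \<in> {0..d} \<Longrightarrow> c \<le> f p t"
  shows "unif_Ck k P d (\<lambda>p t. sqrt (f p t))"
  using assms(1)
proof (induction k)
  case 0
  have "unif_bounded P d f" by (rule unif_Ck_bounded[OF 0])
  then obtain C where "\<And>p t. p \<in> P \<Longrightarrow> t \<in> {0..d} \<Longrightarrow> \<bar>f p t\<bar> \<le> C" by (rule unif_boundedE) blast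
  hence "unif_bounded P d (\<lambda>p t. sqrt (f p t))"
    unfolding unif_bounded_def by (intro exI[of _ "sqrt C"]) (auto simp: abs_le_iff real_sqrt_minus[symmetric] simp del: real_sqrt_minus)
  thus ?case using unif_Ck_continuous[OF 0] by (auto intro: continuous_on_real_sqrt)
next
  case (Suc k)
  from Suc.prems(1) obtain f' where f': "\<And>p t. p \<in> P \<Longrightarrow> t \<in> {0..d} \<Longrightarrow> (f p has_real_derivative f' p t) (at t within {0..d})"
    "unif_Ck k P d f'" "unif_bounded P d f" by (rule unif_Ck_SucE) blast
  note IH = Suc.IH[OF unif_Ck_Suc_imp[OF Suc.prems]]
  have c': "2 * sqrt c > 0" "\<And>p t. p \<in> P \<Longrightarrow> t \<in> {0..d} \<Longrightarrow> 2 * sqrt c \<le> 2 * sqrt (f p t)"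
    using c by auto
  note inv = unif_Ck_inverse[OF unif_Ck_cmult[OF IH, of 2] c']
  show ?case
  proof (rule unif_Ck_SucI[OF unif_Ck_bounded[OF IH] unif_Ck_mult[OF inv f'(2)]])
    fix p t assume pt: "p \<in> P" "t \<in> {0..d}"
    have pos: "f p t > 0" using c(2)[OF pt] c(1) by auto
    show "((\<lambda>t. sqrt (f p t)) has_real_derivative inverse (2 * sqrt (f p t)) * f' p t) (at t within {0..d})"
      by (rule DERIV_cong[OF DERIV_chain2[OF DERIV_real_sqrt[OF pos] f'(1)[OF pt]]]) (simp add: field_simps)
  qed auto
qed

section \<open>Antiderivatives and parameter integrals\<close>

lemma unif_Ck_antiderivative:
  assumes "unif_Ck k P d f"
  shows "unif_Ck (Suc k) P d (\<lambda>p t. integral {0..t} (f p))"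
proof (rule unif_Ck_SucI[OF _ assms])
  obtain C where C: "C > 0" "\<And>p t. p \<in> P \<Longrightarrow> t \<in> {0..d} \<Longrightarrow> \<bar>f p t\<bar> \<le> C" 
    using unif_boundedE[OF unif_Ck_bounded[OF assms]] by metis
  show "unif_bounded P d (\<lambda>p t. integral {0..t} (f p))"
    unfolding unif_bounded_def
  proof (intro exI[of _ "C * d"] ballI)
    fix p t assume pt: "p \<in> P" "t \<in> {0..d}"
    have "norm (integral {0..t} (f p)) \<le> C * (t - 0)"
      by (rule integral_bound) (use pt C(2) continuous_on_subset[OF unif_Ck_continuous[OF assms pt(1)]] in auto)
    also have "\<dots> \<le> C * d" using pt C by auto
    finally show "\<bar>integral {0..t} (f p)\<bar> \<le> C * d" by simp
  qed
  fix p t assume "p \<in> P" "t \<in> {0..d}"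
  thus "((\<lambda>t. integral {0..t} (f p)) has_real_derivative f p t) (at t within {0..d})"
    by (intro integral_has_real_derivative unif_Ck_continuous[OF assms])
qed

text \<open>Differentiation under the integral sign by dominated convergence; the uniform bounds are
  integrable majorants because the measure is finite. Measurability in \<open>y\<close> is assumed
  for \<open>f\<close> alone and passes to the derivatives, so that the induction can
  continue.\<close>

lemma unif_Ck_integral:
  fixes f :: "'x \<times> 'y \<Rightarrow> real \<Rightarrow> real"
  assumes "unif_Ck k (X \<times> space \<nu>) d f" and d: "d > 0" and fin: "finite_measure \<nu>"
    and "\<And>x t. x \<in> X \<Longrightarrow> t \<in> {0..d} \<Longrightarrow> (\<lambda>y. f (x, y) t) \<in> borel_measurable \<nu>"
  shows "unif_Ck k X d (\<lambda>x t. \<integral>y. f (x, y) t \<partial>\<nu>)"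
  using assms(1,4)
proof (induction k arbitrary: f)
  interpret finite_measure \<nu> by fact
  have bdd: "unif_bounded X d (\<lambda>x t. \<integral>y. f (x, y) t \<partial>\<nu>)"
    if b: "unif_bounded (X \<times> space \<nu>) d f" and m: "\<And>x t. x \<in> X \<Longrightarrow> t \<in> {0..d} \<Longrightarrow> (\<lambda>y. f (x, y) t) \<in> borel_measurable \<nu>" for f
  proof -
    obtain C where C: "C > 0" "\<And>p t. p \<in> X \<times> space \<nu> \<Longrightarrow> t \<in> {0..d} \<Longrightarrow> \<bar>f p t\<bar> \<le> C" 
      using unif_boundedE[OF b] by metis
    show ?thesis unfolding unif_bounded_def
    proof (intro exI[of _ "C * measure \<nu> (space \<nu>)"] ballI)
      fix x t assume xt: "x \<in> X" "t \<in> {0..d}"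
      have "norm (\<integral>y. f (x, y) t \<partial>\<nu>) \<le> (\<integral>y. norm (f (x, y) t) \<partial>\<nu>)" by (rule integral_norm_bound)
      also have "\<dots> \<le> (\<integral>y. C \<partial>\<nu>)"
        using C xt m[OF xt] by (intro integral_mono integrable_const_bound[of _ C]) auto
      finally show "\<bar>\<integral>y. f (x, y) t \<partial>\<nu>\<bar> \<le> C * measure \<nu> (space \<nu>)" by (simp add: mult.commute)
    qed
  qed
  {
    case 0
    have "continuous_on {0..d} (\<lambda>t. \<integral>y. f (x, y) t \<partial>\<nu>)" if x: "x \<in> X" for x
      unfolding continuous_on_sequentially
    proof (intro allI ballI impI)
      fix T t assume t: "t \<in> {0..d}" and T: "(\<forall>n. T n \<in> {0..d}) \<and> T \<longlonglongrightarrow> t"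
      obtain C where C: "C > 0" "\<And>p t. p \<in> X \<times> space \<nu> \<Longrightarrow> t \<in> {0..d} \<Longrightarrow> \<bar>f p t\<bar> \<le> C" 
        using unif_boundedE[OF unif_Ck_bounded[OF 0(1)]] by metis
      show "((\<lambda>t. \<integral>y. f (x, y) t \<partial>\<nu>) \<circ> T) \<longlonglongrightarrow> (\<integral>y. f (x, y) t \<partial>\<nu>)"
        unfolding o_def
      proof (rule integral_dominated_convergence[where w = "\<lambda>_. C"])
        show "AE y in \<nu>. (\<lambda>i. f (x, y) (T i)) \<longlonglongrightarrow> f (x, y) t"
        proof (rule AE_I2)
          fix y assume "y \<in> space \<nu>"
          hence "continuous_on {0..d} (f (x, y))" using unif_Ck_continuous[OF 0(1)] x by auto
          thus "(\<lambda>i. f (x, y) (T i)) \<longlonglongrightarrow> f (x, y) t"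
            using T t unfolding continuous_on_sequentially o_def by blast
        qed
        show "AE y in \<nu>. norm (f (x, y) (T i)) \<le> C" for i
          using C x T by (intro AE_I2) auto
      qed (use 0(2)[OF x] t T in auto)
    qed
    thus ?case using bdd[OF unif_Ck_bounded[OF 0(1)] 0(2)] by simp
  next
    case (Suc k)
    from Suc.prems(1) obtain f' where f': "\<And>p t. p \<in> X \<times> space \<nu> \<Longrightarrow> t \<in> {0..d} \<Longrightarrow> (f p has_real_derivative f' p t) (at t within {0..d})"
      "unif_Ck k (X \<times> space \<nu>) d f'" "unif_bounded (X \<times> space \<nu>) d f" by (rule unif_Ck_SucE) blast
    obtain C where C: "C > 0" "\<And>p t. p \<in> X \<times> space \<nu> \<Longrightarrow> t \<in> {0..d} \<Longrightarrow> \<bar>f' p t\<bar> \<le> C" 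
      using unif_boundedE[OF unif_Ck_bounded[OF f'(2)]] by metis
    have quot: "(\<lambda>i. (f (x, y) (T i) - f (x, y) t) / (T i - t)) \<longlonglongrightarrow> f' (x, y) t"
      if "x \<in> X" "y \<in> space \<nu>" "t \<in> {0..d}" "\<And>i. T i \<in> {0..d} - {t}" "T \<longlonglongrightarrow> t" for x y t and T :: "nat \<Rightarrow> real"
    proof -
      have "((\<lambda>s. (f (x, y) s - f (x, y) t) / (s - t)) \<longlongrightarrow> f' (x, y) t) (at t within {0..d})"
        using f'(1)[of "(x, y)" t] that by (simp add: has_field_derivative_iff)
      thus ?thesis using that(4,5) by (auto simp: tendsto_at_iff_sequentially o_def)
    qed
    \<comment> \<open>The derivative is a pointwise limit of difference quotients along a sequence
      inside the interval, which exists since \<open>d > 0\<close>.\<close>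
    have meas': "(\<lambda>y. f' (x, y) t) \<in> borel_measurable \<nu>" if xt: "x \<in> X" "t \<in> {0..d}" for x t
    proof -
      have "t islimpt {0..d}" using xt d by (simp add: islimpt_Icc)
      then obtain T where T: "\<And>i. T i \<in> {0..d} - {t}" "T \<longlonglongrightarrow> t" unfolding islimpt_sequential by blast
      show ?thesis
      proof (rule borel_measurable_LIMSEQ_real)
        show "(\<lambda>i. (f (x, y) (T i) - f (x, y) t) / (T i - t)) \<longlonglongrightarrow> f' (x, y) t" if "y \<in> space \<nu>" for y
          by (rule quot) (use xt T that in auto)
        have [measurable]: "(\<lambda>y. f (x, y) t) \<in> borel_measurable \<nu>" "(\<lambda>y. f (x, y) (T i)) \<in> borel_measurable \<nu>" for i
          using Suc.prems(2)[OF xt(1)] xt T by auto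
        show "(\<lambda>y. (f (x, y) (T i) - f (x, y) t) / (T i - t)) \<in> borel_measurable \<nu>" for i by measurable
      qed
    qed
    show ?case
    proof (rule unif_Ck_SucI[OF bdd[OF f'(3) Suc.prems(2)] Suc.IH[OF f'(2) meas']])
      fix x t assume xt: "x \<in> X" "t \<in> {0..d}"
      show "((\<lambda>t. \<integral>y. f (x, y) t \<partial>\<nu>) has_real_derivative (\<integral>y. f' (x, y) t \<partial>\<nu>)) (at t within {0..d})"
        unfolding has_field_derivative_iff tendsto_at_iff_sequentially o_def
      proof (intro allI impI)
        fix T assume T: "\<forall>i. T i \<in> {0..d} - {t}" "T \<longlonglongrightarrow> t"
        have int: "integrable \<nu> (\<lambda>y. f (x, y) s)" if "s \<in> {0..d}" for s
        proof -
          obtain B where "\<And>p t. p \<in> X \<times> space \<nu> \<Longrightarrow> t \<in> {0..d} \<Longrightarrow> \<bar>f p t\<bar> \<le> B" 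
            using unif_boundedE[OF f'(3)] by metis
          thus ?thesis using xt that Suc.prems(2) by (intro integrable_const_bound[of _ B]) auto
        qed
        have "((\<integral>y. f (x, y) (T i) \<partial>\<nu>) - (\<integral>y. f (x, y) t \<partial>\<nu>)) / (T i - t) =
           (\<integral>y. (f (x, y) (T i) - f (x, y) t) / (T i - t) \<partial>\<nu>)" for i
          using int[of "T i"] int[OF xt(2)] T by simp
        note eq = this
        have "(\<lambda>i. \<integral>y. (f (x, y) (T i) - f (x, y) t) / (T i - t) \<partial>\<nu>) \<longlonglongrightarrow> (\<integral>y. f' (x, y) t \<partial>\<nu>)"
        proof (rule integral_dominated_convergence[where w = "\<lambda>_. C"])
          show "(\<lambda>y. f' (x, y) t) \<in> borel_measurable \<nu>" by (rule meas'[OF xt])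
          show "(\<lambda>y. (f (x, y) (T i) - f (x, y) t) / (T i - t)) \<in> borel_measurable \<nu>" for i
          proof -
            have [measurable]: "(\<lambda>y. f (x, y) t) \<in> borel_measurable \<nu>" "(\<lambda>y. f (x, y) (T i)) \<in> borel_measurable \<nu>"
              using Suc.prems(2)[OF xt(1)] xt T by auto
            show ?thesis by measurable
          qed
          show "AE y in \<nu>. (\<lambda>i. (f (x, y) (T i) - f (x, y) t) / (T i - t)) \<longlonglongrightarrow> f' (x, y) t"
            by (intro AE_I2 quot) (use xt T in auto)
          show "AE y in \<nu>. norm ((f (x, y) (T i) - f (x, y) t) / (T i - t)) \<le> C" for i
          proof (rule AE_I2)
            fix y assume y: "y \<in> space \<nu>"
            \<comment> \<open>The mean value inequality bounds all difference quotients by the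
              uniform bound \<open>C\<close> of the derivative.\<close>
            have "norm (f (x, y) (T i) - f (x, y) t) \<le> C * norm (T i - t)"
              by (rule field_differentiable_bound[of "{0..d}" _ "f' (x, y)"]) (use xt T y f'(1) C in auto)
            moreover have "T i \<noteq> t" using T by auto
            ultimately show "norm ((f (x, y) (T i) - f (x, y) t) / (T i - t)) \<le> C"
              by (simp add: field_simps abs_divide)
          qed
        qed auto
        thus "(\<lambda>i. ((\<integral>y. f (x, y) (T i) \<partial>\<nu>) - (\<integral>y. f (x, y) t \<partial>\<nu>)) / (T i - t)) \<longlonglongrightarrow> (\<integral>y. f' (x, y) t \<partial>\<nu>)"
          unfolding eq .
      qed
    qed
  }
qed

text \<open>The quotient \<open>f(t) / t\<close> is the average of \<open>f'\<close> over \<open>[0, t]\<close>.\<close>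
lemma unif_Ck_hadamard:
  fixes P :: "'a set"
  assumes f: "unif_Ck (Suc k) P d f" and d: "d > 0" and f0: "\<And>p. p \<in> P \<Longrightarrow> f p 0 = 0"
  obtains g where "unif_Ck k P d g" "\<And>p t. p \<in> P \<Longrightarrow> t \<in> {0..d} \<Longrightarrow> f p t = t * g p t"
proof -
  from f obtain f' where f': "\<And>p t. p \<in> P \<Longrightarrow> t \<in> {0..d} \<Longrightarrow> (f p has_real_derivative f' p t) (at t within {0..d})"
    "unif_Ck k P d f'" "unif_bounded P d f" by (rule unif_Ck_SucE) blast
  define \<nu> where "\<nu> = lebesgue_on {0..1::real}"
  have sp: "space \<nu> = {0..1}" by (simp add: \<nu>_def)
  have le: "s * t \<in> {0..d}" if "s \<in> {0..1}" "t \<in> {0..d}" for s t :: real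
  proof -
    have "s * t \<le> 1 * t" using that by (intro mult_right_mono) auto
    thus ?thesis using that by auto
  qed
  have cont: "continuous_on {0..1} (\<lambda>s. f' p (s * t))" if "p \<in> P" "t \<in> {0..d}" for p t
    by (rule continuous_on_compose2[OF unif_Ck_continuous[OF f'(2) that(1)]])
       (use le that in \<open>auto intro!: continuous_intros\<close>)
  define g where "g p t = (\<integral>s. f' p (s * t) \<partial>\<nu>)" for p t
  \<comment> \<open>The averaging variable \<open>s\<close> is made part of the parameter, so that
    the average over \<open>s\<close> becomes a parameter integral of a family with uniform
    bounds.\<close>
  define F where "F q t = f' (fst q) (snd q * t)" for q :: "'a \<times> real" and t
  have "unif_Ck k P d (\<lambda>p t. \<integral>s. F (p, s) t \<partial>\<nu>)"
  proof (rule unif_Ck_integral[OF _ d])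
    show "unif_Ck k (P \<times> space \<nu>) d F"
      unfolding F_def
    proof (rule unif_Ck_compose[where f = "\<lambda>q t. f' (fst q) t" and g = "\<lambda>q t. snd q * t" and d = d])
      show "unif_Ck k (P \<times> space \<nu>) d (\<lambda>p t. f' (fst p) t)" by (rule unif_Ck_reindex[OF f'(2)]) auto
      show "unif_Ck k (P \<times> space \<nu>) d (\<lambda>p t. snd p * t)"
        by (intro unif_Ck_mult unif_Ck_ident unif_Ck_const[of _ _ 1]) (auto simp: sp)
      fix p :: "'a \<times> real" and t assume "p \<in> P \<times> space \<nu>" "t \<in> {0..d}"
      thus "snd p * t \<in> {0..d}" by (intro le) (auto simp: sp)
    qed
    show "finite_measure \<nu>" unfolding \<nu>_def
      by (intro finite_measure_lebesgue_on) auto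
    fix x t assume "x \<in> P" "t \<in> {0..d}"
    thus "(\<lambda>y. F (x, y) t) \<in> borel_measurable \<nu>"
      unfolding F_def fst_conv snd_conv \<nu>_def
      by (intro continuous_imp_measurable_on_sets_lebesgue cont) auto
  qed
  hence 1: "unif_Ck k P d g" by (simp add: g_def[abs_def] F_def)
  show ?thesis
  proof (rule that[OF 1])
    fix p t assume pt: "p \<in> P" "t \<in> {0..d}"
    have "((\<lambda>s. t * f' p (s * t)) has_integral (f p (1 * t) - f p (0 * t))) {0..1}"
    proof (rule fundamental_theorem_of_calculus)
      fix s :: real assume s: "s \<in> {0..1}"
      have "(f p has_real_derivative f' p (s * t)) (at (s * t) within (\<lambda>s. s * t) ` {0..1})"
        by (rule DERIV_subset[OF f'(1)[OF pt(1) le[OF s pt(2)]]]) (use le pt in auto)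
      moreover have "((\<lambda>s. s * t) has_real_derivative t) (at s within {0..1})"
        by (auto intro!: derivative_eq_intros)
      ultimately have "(f p \<circ> (\<lambda>s. s * t) has_real_derivative f' p (s * t) * t) (at s within {0..1})"
        by (rule DERIV_image_chain)
      hence "((\<lambda>s. f p (s * t)) has_real_derivative f' p (s * t) * t) (at s within {0..1})"
        by (simp add: o_def)
      thus "((\<lambda>s. f p (s * t)) has_vector_derivative t * f' p (s * t)) (at s within {0..1})"
        by (simp add: has_real_derivative_iff_has_vector_derivative mult.commute)
    qed simp
    from integral_unique[OF this] have "f p t = integral {0..1} (\<lambda>s. t * f' p (s * t))"
      using f0[OF pt(1)] by simp
    also have "\<dots> = t * integral {0..1} (\<lambda>s. f' p (s * t))" by simp
    also have "integral {0..1} (\<lambda>s. f' p (s * t)) = g p t"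
      unfolding g_def \<nu>_def using cont[OF pt]
      by (intro lebesgue_integral_eq_integral[symmetric] continuous_imp_integrable_real) auto
    finally show "f p t = t * g p t" .
  qed
qed


text \<open>The slope bound \<open>c\<close> makes \<sigma> strictly increasing with
  \<open>\<sigma> p d \<ge> c * d\<close>, so all values up to \<open>c * d\<close> are attained and
  the inverse is Lipschitz. Its derivative is the reciprocal of \<sigma>' at \<rho>, and smoothness
  is bootstrapped from this formula. The last conclusion turns a bound on a distance into a bound on
  the time along a ray.\<close>

lemma unif_Ck_inverse_function:
  assumes \<sigma>: "unif_Ck (Suc k) P d \<sigma>" and d: "d > 0" and \<sigma>0: "\<And>p. p \<in> P \<Longrightarrow> \<sigma> p 0 = 0" and c: "c > 0"
    and inc: "\<And>p s t. p \<in> P \<Longrightarrow> 0 \<le> s \<Longrightarrow> s \<le> t \<Longrightarrow> t \<le> d \<Longrightarrow> c * (t - s) \<le> \<sigma> p t - \<sigma> p s"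
  obtains \<rho> where "unif_Ck (Suc k) P (c * d) \<rho>"
    "\<And>p t. p \<in> P \<Longrightarrow> t \<in> {0..c * d} \<Longrightarrow> \<rho> p t \<in> {0..d} \<and> \<sigma> p (\<rho> p t) = t \<and> \<rho> p t \<le> t / c"
    "\<And>p s t. p \<in> P \<Longrightarrow> t \<in> {0..c * d} \<Longrightarrow> s \<in> {0..d} \<Longrightarrow> \<sigma> p s \<le> t \<longleftrightarrow> s \<le> \<rho> p t"
proof -
  obtain \<sigma>' where \<sigma>': "\<And>p t. p \<in> P \<Longrightarrow> t \<in> {0..d} \<Longrightarrow> (\<sigma> p has_real_derivative \<sigma>' p t) (at t within {0..d})"
    "unif_Ck k P d \<sigma>'" "unif_bounded P d \<sigma>" by (rule unif_Ck_SucE[OF \<sigma>]) blast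
  have "\<exists>s. s \<in> {0..d} \<and> \<sigma> p s = t" if "p \<in> P" "t \<in> {0..c * d}" for p t
  proof -
    have "c * d \<le> \<sigma> p d" using inc[of p 0 d] \<sigma>0 that d by simp
    hence "\<exists>s\<ge>0. s \<le> d \<and> \<sigma> p s = t"
      by (intro IVT' unif_Ck_continuous[OF \<sigma> that(1)]) (use \<sigma>0 that d in auto)
    thus ?thesis by auto
  qed
  then obtain \<rho> where \<rho>: "\<And>p t. p \<in> P \<Longrightarrow> t \<in> {0..c * d} \<Longrightarrow> \<rho> p t \<in> {0..d} \<and> \<sigma> p (\<rho> p t) = t" by metis
  have le: "\<rho> p t \<le> t / c" if "p \<in> P" "t \<in> {0..c * d}" for p t
    using inc[of p 0 "\<rho> p t"] \<rho>[OF that] \<sigma>0 that c by (auto simp: field_simps)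
  have iff: "\<sigma> p s \<le> t \<longleftrightarrow> s \<le> \<rho> p t" if "p \<in> P" "t \<in> {0..c * d}" "s \<in> {0..d}" for p s t
  proof (cases "s \<le> \<rho> p t")
    case True
    hence "c * (\<rho> p t - s) \<le> t - \<sigma> p s" using inc[of p s "\<rho> p t"] \<rho>[OF that(1,2)] that by auto
    moreover have "c * (\<rho> p t - s) \<ge> 0" using c True by simp
    ultimately show ?thesis using True by simp
  next
    case False
    hence "c * (s - \<rho> p t) \<le> \<sigma> p s - t" using inc[of p "\<rho> p t" s] \<rho>[OF that(1,2)] that by auto
    moreover have "c * (s - \<rho> p t) > 0" using c False by simp
    ultimately show ?thesis using False by simp
  qed
  have lip: "c * \<bar>\<rho> p t - \<rho> p u\<bar> \<le> \<bar>t - u\<bar>" if "p \<in> P" "t \<in> {0..c * d}" "u \<in> {0..c * d}" for p t u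
    using inc[of p "\<rho> p t" "\<rho> p u"] inc[of p "\<rho> p u" "\<rho> p t"] \<rho>[OF that(1,2)] \<rho>[OF that(1,3)] that
    by (cases "\<rho> p t \<le> \<rho> p u") (auto simp: abs_if)
  \<comment> \<open>The difference quotients of \<sigma> are at least \<open>c\<close>, and the
    bound survives in the limit.\<close>
  have pos: "c \<le> \<sigma>' p s" if ps: "p \<in> P" "s \<in> {0..d}" for p s
  proof (rule tendsto_lowerbound)
    show "((\<lambda>t. (\<sigma> p t - \<sigma> p s) / (t - s)) \<longlongrightarrow> \<sigma>' p s) (at s within {0..d})"
      using \<sigma>'(1)[OF ps] by (simp add: has_field_derivative_iff)
    show "\<forall>\<^sub>F t in at s within {0..d}. c \<le> (\<sigma> p t - \<sigma> p s) / (t - s)"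
      unfolding eventually_at_filter
    proof (intro always_eventually allI impI)
      fix t assume t: "t \<noteq> s" "t \<in> {0..d}"
      show "c \<le> (\<sigma> p t - \<sigma> p s) / (t - s)"
      proof (cases "t > s")
        case True
        thus ?thesis using inc[of p s t] ps t by (simp add: pos_le_divide_eq)
      next
        case False
        hence "t < s" using t by simp
        thus ?thesis using inc[of p t s] ps t by (simp add: neg_le_divide_eq algebra_simps)
      qed
    qed
    show "at s within {0..d} \<noteq> bot"
      using ps d by (simp add: trivial_limit_within islimpt_Icc)
  qed
  have der: "(\<rho> p has_real_derivative inverse (\<sigma>' p (\<rho> p t))) (at t within {0..c * d})" if pt: "p \<in> P" "t \<in> {0..c * d}" for p t
    unfolding has_field_derivative_iff tendsto_at_iff_sequentially
  proof (intro allI impI)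
    fix T assume T: "\<forall>i. T i \<in> {0..c * d} - {t}" "T \<longlonglongrightarrow> t"
    define S where "S i = \<rho> p (T i)" for i
    have Ti: "T i \<in> {0..c * d}" "T i \<noteq> t" for i using T by auto
    have S: "S i \<in> {0..d}" "\<sigma> p (S i) = T i" for i using \<rho>[OF pt(1) Ti(1)] by (auto simp: S_def)
    have Sn: "S i \<noteq> \<rho> p t" for i using S(2)[of i] \<rho>[OF pt] Ti(2)[of i] by auto
    have "S \<longlonglongrightarrow> \<rho> p t"
    proof (rule tendstoI)
      fix e :: real assume "e > 0"
      hence "eventually (\<lambda>i. dist (T i) t < c * e) sequentially" using T(2) c tendstoD by (metis mult_pos_pos)
      thus "eventually (\<lambda>i. dist (S i) (\<rho> p t) < e) sequentially"
      proof eventually_elim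
        case (elim i)
        have "c * \<bar>S i - \<rho> p t\<bar> < c * e" using lip[OF pt(1) Ti(1)[of i] pt(2)] elim by (simp add: S_def dist_real_def)
        thus ?case using c by (simp add: dist_real_def)
      qed
    qed
    hence "(\<lambda>i. (\<sigma> p (S i) - \<sigma> p (\<rho> p t)) / (S i - \<rho> p t)) \<longlonglongrightarrow> \<sigma>' p (\<rho> p t)"
      using \<sigma>'(1)[OF pt(1), of "\<rho> p t"] \<rho>[OF pt] S(1) Sn
      unfolding has_field_derivative_iff tendsto_at_iff_sequentially o_def by auto
    moreover have "\<sigma>' p (\<rho> p t) \<noteq> 0" using pos[of p "\<rho> p t"] \<rho>[OF pt] pt c by auto
    ultimately have "(\<lambda>i. inverse ((\<sigma> p (S i) - \<sigma> p (\<rho> p t)) / (S i - \<rho> p t))) \<longlonglongrightarrow> inverse (\<sigma>' p (\<rho> p t))"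
      by (rule tendsto_inverse)
    thus "((\<lambda>y. (\<rho> p y - \<rho> p t) / (y - t)) \<circ> T) \<longlonglongrightarrow> inverse (\<sigma>' p (\<rho> p t))"
      using S(2) \<rho>[OF pt] by (simp add: o_def S_def)
  qed
  have bdd: "unif_bounded P (c * d) \<rho>"
    unfolding unif_bounded_def by (intro exI[of _ d] ballI) (use \<rho> in fastforce)
  \<comment> \<open>Bootstrapping: if \<rho> has \<open>j\<close> controlled derivatives, then so
    has \<open>inverse (\<sigma>' p (\<rho> p t))\<close>, which is the derivative of \<rho>. The
    loop stops at \<open>Suc k\<close> because \<sigma>' has only \<open>k\<close> of them.\<close>
  have "unif_Ck j P (c * d) \<rho>" if "j \<le> Suc k" for j
    using that
  proof (induction j)
    case 0
    have "continuous_on {0..c * d} (\<rho> p)" if "p \<in> P" for p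
      by (rule DERIV_continuous_on[OF der[OF that]])
    thus ?case using bdd by simp
  next
    case (Suc j)
    have "unif_Ck j P (c * d) (\<lambda>p t. \<sigma>' p (\<rho> p t))"
      by (rule unif_Ck_compose[OF unif_Ck_le[OF \<sigma>'(2)]]) (use Suc \<rho> in auto)
    hence "unif_Ck j P (c * d) (\<lambda>p t. inverse (\<sigma>' p (\<rho> p t)))"
      by (rule unif_Ck_inverse[OF _ c]) (use pos \<rho> in auto)
    thus ?case by (rule unif_Ck_SucI[OF bdd]) (rule der)
  qed
  from that[OF this[OF order_refl]] show ?thesis using \<rho> le iff by blast
qed

section \<open>Taylor expansion with uniform remainder\<close>

lemma unif_Ck_derivatives:
  assumes "unif_Ck n P d f"
  shows "\<exists>D. D 0 = f \<and> (\<forall>i<n. \<forall>p\<in>P. \<forall>t\<in>{0..d}. (D i p has_real_derivative D (Suc i) p t) (at t within {0..d}))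
     \<and> (\<forall>i\<le>n. unif_bounded P d (D i))"
  using assms
proof (induction n arbitrary: f)
  case 0
  thus ?case by (intro exI[of _ "\<lambda>_. f"]) auto
next
  case (Suc n)
  obtain f' where f': "\<And>p t. p \<in> P \<Longrightarrow> t \<in> {0..d} \<Longrightarrow> (f p has_real_derivative f' p t) (at t within {0..d})"
    "unif_Ck n P d f'" "unif_bounded P d f" by (rule unif_Ck_SucE[OF Suc.prems]) blast
  obtain D where D: "D 0 = f'" "\<forall>i<n. \<forall>p\<in>P. \<forall>t\<in>{0..d}. (D i p has_real_derivative D (Suc i) p t) (at t within {0..d})"
    "\<forall>i\<le>n. unif_bounded P d (D i)" using Suc.IH[OF f'(2)] by blast
  show ?case
    by (rule exI[of _ "case_nat f D"]) (use D f' in \<open>auto split: nat.split\<close>)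
qed

text \<open>\<open>ball_coeff\<close> differentiates within \<open>{0..}\<close>, the families
  within \<open>{0..d}\<close>. The two filters agree at every \<open>t < d\<close>, so the iterated
  derivatives agree there; the right endpoint has to be left out.\<close>

lemma iterated_right_derivative_eq:
  fixes D :: "nat \<Rightarrow> real \<Rightarrow> real"
  assumes "\<And>i t. i < n \<Longrightarrow> t \<in> {0..d} \<Longrightarrow> (D i has_real_derivative D (Suc i) t) (at t within {0..d})"
    and "i \<le> n" "t \<in> {0..<d}"
  shows "((\<lambda>f t. vector_derivative f (at t within {0..})) ^^ i) (D 0) t = D i t"
  using assms(2,3)
proof (induction i arbitrary: t)
  case 0
  show ?case by simp
next
  case (Suc i)
  define G where "G = ((\<lambda>f t. vector_derivative f (at t within {0..})) ^^ i) (D 0)"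
  have G: "G u = D i u" if "u \<in> {0..<d}" for u using Suc that by (simp add: G_def)
  have at: "at t within {0..} = at t within {0..d}"
    by (rule at_within_nhd[of _ "{..<d}"]) (use Suc.prems in auto)
  have "(D i has_vector_derivative D (Suc i) t) (at t within {0..})"
    using assms(1)[of i t] Suc.prems unfolding at by (simp add: has_real_derivative_iff_has_vector_derivative)
  hence "(G has_vector_derivative D (Suc i) t) (at t within {0..})"
  proof (rule has_vector_derivative_transform_within)
    show "0 < d - t" "t \<in> {0..}" using Suc.prems by auto
    fix u assume "u \<in> {0..}" "dist u t < d - t"
    thus "D i u = G u" using G[of u] by (auto simp: dist_real_def)
  qed
  moreover have "at t within {0..} \<noteq> bot"
    using Suc.prems unfolding at by (simp add: trivial_limit_within islimpt_Icc)
  ultimately have "vector_derivative G (at t within {0..}) = D (Suc i) t"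
    by (intro vector_derivative_within)
  thus ?case by (simp add: G_def)
qed

lemma unif_Ck_taylor:
  fixes f :: "'p \<Rightarrow> real \<Rightarrow> real"
  assumes f: "unif_Ck (Suc n) P d f" and d: "d > 0"
  defines "a \<equiv> \<lambda>p i. ((\<lambda>f t. vector_derivative f (at t within {0..})) ^^ i) (f p) 0 / fact i"
  shows "\<exists>C. (\<forall>p\<in>P. \<forall>t\<in>{0..d}. \<bar>f p t - (\<Sum>i\<le>n. a p i * t ^ i)\<bar> \<le> C * t ^ Suc n) \<and>
      (\<forall>p\<in>P. \<forall>i\<le>n. \<bar>a p i\<bar> \<le> C)"
proof -
  obtain D where D: "D 0 = f" "\<And>i p t. i < Suc n \<Longrightarrow> p \<in> P \<Longrightarrow> t \<in> {0..d} \<Longrightarrow> (D i p has_real_derivative D (Suc i) p t) (at t within {0..d})"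
    "\<And>i. i \<le> Suc n \<Longrightarrow> unif_bounded P d (D i)" using unif_Ck_derivatives[OF f] by blast
  have "\<exists>C. \<forall>p\<in>P. \<forall>t\<in>{0..d}. i \<le> Suc n \<longrightarrow> \<bar>D i p t\<bar> \<le> C" for i
    using D(3)[of i] unfolding unif_bounded_def by (cases "i \<le> Suc n") auto
  then obtain C where C: "\<And>i p t. p \<in> P \<Longrightarrow> t \<in> {0..d} \<Longrightarrow> i \<le> Suc n \<Longrightarrow> \<bar>D i p t\<bar> \<le> C i" by metis
  \<comment> \<open>One constant dominates all derivatives up to order \<open>Suc n\<close>, and
    thus serves both for the remainder and for the coefficients.\<close>
  define B where "B = (\<Sum>i\<le>Suc n. \<bar>C i\<bar>)"
  have CB: "C i \<le> B" if "i \<le> Suc n" for i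
  proof -
    have "\<bar>C i\<bar> \<le> B" unfolding B_def using that by (intro member_le_sum) auto
    thus ?thesis by simp
  qed
  have B0: "B \<ge> 0" by (simp add: B_def sum_nonneg)
  have a: "a p i = D i p 0 / fact i" if "p \<in> P" "i \<le> Suc n" for p i
    unfolding a_def using iterated_right_derivative_eq[of "Suc n" d "\<lambda>i. D i p" i 0] D(1,2) that d by simp
  show ?thesis
  proof (intro exI[of _ B] conjI ballI allI impI)
    fix p t assume pt: "p \<in> P" "t \<in> {0..d}"
    have "norm (D 0 p t - (\<Sum>i\<le>n. D i p 0 * (t - 0) ^ i / fact i)) \<le> B * norm (t - 0) ^ Suc n / fact n"
    proof (rule field_Taylor[of "{0..d}" n "\<lambda>i. D i p"])
      fix x assume "x \<in> {0..d}"
      thus "norm (D (Suc n) p x) \<le> B" using C[OF pt(1), of x "Suc n"] CB[of "Suc n"] by simp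
    qed (use D(2) pt d in auto)
    also have "\<dots> \<le> B * norm (t - 0) ^ Suc n"
    proof -
      have "B * norm (t - 0) ^ Suc n / fact n \<le> B * norm (t - 0) ^ Suc n / 1"
        using B0 by (intro divide_left_mono) (auto simp: fact_ge_1)
      thus ?thesis by simp
    qed
    finally have "\<bar>f p t - (\<Sum>i\<le>n. D i p 0 * t ^ i / fact i)\<bar> \<le> B * t ^ Suc n" using D(1) pt by simp
    moreover have "(\<Sum>i\<le>n. D i p 0 * t ^ i / fact i) = (\<Sum>i\<le>n. a p i * t ^ i)"
      using a[OF pt(1)] by (intro sum.cong) auto
    ultimately show "\<bar>f p t - (\<Sum>i\<le>n. a p i * t ^ i)\<bar> \<le> B * t ^ Suc n" by simp
  next
    fix p i assume pi: "p \<in> P" "i \<le> n"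
    have "\<bar>a p i\<bar> = \<bar>D i p 0\<bar> / fact i" using a pi by simp
    also have "\<dots> \<le> \<bar>D i p 0\<bar> / 1" by (intro divide_left_mono) (auto simp: fact_ge_1)
    also have "\<dots> \<le> B" using C[of p 0 i] CB[of i] pi d by auto
    finally show "\<bar>a p i\<bar> \<le> B" .
  qed
qed

section \<open>Distances along rays in a chart\<close>

lemma Ck_on_imp_continuous_on: "Ck_on k S F \<Longrightarrow> continuous_on S F"
  by (cases k) (auto intro!: continuous_at_imp_continuous_on differentiable_imp_continuous_within)

lemma frechet_derivative_expand:
  fixes F :: "'a::euclidean_space \<Rightarrow> 'b::real_normed_vector"
  assumes "F differentiable (at x)"
  shows "frechet_derivative F (at x) u = (\<Sum>b\<in>Basis. (u \<bullet> b) *\<^sub>R frechet_derivative F (at x) b)"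
proof -
  have lin: "linear (frechet_derivative F (at x))" by (rule linear_frechet_derivative[OF assms])
  have "frechet_derivative F (at x) u = frechet_derivative F (at x) (\<Sum>b\<in>Basis. (u \<bullet> b) *\<^sub>R b)"
    by (simp add: euclidean_representation)
  also have "\<dots> = (\<Sum>b\<in>Basis. (u \<bullet> b) *\<^sub>R frechet_derivative F (at x) b)"
    by (simp add: linear_sum[OF lin] linear_scale[OF lin])
  finally show ?thesis .
qed

text \<open>The derivative along the line is a combination of partial derivatives of
  \<open>F\<close> along the same line, with coefficients the coordinates of \<open>u\<close>;
  induction on the order applies to these. Uniformity comes from the compact set \<open>K\<close>
  containing all the segments.\<close>

lemma unif_Ck_line:
  fixes F :: "'a::euclidean_space \<Rightarrow> 'b::euclidean_space"
  assumes "Ck_on k V F" and K: "compact K" "K \<subseteq> V"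
    and in_K: "\<And>v u t. (v, u) \<in> \<Theta> \<Longrightarrow> t \<in> {0..d} \<Longrightarrow> v + t *\<^sub>R u \<in> K"
    and R: "\<And>v u. (v, u) \<in> \<Theta> \<Longrightarrow> norm u \<le> R"
  shows "unif_Ck k \<Theta> d (\<lambda>\<theta> t. F (fst \<theta> + t *\<^sub>R snd \<theta>) \<bullet> e)"
  using assms(1)
proof (induction k arbitrary: F)
  have bdd: "unif_bounded \<Theta> d (\<lambda>\<theta> t. F (fst \<theta> + t *\<^sub>R snd \<theta>) \<bullet> e)" if "continuous_on V F" for F :: "'a \<Rightarrow> 'b"
  proof -
    have "bounded (F ` K)"
      using that K by (intro compact_imp_bounded compact_continuous_image) (auto intro: continuous_on_subset)
    then obtain C where C: "\<And>x. x \<in> K \<Longrightarrow> norm (F x) \<le> C" unfolding bounded_iff by auto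
    show ?thesis unfolding unif_bounded_def
    proof (intro exI[of _ "C * norm e"] ballI)
      fix \<theta> t assume \<theta>: "\<theta> \<in> \<Theta>" "t \<in> {0..d}"
      hence "norm (F (fst \<theta> + t *\<^sub>R snd \<theta>)) \<le> C" using C in_K[of "fst \<theta>" "snd \<theta>" t] by simp
      thus "\<bar>F (fst \<theta> + t *\<^sub>R snd \<theta>) \<bullet> e\<bar> \<le> C * norm e"
        by (intro order_trans[OF Cauchy_Schwarz_ineq2] mult_right_mono) auto
    qed
  qed
  {
    case 0
    hence cont: "continuous_on V F" by simp
    have "continuous_on {0..d} (\<lambda>t. F (fst \<theta> + t *\<^sub>R snd \<theta>) \<bullet> e)" if "\<theta> \<in> \<Theta>" for \<theta>
      by (intro continuous_intros continuous_on_compose2[OF cont])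
         (use in_K[of "fst \<theta>" "snd \<theta>"] that K in auto)
    thus ?case using bdd[OF cont] by simp
  next
    case (Suc k)
    have "unif_Ck k \<Theta> d (\<lambda>\<theta> t. \<Sum>b\<in>Basis. (snd \<theta> \<bullet> b) * (frechet_derivative F (at (fst \<theta> + t *\<^sub>R snd \<theta>)) b \<bullet> e))"
    proof (intro unif_Ck_sum unif_Ck_mult)
      fix b :: 'a assume b: "b \<in> Basis"
      show "unif_Ck k \<Theta> d (\<lambda>\<theta> t. snd \<theta> \<bullet> b)"
      proof (rule unif_Ck_const)
        fix \<theta> assume "\<theta> \<in> \<Theta>"
        thus "\<bar>snd \<theta> \<bullet> b\<bar> \<le> R" using Basis_le_norm[OF b, of "snd \<theta>"] R[of "fst \<theta>" "snd \<theta>"] by simp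
      qed
      show "unif_Ck k \<Theta> d (\<lambda>\<theta> t. frechet_derivative F (at (fst \<theta> + t *\<^sub>R snd \<theta>)) b \<bullet> e)"
        by (rule Suc.IH) (use Suc.prems in auto)
    qed
    thus ?case
    proof (rule unif_Ck_SucI[rotated])
      show "unif_bounded \<Theta> d (\<lambda>\<theta> t. F (fst \<theta> + t *\<^sub>R snd \<theta>) \<bullet> e)"
        by (rule bdd[OF Ck_on_imp_continuous_on[OF Suc.prems]])
      fix \<theta> t assume \<theta>: "\<theta> \<in> \<Theta>" "t \<in> {0..d}"
      define x where "x = fst \<theta> + t *\<^sub>R snd \<theta>"
      have diff: "F differentiable (at x)"
        using Suc.prems in_K[of "fst \<theta>" "snd \<theta>" t] \<theta> K unfolding x_def by auto
      have "((\<lambda>t. fst \<theta> + t *\<^sub>R snd \<theta>) has_derivative (\<lambda>h. h *\<^sub>R snd \<theta>)) (at t)"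
        by (auto intro!: derivative_eq_intros)
      from diff_chain_at[OF this, of F "frechet_derivative F (at x)"] diff
      have "((\<lambda>t. F (fst \<theta> + t *\<^sub>R snd \<theta>)) has_derivative (\<lambda>h. frechet_derivative F (at x) (h *\<^sub>R snd \<theta>))) (at t)"
        by (simp add: frechet_derivative_works o_def x_def)
      hence "((\<lambda>t. F (fst \<theta> + t *\<^sub>R snd \<theta>) \<bullet> e) has_derivative (\<lambda>h. frechet_derivative F (at x) (h *\<^sub>R snd \<theta>) \<bullet> e)) (at t)"
        by (rule has_derivative_inner_left)
      moreover have "(\<lambda>h. frechet_derivative F (at x) (h *\<^sub>R snd \<theta>) \<bullet> e) =
          (\<lambda>h. (\<Sum>b\<in>Basis. (snd \<theta> \<bullet> b) * (frechet_derivative F (at x) b \<bullet> e)) * h)"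
        by (rule ext) (simp add: linear_scale[OF linear_frechet_derivative[OF diff]]
             frechet_derivative_expand[OF diff, of "snd \<theta>"] inner_sum_left mult.commute)
      ultimately have "((\<lambda>t. F (fst \<theta> + t *\<^sub>R snd \<theta>) \<bullet> e) has_real_derivative
          (\<Sum>b\<in>Basis. (snd \<theta> \<bullet> b) * (frechet_derivative F (at x) b \<bullet> e))) (at t)"
        by (simp add: has_field_derivative_def)
      thus "((\<lambda>t. F (fst \<theta> + t *\<^sub>R snd \<theta>) \<bullet> e) has_real_derivative
          (\<Sum>b\<in>Basis. (snd \<theta> \<bullet> b) * (frechet_derivative F (at (fst \<theta> + t *\<^sub>R snd \<theta>)) b \<bullet> e))) (at t within {0..d})"
        unfolding x_def by (rule has_field_derivative_at_within)
    qed
  }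
qed

lemma smooth_on_lipschitz:
  fixes F :: "'a::euclidean_space \<Rightarrow> 'b::euclidean_space"
  assumes F: "smooth_on U F" and K: "cball p R \<subseteq> U"
  obtains L where "L \<ge> 1" "\<And>x y. x \<in> cball p R \<Longrightarrow> y \<in> cball p R \<Longrightarrow> norm (F x - F y) \<le> L * norm (x - y)"
proof -
  have "\<exists>C. \<forall>x\<in>cball p R. norm (frechet_derivative F (at x) b) \<le> C" for b
  proof -
    have "bounded ((\<lambda>x. frechet_derivative F (at x) b) ` cball p R)"
      using smooth_on_imp_continuous_on[OF smooth_on_frechet_derivative[OF F]] K
      by (intro compact_imp_bounded compact_continuous_image) (auto intro: continuous_on_subset)
    thus ?thesis unfolding bounded_iff by auto
  qed
  then obtain C where C: "\<And>b x. x \<in> cball p R \<Longrightarrow> norm (frechet_derivative F (at x) b) \<le> C b" by metis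
  define L where "L = max 1 (\<Sum>b\<in>Basis. C b)"
  show ?thesis
  proof (rule that[of L])
    show "L \<ge> 1" by (simp add: L_def)
    fix x y assume "x \<in> cball p R" "y \<in> cball p R"
    thus "norm (F x - F y) \<le> L * norm (x - y)"
    proof (rule differentiable_bound[OF convex_cball, rotated 2])
      fix z assume z: "z \<in> cball p R"
      hence diff: "F differentiable (at z)" using smooth_on_imp_differentiable[OF F] K by auto
      show "(F has_derivative frechet_derivative F (at z)) (at z within cball p R)"
        using diff by (simp add: frechet_derivative_works has_derivative_at_withinI)
      show "onorm (frechet_derivative F (at z)) \<le> L"
      proof (rule onorm_le)
        fix u :: 'a
        have "norm (frechet_derivative F (at z) u) \<le> (\<Sum>b\<in>Basis. norm ((u \<bullet> b) *\<^sub>R frechet_derivative F (at z) b))"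
          unfolding frechet_derivative_expand[OF diff, of u] by (rule norm_sum)
        also have "\<dots> \<le> (\<Sum>b\<in>Basis. norm u * C b)"
          using C[OF z] by (intro sum_mono) (auto simp: Basis_le_norm intro!: mult_mono)
        also have "\<dots> = (\<Sum>b\<in>Basis. C b) * norm u" by (simp add: sum_distrib_left mult.commute)
        also have "\<dots> \<le> L * norm u" by (intro mult_right_mono) (auto simp: L_def)
        finally show "norm (frechet_derivative F (at z) u) \<le> L * norm u" .
      qed
    qed
  qed
qed

text \<open>The set of directions in \<open>nn_integral_lborel_span_radial\<close>; its lower bound
  1 on the length keeps the distance along a ray from growing too slowly.\<close>

definition annulus :: "'a::euclidean_space set" where
  "annulus = {u. 1 \<le> norm u \<and> norm u \<le> exp 1}"

text \<open>The time limit \<open>r / exp 1\<close> compensates for directions of length up to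
  \<open>exp 1\<close>.\<close>

lemma annulus_line_in_cball:
  assumes "v \<in> cball q r" "u \<in> annulus" "0 \<le> t" "t \<le> r / exp 1"
  shows "v + t *\<^sub>R u \<in> cball q (2 * r)"
proof -
  have "norm (t *\<^sub>R u) \<le> (r / exp 1) * exp 1"
    unfolding norm_scaleR using assms by (intro mult_mono) (auto simp: annulus_def)
  hence "norm (t *\<^sub>R u) \<le> r" by simp
  moreover have "dist q (v + t *\<^sub>R u) \<le> dist q v + norm (t *\<^sub>R u)"
    by (metis dist_norm dist_triangle add_diff_cancel_left' norm_minus_commute)
  ultimately show ?thesis using assms by auto
qed

text \<open>By Hadamard each coordinate of the displacement is \<open>t\<close> times a controlled
  function; with \<open>Q\<close> the sum of the squares of these functions, the distance is
  \<open>t * sqrt (Q \<theta> t)\<close>. The root is harmless because \<open>Q\<close> is at least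
  \<open>1 / L\<^sup>2\<close>: the inverse chart is \<open>L\<close>-Lipschitz in the sense of
  \<open>lower\<close>, and directions have length at least 1.\<close>

lemma unif_Ck_norm_line:
  fixes \<psi> :: "'a::euclidean_space \<Rightarrow> 'a"
  assumes \<psi>: "smooth_on V \<psi>" and r: "r > 0" and K: "cball q (2 * r) \<subseteq> V" and L: "L > 0"
    and lower: "\<And>v w. v \<in> cball q (2 * r) \<Longrightarrow> w \<in> cball q (2 * r) \<Longrightarrow> norm (v - w) \<le> L * norm (\<psi> v - \<psi> w)"
  defines "\<Theta> \<equiv> cball q r \<times> annulus"
  obtains w where "unif_Ck k \<Theta> (r / exp 1) w"
    "\<And>\<theta> t. \<theta> \<in> \<Theta> \<Longrightarrow> t \<in> {0..r / exp 1} \<Longrightarrow> norm (\<psi> (fst \<theta> + t *\<^sub>R snd \<theta>) - \<psi> (fst \<theta>)) = t * w \<theta> t"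
    "\<And>\<theta> t. \<theta> \<in> \<Theta> \<Longrightarrow> t \<in> {0..r / exp 1} \<Longrightarrow> 1 / L \<le> w \<theta> t"
proof -
  define d where "d = r / exp 1"
  have d: "d > 0" using r by (simp add: d_def)
  have line: "fst \<theta> + t *\<^sub>R snd \<theta> \<in> cball q (2 * r)" if "\<theta> \<in> \<Theta>" "t \<in> {0..d}" for \<theta> t
    using annulus_line_in_cball[of "fst \<theta>" q r "snd \<theta>" t] that unfolding \<Theta>_def d_def by auto
  have "\<exists>g. unif_Ck k \<Theta> d g \<and> (\<forall>\<theta>\<in>\<Theta>. \<forall>t\<in>{0..d}. (\<psi> (fst \<theta> + t *\<^sub>R snd \<theta>) - \<psi> (fst \<theta>)) \<bullet> e = t * g \<theta> t)" for e
  proof -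
    have l: "unif_Ck (Suc k) \<Theta> d (\<lambda>\<theta> t. \<psi> (fst \<theta> + t *\<^sub>R snd \<theta>) \<bullet> e)"
    proof (rule unif_Ck_line[OF _ compact_cball K])
      show "Ck_on (Suc k) V \<psi>" using \<psi> unfolding smooth_on_def by blast
      show "v + t *\<^sub>R u \<in> cball q (2 * r)" if "(v, u) \<in> \<Theta>" "t \<in> {0..d}" for v u t
        using line[OF that] by simp
      show "norm u \<le> exp 1" if "(v, u) \<in> \<Theta>" for v u using that by (auto simp: \<Theta>_def annulus_def)
    qed
    obtain C where C: "\<And>\<theta> t. \<theta> \<in> \<Theta> \<Longrightarrow> t \<in> {0..d} \<Longrightarrow> \<bar>\<psi> (fst \<theta> + t *\<^sub>R snd \<theta>) \<bullet> e\<bar> \<le> C"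
      using unif_boundedE[OF unif_Ck_bounded[OF l]] by metis
    have "unif_Ck (Suc k) \<Theta> d (\<lambda>\<theta> t. \<psi> (fst \<theta> + t *\<^sub>R snd \<theta>) \<bullet> e - \<psi> (fst \<theta>) \<bullet> e)"
      by (intro unif_Ck_diff l unif_Ck_const[of _ _ C]) (use C[of _ 0] d in auto)
    from unif_Ck_hadamard[OF this d]
    obtain g where "unif_Ck k \<Theta> d g"
       "\<And>\<theta> t. \<theta> \<in> \<Theta> \<Longrightarrow> t \<in> {0..d} \<Longrightarrow> \<psi> (fst \<theta> + t *\<^sub>R snd \<theta>) \<bullet> e - \<psi> (fst \<theta>) \<bullet> e = t * g \<theta> t"
      by (metis (no_types, lifting) add.right_neutral diff_self scaleR_zero_left)
    thus ?thesis by (auto simp: inner_diff_left)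
  qed
  then obtain g where g: "\<And>e. unif_Ck k \<Theta> d (g e)"
    "\<And>e \<theta> t. \<theta> \<in> \<Theta> \<Longrightarrow> t \<in> {0..d} \<Longrightarrow> (\<psi> (fst \<theta> + t *\<^sub>R snd \<theta>) - \<psi> (fst \<theta>)) \<bullet> e = t * g e \<theta> t"
    by metis
  define Q where "Q \<theta> t = (\<Sum>e\<in>Basis. (g e \<theta> t)\<^sup>2)" for \<theta> t
  have Q: "unif_Ck k \<Theta> d Q" unfolding Q_def[abs_def] by (intro unif_Ck_sum unif_Ck_power g)
  have Qeq: "(norm (\<psi> (fst \<theta> + t *\<^sub>R snd \<theta>) - \<psi> (fst \<theta>)))\<^sup>2 = t\<^sup>2 * Q \<theta> t" if "\<theta> \<in> \<Theta>" "t \<in> {0..d}" for \<theta> t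
    unfolding Q_def power2_norm_eq_inner
    by (subst euclidean_inner) (simp add: g(2)[OF that] sum_distrib_left power2_eq_square mult_ac)
  have Qpos: "1 / L\<^sup>2 \<le> Q \<theta> t" if \<theta>: "\<theta> \<in> \<Theta>" and t: "t \<in> {0<..d}" for \<theta> t
  proof -
    have "fst \<theta> \<in> cball q (2 * r)" using line[OF \<theta>, of 0] d by simp
    hence "norm (t *\<^sub>R snd \<theta>) \<le> L * norm (\<psi> (fst \<theta> + t *\<^sub>R snd \<theta>) - \<psi> (fst \<theta>))"
      using lower[of "fst \<theta> + t *\<^sub>R snd \<theta>" "fst \<theta>"] line[OF \<theta>, of t] t by simp
    moreover have "t * 1 \<le> norm (t *\<^sub>R snd \<theta>)"
      unfolding norm_scaleR using \<theta> t by (intro mult_mono) (auto simp: \<Theta>_def annulus_def)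
    ultimately have "t \<le> L * norm (\<psi> (fst \<theta> + t *\<^sub>R snd \<theta>) - \<psi> (fst \<theta>))" by simp
    hence "t\<^sup>2 \<le> (L * norm (\<psi> (fst \<theta> + t *\<^sub>R snd \<theta>) - \<psi> (fst \<theta>)))\<^sup>2" using t by (intro power_mono) auto
    also have "\<dots> = t\<^sup>2 * (L\<^sup>2 * Q \<theta> t)" using Qeq[OF \<theta>, of t] t by (simp add: power_mult_distrib mult_ac)
    finally have "1 \<le> L\<^sup>2 * Q \<theta> t" using t by simp
    thus ?thesis using L by (simp add: divide_le_eq mult.commute)
  qed
  \<comment> \<open>At \<open>t = 0\<close> the estimate cannot be obtained by dividing by
    \<open>t\<^sup>2\<close>; it follows from continuity of \<open>Q\<close>.\<close>
  have Qpos': "1 / L\<^sup>2 \<le> Q \<theta> t" if \<theta>: "\<theta> \<in> \<Theta>" and t: "t \<in> {0..d}" for \<theta> t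
  proof (cases "t = 0")
    case False
    thus ?thesis using Qpos[OF \<theta>, of t] t by auto
  next
    case True
    show ?thesis
    proof (rule tendsto_lowerbound)
      have "continuous (at t within {0..d}) (Q \<theta>)"
        using unif_Ck_continuous[OF Q \<theta>] t by (simp add: continuous_on_eq_continuous_within)
      thus "(Q \<theta> \<longlongrightarrow> Q \<theta> t) (at t within {0..d})" by (simp add: continuous_within)
      show "\<forall>\<^sub>F s in at t within {0..d}. 1 / L\<^sup>2 \<le> Q \<theta> s"
        unfolding eventually_at_filter using Qpos[OF \<theta>] True by (intro always_eventually) auto
      show "at t within {0..d} \<noteq> bot"
        using t d by (simp add: trivial_limit_within islimpt_Icc)
    qed
  qed
  have c: "1 / L\<^sup>2 > 0" using L by simp
  show ?thesis
  proof (rule that[of "\<lambda>\<theta> t. sqrt (Q \<theta> t)", folded d_def])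
    show "unif_Ck k \<Theta> d (\<lambda>\<theta> t. sqrt (Q \<theta> t))" by (rule unif_Ck_sqrt[OF Q c Qpos'])
    fix \<theta> t assume \<theta>: "\<theta> \<in> \<Theta>" "t \<in> {0..d}"
    have "norm (\<psi> (fst \<theta> + t *\<^sub>R snd \<theta>) - \<psi> (fst \<theta>)) = sqrt (t\<^sup>2 * Q \<theta> t)"
      using Qeq[OF \<theta>] by (metis norm_ge_zero real_sqrt_unique)
    thus "norm (\<psi> (fst \<theta> + t *\<^sub>R snd \<theta>) - \<psi> (fst \<theta>)) = t * sqrt (Q \<theta> t)"
      using \<theta> by (simp add: real_sqrt_mult)
    have "sqrt (1 / L\<^sup>2) \<le> sqrt (Q \<theta> t)" using Qpos'[OF \<theta>] by simp
    thus "1 / L \<le> sqrt (Q \<theta> t)" using L by (simp add: real_sqrt_divide)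
  qed
qed

text \<open>The distance \<open>t * w \<theta> t\<close> has a slope at least half of the lower
  bound \<open>1 / L\<close> of \<open>w\<close>, provided that \<open>t\<close> is small compared
  with the oscillation of \<open>w\<close>. This feeds the inverse function lemma and gives both the
  interval up to \<open>d / (2 * L)\<close> and the estimate \<open>2 * L * t\<close>.\<close>

lemma chart_exit_time:
  fixes \<psi> :: "'a::euclidean_space \<Rightarrow> 'a"
  assumes \<psi>: "smooth_on V \<psi>" and r: "r > 0" and K: "cball q (2 * r) \<subseteq> V" and L: "L > 0"
    and lower: "\<And>v w. v \<in> cball q (2 * r) \<Longrightarrow> w \<in> cball q (2 * r) \<Longrightarrow> norm (v - w) \<le> L * norm (\<psi> v - \<psi> w)"
  defines "\<Theta> \<equiv> cball q r \<times> annulus"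
  obtains d \<rho> where "0 < d" "d \<le> r / exp 1" "unif_Ck (Suc k) \<Theta> (d / (2 * L)) \<rho>"
    "\<And>\<theta> t. \<theta> \<in> \<Theta> \<Longrightarrow> t \<in> {0..d / (2 * L)} \<Longrightarrow> \<rho> \<theta> t \<in> {0..d} \<and> \<rho> \<theta> t \<le> 2 * L * t"
    "\<And>\<theta> s t. \<theta> \<in> \<Theta> \<Longrightarrow> t \<in> {0..d / (2 * L)} \<Longrightarrow> s \<in> {0..d} \<Longrightarrow>
        norm (\<psi> (fst \<theta> + s *\<^sub>R snd \<theta>) - \<psi> (fst \<theta>)) \<le> t \<longleftrightarrow> s \<le> \<rho> \<theta> t"
proof -
  define d0 where "d0 = r / exp 1"
  have d0: "d0 > 0" using r by (simp add: d0_def)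
  from unif_Ck_norm_line[OF \<psi> r K L lower, of "Suc k"]
  obtain w where w: "unif_Ck (Suc k) \<Theta> d0 w"
    "\<And>\<theta> t. \<theta> \<in> \<Theta> \<Longrightarrow> t \<in> {0..d0} \<Longrightarrow> norm (\<psi> (fst \<theta> + t *\<^sub>R snd \<theta>) - \<psi> (fst \<theta>)) = t * w \<theta> t"
    "\<And>\<theta> t. \<theta> \<in> \<Theta> \<Longrightarrow> t \<in> {0..d0} \<Longrightarrow> 1 / L \<le> w \<theta> t"
    unfolding d0_def \<Theta>_def by (metis (no_types, lifting))
  obtain w' where w': "\<And>\<theta> t. \<theta> \<in> \<Theta> \<Longrightarrow> t \<in> {0..d0} \<Longrightarrow> (w \<theta> has_real_derivative w' \<theta> t) (at t within {0..d0})"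
    "unif_Ck k \<Theta> d0 w'" "unif_bounded \<Theta> d0 w" by (rule unif_Ck_SucE[OF w(1)]) blast
  obtain C where C: "C > 0" "\<And>\<theta> t. \<theta> \<in> \<Theta> \<Longrightarrow> t \<in> {0..d0} \<Longrightarrow> \<bar>w' \<theta> t\<bar> \<le> C" 
    using unif_boundedE[OF unif_Ck_bounded[OF w'(2)]] by metis
  have lip: "\<bar>w \<theta> t - w \<theta> s\<bar> \<le> C * \<bar>t - s\<bar>" if "\<theta> \<in> \<Theta>" "t \<in> {0..d0}" "s \<in> {0..d0}" for \<theta> t s
    using field_differentiable_bound[of "{0..d0}" "w \<theta>" "w' \<theta>" C t s] w'(1)[OF that(1)] C(2)[OF that(1)] that by simp
  define d where "d = min d0 (1 / (2 * L * C))"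
  have d: "d > 0" "d \<le> d0" "d * C \<le> 1 / (2 * L)"
  proof -
    show "d > 0" "d \<le> d0" using d0 C L by (auto simp: d_def)
    have "d * C \<le> 1 / (2 * L * C) * C" using C by (intro mult_right_mono) (auto simp: d_def)
    thus "d * C \<le> 1 / (2 * L)" using C by simp
  qed
  define \<sigma> where "\<sigma> \<theta> t = t * w \<theta> t" for \<theta> t
  have \<sigma>: "unif_Ck (Suc k) \<Theta> d \<sigma>"
    unfolding \<sigma>_def[abs_def] by (intro unif_Ck_mult unif_Ck_ident unif_Ck_reindex[OF w(1), of \<Theta> "\<lambda>\<theta>. \<theta>"]) (use d in auto)
  have c: "1 / (2 * L) > 0" using L by simp
  have \<sigma>0: "\<sigma> \<theta> 0 = 0" for \<theta> by (simp add: \<sigma>_def)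
  have inc: "1 / (2 * L) * (t - s) \<le> \<sigma> \<theta> t - \<sigma> \<theta> s" if "\<theta> \<in> \<Theta>" "0 \<le> s" "s \<le> t" "t \<le> d" for \<theta> s t
    proof -
      have ts: "t \<in> {0..d0}" "s \<in> {0..d0}" using that d by auto
      have "- (C * (t - s)) \<le> w \<theta> t - w \<theta> s" using lip[OF that(1) ts] that by simp
      hence "t * - (C * (t - s)) \<le> t * (w \<theta> t - w \<theta> s)" using that by (intro mult_left_mono) auto
      moreover have "t * (C * (t - s)) \<le> 1 / (2 * L) * (t - s)"
      proof -
        have "t * C \<le> d * C" using that C by (intro mult_right_mono) auto
        hence "(t * C) * (t - s) \<le> 1 / (2 * L) * (t - s)" using d that by (intro mult_right_mono) auto
        thus ?thesis by (simp add: mult.assoc)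
      qed
      moreover have "(t - s) * (1 / L) \<le> (t - s) * w \<theta> s" using w(3)[OF that(1) ts(2)] that by (intro mult_left_mono) auto
      moreover have "\<sigma> \<theta> t - \<sigma> \<theta> s = t * (w \<theta> t - w \<theta> s) + (t - s) * w \<theta> s" by (simp add: \<sigma>_def algebra_simps)
      moreover have "(t - s) * (1 / L) = 1 / (2 * L) * (t - s) + 1 / (2 * L) * (t - s)" using L by (simp add: field_simps)
      ultimately show ?thesis by simp
    qed
  obtain \<rho> where \<rho>: "unif_Ck (Suc k) \<Theta> (1 / (2 * L) * d) \<rho>"
    "\<And>p t. p \<in> \<Theta> \<Longrightarrow> t \<in> {0..1 / (2 * L) * d} \<Longrightarrow> \<rho> p t \<in> {0..d} \<and> \<sigma> p (\<rho> p t) = t \<and> \<rho> p t \<le> t / (1 / (2 * L))"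
    "\<And>p s t. p \<in> \<Theta> \<Longrightarrow> t \<in> {0..1 / (2 * L) * d} \<Longrightarrow> s \<in> {0..d} \<Longrightarrow> \<sigma> p s \<le> t \<longleftrightarrow> s \<le> \<rho> p t"
    apply (rule unif_Ck_inverse_function[OF \<sigma> d(1) \<sigma>0 c inc])
       apply assumption+
    subgoal for \<rho> by (rule that[of \<rho>])
    done
  show ?thesis
  proof (rule that[OF d(1) d(2)[unfolded d0_def]])
    show "unif_Ck (Suc k) \<Theta> (d / (2 * L)) \<rho>" using \<rho>(1) by simp
    show "\<rho> \<theta> t \<in> {0..d} \<and> \<rho> \<theta> t \<le> 2 * L * t" if "\<theta> \<in> \<Theta>" "t \<in> {0..d / (2 * L)}" for \<theta> t
      using \<rho>(2)[of \<theta> t] that by (simp add: mult.commute)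
    show "norm (\<psi> (fst \<theta> + s *\<^sub>R snd \<theta>) - \<psi> (fst \<theta>)) \<le> t \<longleftrightarrow> s \<le> \<rho> \<theta> t"
      if "\<theta> \<in> \<Theta>" "t \<in> {0..d / (2 * L)}" "s \<in> {0..d}" for \<theta> s t
      using \<rho>(3)[of \<theta> t s] w(2)[of \<theta> s] that d by (simp add: \<sigma>_def)
  qed
qed

text \<open>\<open>gram_det\<close> is a polynomial in the first derivatives of \<psi>, and on a
  compact ball inside \<open>V\<close> it is bounded away from 0, so the square root keeps uniform
  bounds. The exponent \<open>n\<close> is \<open>m - 1\<close> for the polar weight and 0 when the
  density alone has to be bounded.\<close>

lemma unif_Ck_gram_line:
  assumes c: "slice_chart m M I U V \<phi> \<psi>" and r: "r > 0" and K: "cball q (2 * r) \<subseteq> V"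
  shows "unif_Ck k (cball q r \<times> annulus) (r / exp 1) (\<lambda>\<theta> t. sqrt (gram_det I \<psi> (fst \<theta> + t *\<^sub>R snd \<theta>)) * t ^ n)"
proof -
  note D = slice_chartD[OF c]
  define d where "d = r / exp 1"
  let ?\<Theta> = "cball q r \<times> annulus :: ('a \<times> 'a) set"
  have line: "fst \<theta> + t *\<^sub>R snd \<theta> \<in> cball q (2 * r)" if "\<theta> \<in> ?\<Theta>" "t \<in> {0..d}" for \<theta> t
    using annulus_line_in_cball[of "fst \<theta>" q r "snd \<theta>" t] that unfolding d_def by auto
  have l: "unif_Ck k ?\<Theta> d (\<lambda>\<theta> t. frechet_derivative \<psi> (at (fst \<theta> + t *\<^sub>R snd \<theta>)) b \<bullet> e)" for b e
  proof (rule unif_Ck_line[OF _ compact_cball K])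
    show "Ck_on k V (\<lambda>x. frechet_derivative \<psi> (at x) b)"
      using smooth_on_frechet_derivative[OF D(6)] unfolding smooth_on_def by blast
    show "v + t *\<^sub>R u \<in> cball q (2 * r)" if "(v, u) \<in> ?\<Theta>" "t \<in> {0..d}" for v u t
      using line[OF that] by simp
    show "norm u \<le> exp 1" if "(v, u) \<in> ?\<Theta>" for v u using that by (auto simp: annulus_def)
  qed
  have "unif_Ck k ?\<Theta> d (\<lambda>\<theta> t. \<Sum>p | p permutes I. of_int (sign p) *
     (\<Prod>b\<in>I. \<Sum>e\<in>Basis. (frechet_derivative \<psi> (at (fst \<theta> + t *\<^sub>R snd \<theta>)) b \<bullet> e) *
        (frechet_derivative \<psi> (at (fst \<theta> + t *\<^sub>R snd \<theta>)) (p b) \<bullet> e)))"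
    by (intro unif_Ck_sum unif_Ck_cmult unif_Ck_prod unif_Ck_mult l)
  hence g: "unif_Ck k ?\<Theta> d (\<lambda>\<theta> t. gram_det I \<psi> (fst \<theta> + t *\<^sub>R snd \<theta>))"
    by (simp add: gram_det_def euclidean_inner[symmetric])
  have cont: "continuous_on (cball q (2 * r)) (gram_det I \<psi>)"
    by (rule continuous_on_subset[OF slice_chart_gram_continuous[OF c] K])
  have "\<exists>x\<in>cball q (2 * r). \<forall>y\<in>cball q (2 * r). gram_det I \<psi> x \<le> gram_det I \<psi> y"
    by (rule continuous_attains_inf[OF compact_cball _ cont]) (use r in auto)
  then obtain x where x: "x \<in> cball q (2 * r)" "\<And>y. y \<in> cball q (2 * r) \<Longrightarrow> gram_det I \<psi> x \<le> gram_det I \<psi> y" by blast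
  have "gram_det I \<psi> x > 0" using slice_chart_gram_pos[OF c] x K by auto
  from unif_Ck_sqrt[OF g this] have "unif_Ck k ?\<Theta> d (\<lambda>\<theta> t. sqrt (gram_det I \<psi> (fst \<theta> + t *\<^sub>R snd \<theta>)))"
    using x line by blast
  thus ?thesis unfolding d_def[symmetric] by (intro unif_Ck_mult unif_Ck_power unif_Ck_ident)
qed

section \<open>Smoothness of the ball volume\<close>

text \<open>In the chart, the part of \<open>M\<close> in a small ball around \<open>x\<close> is
  star-shaped about \<open>\<phi> x\<close> within \<open>span I\<close>: along each direction it
  consists of the times up to the exit time. The polar formula then expresses the volume as an
  integral over directions of a family with uniform bounds. The estimate by \<open>t ^ m\<close> is
  what later places the first possible pole.\<close>

lemma local_ball_volume:
  fixes M :: "'a::euclidean_space set"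
  assumes M: "closed_submanifold m M" and p: "p \<in> M" and m: "m > 0"
  shows "\<exists>\<eta>>0. \<exists>\<delta>>0. unif_Ck k (M \<inter> ball p \<eta>) \<delta> (ball_volume m M) \<and>
     (\<exists>C. \<forall>x\<in>M \<inter> ball p \<eta>. \<forall>t\<in>{0..\<delta>}. ball_volume m M x t \<le> C * t ^ m)"
proof -
  obtain I U V \<phi> \<psi> where pU: "p \<in> U" and c: "slice_chart m M I U V \<phi> \<psi>"
    using M p unfolding closed_submanifold_def by blast
  note D = slice_chartD[OF c]
  have fin: "finite I" and I0: "I \<noteq> {}" using finite_Basis_subset[OF D(1)] D(2) m by auto
  obtain R where R: "R > 0" "cball p R \<subseteq> U" using D(3) pU open_contains_cball by blast
  obtain L where L1: "L \<ge> 1" and L: "\<And>x y. x \<in> cball p R \<Longrightarrow> y \<in> cball p R \<Longrightarrow> norm (\<phi> x - \<phi> y) \<le> L * norm (x - y)"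
    using smooth_on_lipschitz[OF D(5) R(2)] by metis
  have L0: "L > 0" using L1 by simp
  define q where "q = \<phi> p"
  have "open (V \<inter> \<psi> -` ball p R)" by (rule continuous_open_preimage[OF D(12) D(4) open_ball])
  moreover have "q \<in> V \<inter> \<psi> -` ball p R" using D(7)[OF pU] D(9)[OF pU] R by (simp add: q_def)
  ultimately obtain r0 where r0: "r0 > 0" "cball q r0 \<subseteq> V \<inter> \<psi> -` ball p R" using open_contains_cball by blast
  \<comment> \<open>Rays start in \<open>cball q r\<close> and run inside
    \<open>cball q (2 * r)\<close>, so half of the available radius is reserved for them.\<close>
  define r where "r = r0 / 2"
  have r: "r > 0" "cball q (2 * r) \<subseteq> V \<inter> \<psi> -` ball p R" using r0 by (auto simp: r_def)
  have K: "cball q (2 * r) \<subseteq> V" using r by auto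
  have lower: "norm (v - w) \<le> L * norm (\<psi> v - \<psi> w)" if "v \<in> cball q (2 * r)" "w \<in> cball q (2 * r)" for v w
  proof -
    have "v \<in> V" "w \<in> V" "\<psi> v \<in> cball p R" "\<psi> w \<in> cball p R" using r(2) that by auto
    thus ?thesis using L[of "\<psi> v" "\<psi> w"] D(10) by simp
  qed
  define \<Theta> where "\<Theta> = cball q r \<times> (annulus :: 'a set)"
  obtain d \<rho> where d: "0 < d" "d \<le> r / exp 1" and \<rho>: "unif_Ck (Suc k) \<Theta> (d / (2 * L)) \<rho>"
    "\<And>\<theta> t. \<theta> \<in> \<Theta> \<Longrightarrow> t \<in> {0..d / (2 * L)} \<Longrightarrow> \<rho> \<theta> t \<in> {0..d} \<and> \<rho> \<theta> t \<le> 2 * L * t"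
    "\<And>\<theta> s t. \<theta> \<in> \<Theta> \<Longrightarrow> t \<in> {0..d / (2 * L)} \<Longrightarrow> s \<in> {0..d} \<Longrightarrow>
        norm (\<psi> (fst \<theta> + s *\<^sub>R snd \<theta>) - \<psi> (fst \<theta>)) \<le> t \<longleftrightarrow> s \<le> \<rho> \<theta> t"
  proof (rule chart_exit_time[OF D(6) r(1) K L0, where k = k])
    fix v w assume "v \<in> cball q (2 * r)" "w \<in> cball q (2 * r)"
    thus "norm (v - w) \<le> L * norm (\<psi> v - \<psi> w)" by (rule lower)
  next
    fix d \<rho>
    assume "0 < d" "d \<le> r / exp 1" "unif_Ck (Suc k) (cball q r \<times> annulus) (d / (2 * L)) \<rho>"
      "\<And>\<theta> t. \<theta> \<in> cball q r \<times> annulus \<Longrightarrow> t \<in> {0..d / (2 * L)} \<Longrightarrow> \<rho> \<theta> t \<in> {0..d} \<and> \<rho> \<theta> t \<le> 2 * L * t"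
      "\<And>\<theta> s t. \<theta> \<in> cball q r \<times> annulus \<Longrightarrow> t \<in> {0..d / (2 * L)} \<Longrightarrow> s \<in> {0..d} \<Longrightarrow>
        norm (\<psi> (fst \<theta> + s *\<^sub>R snd \<theta>) - \<psi> (fst \<theta>)) \<le> t \<longleftrightarrow> s \<le> \<rho> \<theta> t"
    thus thesis unfolding \<Theta>_def[symmetric] by (rule that)
  qed
  \<comment> \<open>The bound \<open>R / 2\<close> on both \<eta> and \<delta> keeps the balls
    inside \<open>cball p R\<close>, hence inside the chart domain. The bound \<open>r / L\<close>
    places \<open>\<phi> x\<close> in \<open>cball q r\<close>, and \<open>d / (2 * L)\<close> is
    the range of the exit time.\<close>
  define \<eta> where "\<eta> = min (R / 2) (r / L)"
  define \<delta> where "\<delta> = min (R / 2) (d / (2 * L))"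
  have \<eta>: "\<eta> > 0" "\<eta> \<le> R / 2" "L * \<eta> \<le> r"
  proof -
    show "\<eta> > 0" using R r L0 by (simp add: \<eta>_def)
    show "\<eta> \<le> R / 2" unfolding \<eta>_def by (rule min.cobounded1)
    have "L * \<eta> \<le> L * (r / L)" using L0 by (intro mult_left_mono) (auto simp: \<eta>_def)
    thus "L * \<eta> \<le> r" using L0 by simp
  qed
  have \<delta>: "\<delta> > 0" "\<delta> \<le> R / 2" "\<delta> \<le> d / (2 * L)"
    using R d L0 unfolding \<delta>_def by (simp_all only: min.cobounded1 min.cobounded2, simp)
  have L\<delta>: "L * \<delta> \<le> d"
  proof -
    have "L * \<delta> \<le> L * (d / (2 * L))" using L0 \<delta> by (intro mult_left_mono) auto
    thus ?thesis using L0 d by simp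
  qed
  define X where "X = M \<inter> ball p \<eta>"
  define A where "A = span I \<inter> (annulus :: 'a set)"
  define \<nu> where "\<nu> = restrict_space (lborel_span I) A"
  have Ab [measurable]: "A \<in> sets borel"
  proof -
    have "closed (annulus :: 'a set)" unfolding annulus_def
      by (intro closed_Collect_conj closed_Collect_le continuous_intros)
    thus ?thesis unfolding A_def using closed_span by (intro borel_closed closed_Int)
  qed
  have sp\<nu>: "space \<nu> = A" by (simp add: \<nu>_def space_restrict_space)
  have "bounded A" unfolding A_def annulus_def bounded_iff by auto
  hence fin\<nu>: "finite_measure \<nu>"
    using emeasure_lborel_span_bounded[OF D(1), of A]
    by (intro finite_measureI) (simp add: sp\<nu>, simp add: \<nu>_def emeasure_restrict_space)
  have xX: "x \<in> cball p R" "x \<in> M" "x \<in> U" "\<phi> x \<in> cball q r" "\<phi> x \<in> V" "\<phi> x \<in> span I" if "x \<in> X" for x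
  proof -
    have xp: "dist p x < \<eta>" and xM: "x \<in> M" using that by (auto simp: X_def)
    show 1: "x \<in> cball p R" using xp \<eta> R by simp
    show "x \<in> M" by fact
    show xU: "x \<in> U" using 1 R by auto
    have "norm (\<phi> p - \<phi> x) \<le> L * norm (p - x)" using L[of p x] 1 R by simp
    also have "\<dots> \<le> L * \<eta>" using xp L0 by (intro mult_left_mono) (auto simp: dist_norm)
    finally show "\<phi> x \<in> cball q r" using \<eta> by (simp add: q_def dist_norm)
    show "\<phi> x \<in> V" by (rule D(7)[OF xU])
    show "\<phi> x \<in> span I" using D(13) xM xU by blast
  qed
  \<comment> \<open>\<open>G\<close> is the density along a ray with the polar weight,
    \<open>H\<close> its antiderivative, and \<open>P\<close> below is \<open>H\<close> stopped at
    the exit time.\<close>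
  define G where "G \<theta> s = sqrt (gram_det I \<psi> (fst \<theta> + s *\<^sub>R snd \<theta>)) * s ^ (m - 1)" for \<theta> s
  have G: "unif_Ck k \<Theta> (r / exp 1) G" unfolding G_def[abs_def] \<Theta>_def by (rule unif_Ck_gram_line[OF c r(1) K])
  define H where "H \<theta> s = integral {0..s} (G \<theta>)" for \<theta> s
  have H: "unif_Ck k \<Theta> d H"
    using unif_Ck_reindex[OF unif_Ck_le[OF unif_Ck_antiderivative[OF G], of k], of \<Theta> "\<lambda>\<theta>. \<theta>" d] d
    by (simp add: H_def[abs_def])
  define P where "P \<theta> t = H \<theta> (\<rho> \<theta> t)" for \<theta> t
  have P: "unif_Ck k \<Theta> \<delta> P"
    unfolding P_def[abs_def]
  proof (rule unif_Ck_compose[OF H])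
    show "unif_Ck k \<Theta> \<delta> \<rho>"
      using unif_Ck_reindex[OF unif_Ck_le[OF \<rho>(1), of k], of \<Theta> "\<lambda>\<theta>. \<theta>" \<delta>] \<delta> by simp
    show "\<rho> \<theta> t \<in> {0..d}" if "\<theta> \<in> \<Theta>" "t \<in> {0..\<delta>}" for \<theta> t using \<rho>(2)[of \<theta> t] that \<delta> by auto
  qed
  have Gnn: "0 \<le> G \<theta> s" if "\<theta> \<in> \<Theta>" "0 \<le> s" "s \<le> d" for \<theta> s
  proof -
    have "fst \<theta> + s *\<^sub>R snd \<theta> \<in> V"
      using annulus_line_in_cball[of "fst \<theta>" q r "snd \<theta>" s] that K d by (auto simp: \<Theta>_def)
    thus ?thesis using slice_chart_gram_pos[OF c] that by (simp add: G_def less_imp_le)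
  qed
  have Gint: "(G \<theta> has_integral P \<theta> t) {0..\<rho> \<theta> t}" if "\<theta> \<in> \<Theta>" "t \<in> {0..\<delta>}" for \<theta> t
    unfolding P_def H_def
    by (intro integrable_integral integrable_continuous_real continuous_on_subset[OF unif_Ck_continuous[OF G that(1)]])
       (use \<rho>(2)[of \<theta> t] that \<delta> d in auto)
  have Pnn: "0 \<le> P \<theta> t" if "\<theta> \<in> \<Theta>" "t \<in> {0..\<delta>}" for \<theta> t
    by (rule has_integral_nonneg[OF Gint[OF that]]) (use Gnn[OF that(1)] \<rho>(2)[of \<theta> t] that \<delta> in auto)
  have key: "ball_volume m M x t = (\<integral>u. P (\<phi> x, u) t \<partial>\<nu>) \<and> (\<lambda>u. P (\<phi> x, u) t) \<in> borel_measurable \<nu>"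
    if x: "x \<in> X" and t: "t \<in> {0..\<delta>}" for x t
  proof -
    define v0 where "v0 = \<phi> x"
    have v0: "v0 \<in> cball q r" "v0 \<in> span I" "\<psi> v0 = x" using xX[OF x] D(9) by (auto simp: v0_def)
    define S where "S = M \<inter> cball x t"
    have Sp: "S \<subseteq> cball p R"
    proof
      fix y assume "y \<in> S"
      hence "dist x y \<le> \<delta>" using t by (auto simp: S_def)
      moreover have "dist p x < \<eta>" using x by (auto simp: X_def)
      ultimately show "y \<in> cball p R" using dist_triangle[of p y x] \<eta> \<delta> by simp
    qed
    have SU: "S \<subseteq> U" "S \<subseteq> M" "S \<in> sets borel"
      using Sp R closed_submanifold_borel[OF M] by (auto simp: S_def)
    define B where "B = \<phi> ` S"
    have B: "B \<in> sets borel" "B \<subseteq> V" 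
      using slice_chart_image_borel[OF c SU(1,3)] SU D(7) by (auto simp: B_def)
    have Biff: "v \<in> B \<longleftrightarrow> v \<in> V \<and> \<psi> v \<in> M \<and> dist x (\<psi> v) \<le> t" for v
      unfolding B_def slice_chart_image[OF c SU(1)] by (auto simp: S_def)
    \<comment> \<open>The exit time compares only times up to \<open>d\<close>. A point of
      \<open>B\<close> cannot have a larger time: the Lipschitz bound for \<phi> gives
      \<open>norm (s *\<^sub>R u) \<le> L * \<delta>\<close>, which is at most \<open>d\<close>, and
      \<open>u\<close> has length at least 1. Conversely, points of the ray in \<open>V\<close>
      belong to \<open>M\<close> because they lie in \<open>span I\<close>.\<close>
    have Bs: "v0 + s *\<^sub>R u \<in> B \<longleftrightarrow> s \<le> \<rho> (v0, u) t" if s: "s > 0" and u: "u \<in> A" for s u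
    proof -
      have \<theta>: "(v0, u) \<in> \<Theta>" using v0 u by (auto simp: \<Theta>_def A_def)
      have t': "t \<in> {0..d / (2 * L)}" using t \<delta> by auto
      show ?thesis
      proof
        assume "v0 + s *\<^sub>R u \<in> B"
        then obtain y where y: "y \<in> S" "v0 + s *\<^sub>R u = \<phi> y" unfolding B_def by blast
        have ypsi: "\<psi> (v0 + s *\<^sub>R u) = y" using y SU D(9) by auto
        have "norm (\<phi> y - \<phi> x) \<le> L * norm (y - x)" using L y Sp xX[OF x] by blast
        also have "\<dots> \<le> L * \<delta>" using y t L0 by (intro mult_left_mono) (auto simp: S_def dist_norm norm_minus_commute)
        also have "\<dots> \<le> d" by (rule L\<delta>)
        finally have "norm (\<phi> y - \<phi> x) \<le> d" .
        moreover have "s *\<^sub>R u = \<phi> y - \<phi> x" using y(2) unfolding v0_def by (simp add: eq_diff_eq add.commute)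
        ultimately have "norm (s *\<^sub>R u) \<le> d" by simp
        moreover have "s * 1 \<le> norm (s *\<^sub>R u)"
          unfolding norm_scaleR using u s by (intro mult_mono) (auto simp: A_def annulus_def)
        ultimately have "s * 1 \<le> d" by (rule order_trans[rotated])
        hence "s \<in> {0..d}" using s by simp
        from \<rho>(3)[OF \<theta> t' this] show "s \<le> \<rho> (v0, u) t"
          using y(1) ypsi v0(3) by (simp add: S_def dist_norm norm_minus_commute)
      next
        assume le: "s \<le> \<rho> (v0, u) t"
        hence sd: "s \<in> {0..d}" using \<rho>(2)[OF \<theta> t'] s by auto
        have "norm (\<psi> (v0 + s *\<^sub>R u) - x) \<le> t" using \<rho>(3)[OF \<theta> t' sd] le v0(3) by simp
        moreover have inV: "v0 + s *\<^sub>R u \<in> V"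
          using annulus_line_in_cball[of v0 q r u s] sd d v0 u K by (auto simp: A_def)
        moreover have "\<psi> (v0 + s *\<^sub>R u) \<in> M"
        proof -
          have "v0 + s *\<^sub>R u \<in> span I" using v0(2) u by (auto simp: A_def intro!: span_add span_scale)
          hence "v0 + s *\<^sub>R u \<in> \<phi> ` (M \<inter> U)" using inV D(13) by blast
          thus ?thesis using D(9) by auto
        qed
        ultimately show "v0 + s *\<^sub>R u \<in> B" unfolding Biff by (simp add: dist_norm norm_minus_commute)
      qed
    qed
    define f where "f v = ennreal (indicator B v * sqrt (gram_det I \<psi> v))" for v
    have fm [measurable]: "f \<in> borel_measurable borel"
      unfolding f_def using slice_chart_density_measurable[OF c B] by simp
    define J where "J u = (\<integral>\<^sup>+s. f (v0 + s *\<^sub>R u) * ennreal (s ^ (card I - 1)) * indicator {0<..} s \<partial>lborel)" for u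
    have Jm [measurable]: "J \<in> borel_measurable borel" unfolding J_def[abs_def] by measurable
    have J: "J u = ennreal (P (v0, u) t)" if u: "u \<in> A" for u
    proof -
      have \<theta>: "(v0, u) \<in> \<Theta>" using v0 u by (auto simp: \<Theta>_def A_def)
      have "J u = (\<integral>\<^sup>+s. ennreal (G (v0, u) s) * indicator {0..\<rho> (v0, u) t} s \<partial>lborel)"
        unfolding J_def
      proof (rule nn_integral_cong_AE)
        have "AE s in lborel. s \<noteq> (0::real)" by (rule AE_lborel_singleton)
        thus "AE s in lborel. f (v0 + s *\<^sub>R u) * ennreal (s ^ (card I - 1)) * indicator {0<..} s =
            ennreal (G (v0, u) s) * indicator {0..\<rho> (v0, u) t} s"
        proof eventually_elim
          case (elim s)
          show ?case
          proof (cases "s > 0")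
            case True
            have "sqrt (gram_det I \<psi> (v0 + s *\<^sub>R u)) \<ge> 0" if "v0 + s *\<^sub>R u \<in> B"
              using slice_chart_gram_pos[OF c, of "v0 + s *\<^sub>R u"] B(2) that by auto
            thus ?thesis using True Bs[OF True u] 
              by (auto simp: f_def G_def D(2) ennreal_mult split: split_indicator)
          next
            case False
            thus ?thesis using elim by (auto split: split_indicator)
          qed
        qed
      qed
      also have "\<dots> = ennreal (P (v0, u) t)"
        by (rule nn_integral_has_integral_lebesgue'[OF _ Gint[OF \<theta> t]])
           (use Gnn[OF \<theta>] \<rho>(2)[OF \<theta>, of t] t \<delta> in auto)
      finally show ?thesis .
    qed
    \<comment> \<open>The estimates say nothing about dependence on the direction. Measurability is
      inherited from \<open>J\<close>, an integral of a jointly measurable function.\<close>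
    have Pm: "(\<lambda>u. P (v0, u) t) \<in> borel_measurable \<nu>"
    proof (subst measurable_cong)
      show "P (v0, u) t = enn2real (J u)" if "u \<in> space \<nu>" for u
        using J[of u] that Pnn[of "(v0, u)" t] t v0 by (auto simp: sp\<nu> \<Theta>_def A_def)
      show "(\<lambda>u. enn2real (J u)) \<in> borel_measurable \<nu>"
        unfolding \<nu>_def by (intro measurable_restrict_space1) measurable
    qed
    have "emeasure (riemannian_volume m M) S = chart_volume I \<phi> \<psi> S"
      by (rule emeasure_riemannian_volume_chart[OF M c SU(3,2,1)])
    also have "\<dots> = (\<integral>\<^sup>+v. f v \<partial>lborel_span I)"
      unfolding chart_volume_def f_def B_def[symmetric] by (intro nn_integral_cong) (auto split: split_indicator)
    also have "\<dots> = (\<integral>\<^sup>+w. f (v0 + w) \<partial>lborel_span I)"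
      using nn_integral_lborel_span_affine[OF fin D(1) fm, of 1 v0] v0 by simp
    also have "\<dots> = (\<integral>\<^sup>+u. indicator {u. 1 \<le> norm u \<and> norm u \<le> exp 1} u * J u \<partial>lborel_span I)"
      unfolding J_def by (rule nn_integral_lborel_span_radial[OF D(1) I0]) measurable
    also have "\<dots> = (\<integral>\<^sup>+u. ennreal (P (v0, u) t) * indicator A u \<partial>lborel_span I)"
    proof (rule nn_integral_cong_AE)
      show "AE u in lborel_span I. indicator {u. 1 \<le> norm u \<and> norm u \<le> exp 1} u * J u = ennreal (P (v0, u) t) * indicator A u"
        using AE_lborel_span[OF D(1)]
        by eventually_elim (auto simp: A_def annulus_def J split: split_indicator)
    qed
    also have "\<dots> = (\<integral>\<^sup>+u. ennreal (P (v0, u) t) \<partial>\<nu>)"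
      unfolding \<nu>_def by (subst nn_integral_restrict_space) auto
    finally have "measure (riemannian_volume m M) S = enn2real (\<integral>\<^sup>+u. ennreal (P (v0, u) t) \<partial>\<nu>)"
      by (simp add: measure_def)
    also have "\<dots> = (\<integral>u. P (v0, u) t \<partial>\<nu>)"
      using Pnn t v0 by (intro integral_eq_nn_integral[symmetric] Pm AE_I2) (auto simp: sp\<nu> \<Theta>_def A_def)
    finally show ?thesis using Pm by (simp add: ball_volume_def S_def v0_def)
  qed
  have in\<Theta>: "(\<phi> x, u) \<in> \<Theta>" if "x \<in> X" "u \<in> space \<nu>" for x u
    using xX[OF that(1)] that(2) by (auto simp: \<Theta>_def sp\<nu> A_def)
  define Q where "Q z t = P (\<phi> (fst z), snd z) t" for z :: "'a \<times> 'a" and t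
  have "unif_Ck k X \<delta> (\<lambda>x t. \<integral>u. Q (x, u) t \<partial>\<nu>)"
  proof (rule unif_Ck_integral[OF _ \<delta>(1) fin\<nu>])
    show "unif_Ck k (X \<times> space \<nu>) \<delta> Q"
      unfolding Q_def[abs_def] by (rule unif_Ck_reindex[OF P]) (use in\<Theta> in auto)
    show "(\<lambda>u. Q (x, u) t) \<in> borel_measurable \<nu>" if "x \<in> X" "t \<in> {0..\<delta>}" for x t
      using key[OF that] by (simp add: Q_def)
  qed
  hence main: "unif_Ck k X \<delta> (ball_volume m M)"
    by (rule unif_Ck_cong) (use key in \<open>simp add: Q_def\<close>)
  obtain b where b: "b > 0" "\<And>\<theta> s. \<theta> \<in> \<Theta> \<Longrightarrow> s \<in> {0..r / exp 1} \<Longrightarrow> \<bar>sqrt (gram_det I \<psi> (fst \<theta> + s *\<^sub>R snd \<theta>)) * s ^ 0\<bar> \<le> b"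
    using unif_boundedE[OF unif_Ck_bounded[OF unif_Ck_gram_line[OF c r(1) K, of 0 0, folded \<Theta>_def]]] by metis
  \<comment> \<open>With \<open>b\<close> bounding the density, \<open>G\<close> is at most
    \<open>b\<close> times the power \<open>m - 1\<close> of the exit time; integrating adds one
    power, and the exit time is at most \<open>2 * L * t\<close>.\<close>
  have Pb: "P \<theta> t \<le> b * (2 * L * t) ^ m" if \<theta>: "\<theta> \<in> \<Theta>" and t: "t \<in> {0..\<delta>}" for \<theta> t
  proof -
    have \<rho>t: "0 \<le> \<rho> \<theta> t" "\<rho> \<theta> t \<le> d" "\<rho> \<theta> t \<le> 2 * L * t" using \<rho>(2)[OF \<theta>, of t] t \<delta> by auto
    have "P \<theta> t \<le> (b * \<rho> \<theta> t ^ (m - 1)) * (\<rho> \<theta> t - 0)"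
    proof (rule has_integral_le[OF Gint[OF \<theta> t]])
      show "((\<lambda>_. b * \<rho> \<theta> t ^ (m - 1)) has_integral (b * \<rho> \<theta> t ^ (m - 1)) * (\<rho> \<theta> t - 0)) {0..\<rho> \<theta> t}"
        using has_integral_const_real[of "b * \<rho> \<theta> t ^ (m - 1)" 0 "\<rho> \<theta> t"] \<rho>t by (simp add: mult.commute)
      fix s assume s: "s \<in> {0..\<rho> \<theta> t}"
      show "G \<theta> s \<le> b * \<rho> \<theta> t ^ (m - 1)"
        unfolding G_def using b(2)[OF \<theta>, of s] s \<rho>t d b(1) by (intro mult_mono power_mono) auto
    qed
    also have "\<dots> = b * \<rho> \<theta> t ^ m" using m by (cases m) auto
    also have "\<dots> \<le> b * (2 * L * t) ^ m" using \<rho>t b by (intro mult_left_mono power_mono) auto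
    finally show ?thesis .
  qed
  have bound: "ball_volume m M x t \<le> (b * (2 * L) ^ m * measure \<nu> (space \<nu>)) * t ^ m" if x: "x \<in> X" and t: "t \<in> {0..\<delta>}" for x t
  proof -
    interpret finite_measure \<nu> by fact
    have "ball_volume m M x t = (\<integral>u. P (\<phi> x, u) t \<partial>\<nu>)" using key[OF x t] by simp
    also have "\<dots> \<le> (\<integral>u. b * (2 * L * t) ^ m \<partial>\<nu>)"
    proof (rule integral_mono)
      show "integrable \<nu> (\<lambda>u. P (\<phi> x, u) t)"
        using key[OF x t] Pb Pnn in\<Theta>[OF x] t by (intro integrable_const_bound[of _ "b * (2 * L * t) ^ m"]) auto
      show "P (\<phi> x, u) t \<le> b * (2 * L * t) ^ m" if "u \<in> space \<nu>" for u
        by (rule Pb[OF in\<Theta>[OF x that] t])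
    qed simp
    also have "\<dots> = (b * (2 * L) ^ m * measure \<nu> (space \<nu>)) * t ^ m" by (simp add: power_mult_distrib)
    finally show ?thesis .
  qed
  show ?thesis
    using \<eta>(1) \<delta>(1) main bound unfolding X_def by blast
qed

text \<open>Polar coordinates require positive dimension. In dimension 0 the slice is contained in
  the origin, so \<open>p\<close> is isolated in \<open>M\<close> and small closed balls have
  constant volume, including at \<open>t = 0\<close>.\<close>

lemma local_ball_volume_0:
  fixes M :: "'a::euclidean_space set"
  assumes M: "closed_submanifold 0 M" and p: "p \<in> M"
  shows "\<exists>\<eta>>0. \<exists>\<delta>>0. unif_Ck k (M \<inter> ball p \<eta>) \<delta> (ball_volume 0 M) \<and>
     (\<exists>C. \<forall>x\<in>M \<inter> ball p \<eta>. \<forall>t\<in>{0..\<delta>}. ball_volume 0 M x t \<le> C * t ^ 0)"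
proof -
  obtain I U V \<phi> \<psi> where pU: "p \<in> U" and c: "slice_chart 0 M I U V \<phi> \<psi>"
    using M p unfolding closed_submanifold_def by blast
  note D = slice_chartD[OF c]
  have "I = {}" using finite_Basis_subset[OF D(1)] D(2) by simp
  hence "\<phi> ` (M \<inter> U) \<subseteq> {0}" using D(13) by auto
  hence single: "y = p" if "y \<in> M" "y \<in> U" for y
    using that p pU D(9) by (metis IntI image_subset_iff singletonD)
  obtain R where R: "R > 0" "ball p R \<subseteq> U" using D(3) pU open_contains_ball by blast
  have bv: "ball_volume 0 M x t = measure (riemannian_volume 0 M) {p}" if "x \<in> M \<inter> ball p R" "t \<in> {0..R / 2}" for x t
  proof -
    have x: "x = p" by (rule single) (use that R in auto)
    have "M \<inter> cball x t = {p}"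
    proof
      show "M \<inter> cball x t \<subseteq> {p}"
      proof
        fix y assume y: "y \<in> M \<inter> cball x t"
        hence "y \<in> ball p R" using that(2) R(1) unfolding x by simp
        hence "y = p" using single y R(2) by blast
        thus "y \<in> {p}" by simp
      qed
      show "{p} \<subseteq> M \<inter> cball x t" using p x that by simp
    qed
    thus ?thesis by (simp add: ball_volume_def)
  qed
  have "unif_Ck k (M \<inter> ball p R) (R / 2) (\<lambda>x t. measure (riemannian_volume 0 M) {p})"
    by (rule unif_Ck_const[of _ _ "measure (riemannian_volume 0 M) {p}"]) simp
  hence "unif_Ck k (M \<inter> ball p R) (R / 2) (ball_volume 0 M)"
    by (rule unif_Ck_cong) (rule bv)
  moreover have "\<forall>x\<in>M \<inter> ball p R. \<forall>t\<in>{0..R / 2}. ball_volume 0 M x t \<le> measure (riemannian_volume 0 M) {p} * t ^ 0"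
    using bv by simp
  ultimately show ?thesis using R(1) half_gt_zero by blast
qed

text \<open>The derivatives supplied on the individual patches need not be the same functions. For
  \<open>d > 0\<close> derivatives within the interval are unique, so all patches share the
  canonical choice \<open>vector_derivative\<close>.\<close>

lemma unif_Ck_UN:
  assumes "finite S" "\<And>s. s \<in> S \<Longrightarrow> unif_Ck k (P s) d f"
  shows "unif_Ck k (\<Union>s\<in>S. P s) d f"
  using assms(2)
proof (induction k arbitrary: f)
  have bdd: "unif_bounded (\<Union>s\<in>S. P s) d f" if "\<And>s. s \<in> S \<Longrightarrow> unif_bounded (P s) d f" for f
  proof -
    obtain C where C: "\<And>s p t. s \<in> S \<Longrightarrow> p \<in> P s \<Longrightarrow> t \<in> {0..d} \<Longrightarrow> \<bar>f p t\<bar> \<le> C s"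
      using \<open>\<And>s. s \<in> S \<Longrightarrow> unif_bounded (P s) d f\<close> unfolding unif_bounded_def by metis
    have "C s \<le> (\<Sum>s\<in>S. \<bar>C s\<bar>)" if "s \<in> S" for s
    proof -
      have "\<bar>C s\<bar> \<le> (\<Sum>s\<in>S. \<bar>C s\<bar>)" using assms(1) that by (intro member_le_sum) auto
      thus ?thesis by simp
    qed
    thus ?thesis unfolding unif_bounded_def
      by (intro exI[of _ "\<Sum>s\<in>S. \<bar>C s\<bar>"]) (use C in \<open>fastforce intro: order_trans\<close>)
  qed
  {
    case 0
    thus ?case using bdd by auto
  next
    case (Suc k)
    define f' where "f' p t = vector_derivative (f p) (at t within {0..d})" for p t
    show ?case
    proof (cases "d > 0")
      case True
      have f': "D = f' p t" if "(f p has_real_derivative D) (at t within {0..d})" "t \<in> {0..d}" for p t D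
        unfolding f'_def using that True
        by (intro vector_derivative_within[symmetric])
           (auto simp: has_real_derivative_iff_has_vector_derivative trivial_limit_within islimpt_Icc)
      have *: "unif_Ck k (P s) d f' \<and> (\<forall>p\<in>P s. \<forall>t\<in>{0..d}. (f p has_real_derivative f' p t) (at t within {0..d}))" if "s \<in> S" for s
      proof -
        note prem = Suc.prems[OF that]
        obtain g' where g': "\<And>p t. p \<in> P s \<Longrightarrow> t \<in> {0..d} \<Longrightarrow> (f p has_real_derivative g' p t) (at t within {0..d})"
          "unif_Ck k (P s) d g'" "unif_bounded (P s) d f" by (rule unif_Ck_SucE[OF prem]) blast
        have "g' p t = f' p t" if "p \<in> P s" "t \<in> {0..d}" for p t using f'[OF g'(1)[OF that] that(2)] .
        thus ?thesis using g' unif_Ck_cong[OF g'(2), of f'] by metis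
      qed
      show ?thesis
      proof (rule unif_Ck_SucI[OF bdd Suc.IH])
        show "unif_bounded (P s) d f" if "s \<in> S" for s using unif_Ck_bounded[OF Suc.prems[OF that]] .
        show "unif_Ck k (P s) d f'" if "s \<in> S" for s using *[OF that] by blast
        fix p t assume "p \<in> (\<Union>s\<in>S. P s)" "t \<in> {0..d}"
        thus "(f p has_real_derivative f' p t) (at t within {0..d})" using * by blast
      qed
    next
      case False
      \<comment> \<open>The interval has at most one point here, so the filter is trivial and 0
        qualifies as a derivative of any function.\<close>
      have "at t within {0..d} = bot" if "t \<in> {0..d}" for t
      proof -
        have "{0..d} \<subseteq> {t}" using that False by auto
        hence "finite {0..d}" by (rule finite_subset) simp
        thus ?thesis by (simp add: trivial_limit_within islimpt_finite)
      qed
      hence "(f p has_real_derivative 0) (at t within {0..d})" if "t \<in> {0..d}" for p t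
        using that by (simp add: has_field_derivative_iff)
      thus ?thesis
        by (intro unif_Ck_SucI[OF bdd unif_Ck_const[of _ "\<lambda>_. 0" 0]]) (use unif_Ck_bounded Suc.prems in auto)
    qed
  }
qed

text \<open>Finitely many of the local neighbourhoods cover the compact set \<open>M\<close>, and
  the smallest of their intervals serves for all points. The interval is chosen after the order
  \<open>k\<close>.\<close>

lemma ball_volume_unif_Ck:
  fixes M :: "'a::euclidean_space set"
  assumes M: "closed_submanifold m M"
  shows "\<exists>\<delta>>0. unif_Ck k M \<delta> (ball_volume m M) \<and> (\<exists>C. \<forall>x\<in>M. \<forall>t\<in>{0..\<delta>}. ball_volume m M x t \<le> C * t ^ m)"
proof (cases "M = {}")
  case True
  have "unif_Ck k {} 1 (ball_volume m M)" by (induction k) (auto simp: unif_bounded_def)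
  thus ?thesis using True by (intro exI[of _ 1]) auto
next
  case False
  have "\<exists>\<eta>>0. \<exists>\<delta>>0. unif_Ck k (M \<inter> ball p \<eta>) \<delta> (ball_volume m M) \<and>
     (\<exists>C. \<forall>x\<in>M \<inter> ball p \<eta>. \<forall>t\<in>{0..\<delta>}. ball_volume m M x t \<le> C * t ^ m)" if "p \<in> M" for p
    using local_ball_volume[OF M that] local_ball_volume_0[OF _ that] M by (cases "m = 0") auto
  then obtain \<eta> \<delta> C where loc: "\<And>p. p \<in> M \<Longrightarrow> \<eta> p > 0" "\<And>p. p \<in> M \<Longrightarrow> \<delta> p > 0"
    "\<And>p. p \<in> M \<Longrightarrow> unif_Ck k (M \<inter> ball p (\<eta> p)) (\<delta> p) (ball_volume m M)"
    "\<And>p x t. p \<in> M \<Longrightarrow> x \<in> M \<inter> ball p (\<eta> p) \<Longrightarrow> t \<in> {0..\<delta> p} \<Longrightarrow> ball_volume m M x t \<le> C p * t ^ m"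
    by metis
  have "compact M" using M by (simp add: closed_submanifold_def)
  moreover have "M \<subseteq> (\<Union>p\<in>M. ball p (\<eta> p))" using loc(1) by force
  ultimately obtain S where S: "S \<subseteq> M" "finite S" "M \<subseteq> (\<Union>p\<in>S. ball p (\<eta> p))"
    by (elim compactE_image) auto
  have Sne: "S \<noteq> {}" using S False by auto
  define d where "d = Min (\<delta> ` S)"
  have d: "d > 0" "\<And>p. p \<in> S \<Longrightarrow> d \<le> \<delta> p"
    using S Sne loc(2) by (auto simp: d_def Min_gr_iff)
  have "unif_Ck k (\<Union>p\<in>S. M \<inter> ball p (\<eta> p)) d (ball_volume m M)"
    by (rule unif_Ck_UN[OF S(2)], rule unif_Ck_reindex[OF loc(3), of _ _ "\<lambda>x. x"]) (use S d in auto)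
  moreover have "(\<Union>p\<in>S. M \<inter> ball p (\<eta> p)) = M" using S by auto
  ultimately have 1: "unif_Ck k M d (ball_volume m M)" by simp
  have "ball_volume m M x t \<le> (\<Sum>p\<in>S. \<bar>C p\<bar>) * t ^ m" if x: "x \<in> M" and t: "t \<in> {0..d}" for x t
  proof -
    obtain p where p: "p \<in> S" "x \<in> ball p (\<eta> p)" using x S by blast
    have "ball_volume m M x t \<le> C p * t ^ m" using loc(4)[of p x t] p S x t d(2)[of p] by auto
    also have "\<dots> \<le> (\<Sum>p\<in>S. \<bar>C p\<bar>) * t ^ m"
    proof (rule mult_right_mono)
      have "\<bar>C p\<bar> \<le> (\<Sum>p\<in>S. \<bar>C p\<bar>)" using S p by (intro member_le_sum) auto
      thus "C p \<le> (\<Sum>p\<in>S. \<bar>C p\<bar>)" by simp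
    qed (use t in auto)
    finally show ?thesis .
  qed
  thus ?thesis using 1 d(1) by blast
qed

section \<open>Complex powers and holomorphic parameter integrals\<close>

text \<open>A local majorant for the functions alone is enough: Cauchy's inequality on discs of half
  the radius converts it into a majorant for the difference quotients, and dominated convergence
  yields a complex derivative at every point.\<close>

lemma holomorphic_integral_dominated:
  fixes f :: "complex \<Rightarrow> 'b \<Rightarrow> complex"
  assumes hol: "\<And>x. x \<in> space N \<Longrightarrow> (\<lambda>z. f z x) holomorphic_on S"
    and meas: "\<And>z. z \<in> S \<Longrightarrow> f z \<in> borel_measurable N"
    and dom: "\<And>z. z \<in> S \<Longrightarrow> \<exists>r>0. cball z r \<subseteq> S \<and>
      (\<exists>g. integrable N g \<and> (\<forall>x\<in>space N. \<forall>w\<in>cball z r. norm (f w x) \<le> g x))"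
  shows "(\<lambda>z. \<integral>x. f z x \<partial>N) holomorphic_on S"
proof -
  have "\<exists>D. ((\<lambda>z. \<integral>x. f z x \<partial>N) has_field_derivative D) (at z)" if z: "z \<in> S" for z
  proof -
    obtain r g where r: "r > 0" "cball z r \<subseteq> S" and g: "integrable N g" 
      "\<And>x w. x \<in> space N \<Longrightarrow> w \<in> cball z r \<Longrightarrow> norm (f w x) \<le> g x" using dom[OF z] by blast
    define f' where "f' x = deriv (\<lambda>z. f z x) z" for x
    have holr: "(\<lambda>z. f z x) holomorphic_on cball z r" if "x \<in> space N" for x
      using hol[OF that] r(2) by (rule holomorphic_on_subset)
    \<comment> \<open>Discs of radius \<open>r / 2\<close> around points of
      \<open>cball z (r / 2)\<close> stay in \<open>cball z r\<close>, so the derivative there is at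
      most \<open>g x / (r / 2)\<close>.\<close>
    have lip: "norm (f w x - f z x) \<le> (2 / r * g x) * norm (w - z)" if x: "x \<in> space N" and w: "w \<in> cball z (r / 2)" for x w
    proof (rule field_differentiable_bound[OF convex_cball])
      fix u assume u: "u \<in> cball z (r / 2)"
      have sub: "cball u (r / 2) \<subseteq> cball z r"
      proof
        fix y assume "y \<in> cball u (r / 2)"
        thus "y \<in> cball z r" using u dist_triangle[of z y u] by simp
      qed
      have "u \<in> ball z r" using u r by auto
      hence "((\<lambda>z. f z x) has_field_derivative deriv (\<lambda>z. f z x) u) (at u)"
        using holomorphic_derivI[OF holomorphic_on_subset[OF holr[OF x] ball_subset_cball] open_ball] by blast
      thus "((\<lambda>z. f z x) has_field_derivative deriv (\<lambda>z. f z x) u) (at u within cball z (r / 2))"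
        by (rule has_field_derivative_at_within)
      have "norm ((deriv ^^ 1) (\<lambda>z. f z x) u) \<le> fact 1 * g x / (r / 2) ^ 1"
      proof (rule Cauchy_inequality)
        show "(\<lambda>z. f z x) holomorphic_on ball u (r / 2)"
          using holr[OF x] by (rule holomorphic_on_subset) (use sub ball_subset_cball in blast)
        show "continuous_on (cball u (r / 2)) (\<lambda>z. f z x)"
          by (rule continuous_on_subset[OF holomorphic_on_imp_continuous_on[OF holr[OF x]] sub])
        show "norm (f y x) \<le> g x" if "norm (u - y) = r / 2" for y
          by (rule g(2)[OF x subsetD[OF sub]]) (simp add: dist_norm that)
      qed (use r in auto)
      thus "norm (deriv (\<lambda>z. f z x) u) \<le> 2 / r * g x" by (simp add: field_simps)
    qed (use r w in auto)
    have quot: "(\<lambda>i. (f (T i) x - f z x) / (T i - z)) \<longlonglongrightarrow> f' x"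
      if "x \<in> space N" "\<And>i. T i \<noteq> z" "T \<longlonglongrightarrow> z" for x and T :: "nat \<Rightarrow> complex"
    proof -
      have "((\<lambda>z. f z x) has_field_derivative f' x) (at z)"
        unfolding f'_def using r
        by (intro holomorphic_derivI[OF holomorphic_on_subset[OF holr[OF that(1)] ball_subset_cball] open_ball]) auto
      thus ?thesis using that(2,3) by (simp add: has_field_derivative_iff tendsto_at_iff_sequentially o_def)
    qed
    have f'm: "f' \<in> borel_measurable N"
    proof (rule borel_measurable_LIMSEQ_metric)
      define T where "T i = z + of_real (r / real (Suc i))" for i
      have lim: "(\<lambda>i. r / real (Suc i)) \<longlonglongrightarrow> 0" by (intro LIMSEQ_Suc lim_const_over_n)
      have "T \<longlonglongrightarrow> z + of_real 0" unfolding T_def by (intro tendsto_intros lim)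
      hence T: "T \<longlonglongrightarrow> z" by simp
      have Tne: "T i \<noteq> z" for i
      proof -
        have "r / real (Suc i) \<noteq> 0" using r by simp
        thus ?thesis unfolding T_def by (metis add_cancel_left_right of_real_eq_0_iff)
      qed
      show "(\<lambda>i. (f (T i) x - f z x) / (T i - z)) \<longlonglongrightarrow> f' x" if "x \<in> space N" for x
        by (rule quot[OF that Tne T])
      show "(\<lambda>x. (f (T i) x - f z x) / (T i - z)) \<in> borel_measurable N" for i
      proof -
        have "T i \<in> cball z r" using r by (simp add: T_def dist_norm norm_divide field_simps del: of_nat_Suc)
        hence [measurable]: "f (T i) \<in> borel_measurable N" "f z \<in> borel_measurable N" using meas r z by auto
        show ?thesis by measurable
      qed
    qed
    have int: "integrable N (f w)" if "w \<in> cball z r" for w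
      using g meas[of w] that r by (intro Bochner_Integration.integrable_bound[OF g(1)] AE_I2) force+
    have "((\<lambda>w. ((\<integral>x. f w x \<partial>N) - (\<integral>x. f z x \<partial>N)) / (w - z)) \<longlongrightarrow> (\<integral>x. f' x \<partial>N)) (at z)"
      unfolding tendsto_at_iff_sequentially o_def
    proof (intro allI impI)
      fix T assume T: "\<forall>i. T i \<in> UNIV - {z}" "T \<longlonglongrightarrow> z"
      have "eventually (\<lambda>i. dist (T i) z < r / 2) sequentially" using T(2) r by (intro tendstoD) auto
      then obtain n where n: "\<And>i. i \<ge> n \<Longrightarrow> dist (T i) z < r / 2" unfolding eventually_sequentially by blast
      \<comment> \<open>The Lipschitz estimate holds only within \<open>r / 2\<close> of
        \<open>z\<close>, so the terms of the sequence before that are dropped.\<close>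
      define U where "U i = T (i + n)" for i
      have U: "U i \<noteq> z" "U i \<in> cball z (r / 2)" "U i \<in> cball z r" for i
        using T n[of "i + n"] r by (auto simp: U_def dist_commute)
      have Ul: "U \<longlonglongrightarrow> z" unfolding U_def using T(2) by (rule LIMSEQ_ignore_initial_segment)
      have eq: "((\<integral>x. f (U i) x \<partial>N) - (\<integral>x. f z x \<partial>N)) / (U i - z) = (\<integral>x. (f (U i) x - f z x) / (U i - z) \<partial>N)" for i
        using int[OF U(3)] int[of z] r by simp
      have "(\<lambda>i. \<integral>x. (f (U i) x - f z x) / (U i - z) \<partial>N) \<longlonglongrightarrow> (\<integral>x. f' x \<partial>N)"
      proof (rule integral_dominated_convergence[where w = "\<lambda>x. 2 / r * g x"])
        show "integrable N (\<lambda>x. 2 / r * g x)" using g by simp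
        show "AE x in N. (\<lambda>i. (f (U i) x - f z x) / (U i - z)) \<longlonglongrightarrow> f' x"
          by (intro AE_I2 quot Ul U)
        show "AE x in N. norm ((f (U i) x - f z x) / (U i - z)) \<le> 2 / r * g x" for i
        proof (rule AE_I2)
          fix x assume "x \<in> space N"
          from lip[OF this U(2)] show "norm ((f (U i) x - f z x) / (U i - z)) \<le> 2 / r * g x"
            using U(1)[of i] by (simp add: norm_divide divide_le_eq)
        qed
        show "(\<lambda>x. (f (U i) x - f z x) / (U i - z)) \<in> borel_measurable N" for i
        proof -
          have "z \<in> cball z r" using r by simp
          hence [measurable]: "f (U i) \<in> borel_measurable N" "f z \<in> borel_measurable N"
            using borel_measurable_integrable[OF int] U(3)[of i] by auto
          show ?thesis by measurable
        qed
      qed (rule f'm)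
      hence "(\<lambda>i. ((\<integral>x. f (U i) x \<partial>N) - (\<integral>x. f z x \<partial>N)) / (U i - z)) \<longlonglongrightarrow> (\<integral>x. f' x \<partial>N)"
        unfolding eq .
      thus "(\<lambda>i. ((\<integral>x. f (T i) x \<partial>N) - (\<integral>x. f z x \<partial>N)) / (T i - z)) \<longlonglongrightarrow> (\<integral>x. f' x \<partial>N)"
        unfolding U_def by (rule LIMSEQ_offset)
    qed
    thus ?thesis by (auto simp: has_field_derivative_iff)
  qed
  thus ?thesis by (metis has_field_derivative_at_within holomorphic_on_def field_differentiable_def)
qed

text \<open>For \<open>t > 0\<close> this is \<open>powr\<close>, in a form that is visibly entire
  in the exponent. At \<open>t = 0\<close> the two differ, since \<open>exp\<close> never
  vanishes.\<close>

definition cpow :: "real \<Rightarrow> complex \<Rightarrow> complex" where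
  "cpow t z = exp (z * of_real (ln t))"

lemma powr_eq_cpow: "t > 0 \<Longrightarrow> complex_of_real t powr z = cpow t z"
  by (simp add: cpow_def powr_def Ln_of_real)

lemma norm_cpow: "t > 0 \<Longrightarrow> norm (cpow t z) = t powr Re z"
  by (simp add: cpow_def powr_def)

lemma cpow_add: "cpow t (z + w) = cpow t z * cpow t w"
  by (simp add: cpow_def distrib_right exp_add)

lemma cpow_of_nat: "t > 0 \<Longrightarrow> cpow t (of_nat n) = of_real (t ^ n)"
  by (simp add: cpow_def exp_of_nat_mult exp_of_real)

lemma measurable_cpow [measurable]: "(\<lambda>t. cpow t z) \<in> borel_measurable borel"
  unfolding cpow_def by measurable

lemma holomorphic_cpow [holomorphic_intros]: "f holomorphic_on S \<Longrightarrow> (\<lambda>z. cpow t (f z)) holomorphic_on S"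
  unfolding cpow_def by (intro holomorphic_intros)

lemma cpow_derivative:
  assumes "t > 0" "s \<noteq> 0"
  shows "((\<lambda>t. cpow t s / s) has_vector_derivative cpow t (s - 1)) (at t)"
proof -
  have "(ln has_vector_derivative (1 / t)) (at t)"
    using assms(1) by (auto intro!: derivative_eq_intros simp: has_real_derivative_iff_has_vector_derivative[symmetric])
  hence 1: "((\<lambda>t. complex_of_real (ln t)) has_vector_derivative of_real (1 / t)) (at t)"
    by (rule bounded_linear.has_vector_derivative[OF bounded_linear_of_real])
  have "((\<lambda>w. exp (s * w) / s) has_field_derivative exp (s * of_real (ln t))) (at (of_real (ln t)))"
    using assms(2) by (auto intro!: derivative_eq_intros)
  from field_vector_diff_chain_at[OF 1 this]
  have "((\<lambda>t. cpow t s / s) has_vector_derivative of_real (1 / t) * cpow t s) (at t)"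
    by (simp add: o_def cpow_def)
  moreover have "of_real (1 / t) * cpow t s = cpow t (s - 1)"
    using assms(1) cpow_add[of t "s - 1" 1] cpow_of_nat[of t 1] by simp
  ultimately show ?thesis by simp
qed

lemma integrable_powr_0:
  fixes a D :: real
  assumes "a > 0" "D \<ge> 0"
  shows "set_integrable lborel {0<..D} (\<lambda>t. t powr (a - 1))"
proof -
  have "(\<lambda>t. t powr (a - 1)) integrable_on {0<..D}"
    by (rule integrable_on_powr_from_0') (use assms in auto)
  hence "(\<lambda>t. t powr (a - 1)) absolutely_integrable_on {0<..D}"
    by (intro nonnegative_absolutely_integrable_1) auto
  thus ?thesis
    unfolding set_integrable_def by (subst (asm) integrable_completion) auto
qed

lemma set_integrable_cpow:
  assumes "Re s > 0" "D \<ge> 0"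
  shows "set_integrable lborel {0<..D} (\<lambda>t. cpow t (s - 1))"
  unfolding set_integrable_def
proof (rule Bochner_Integration.integrable_bound[OF integrable_powr_0[OF assms, unfolded set_integrable_def]])
  show "AE t in lborel. norm (indicat_real {0<..D} t *\<^sub>R cpow t (s - 1)) \<le> norm (indicat_real {0<..D} t *\<^sub>R t powr (Re s - 1))"
    by (intro AE_I2) (auto simp: norm_cpow split: split_indicator)
qed simp

lemma integral_cpow:
  assumes "Re s > 0" and "0 \<le> a" "a < D"
  shows "(LINT t:{a<..D}|lborel. cpow t (s - 1)) = cpow D s / s - (if a = 0 then 0 else cpow a s / s)"
proof -
  have s0: "s \<noteq> 0" using assms(1) by auto
  \<comment> \<open>The primitive \<open>cpow t s / s\<close> extends continuously by 0 to
    \<open>t = 0\<close> because \<open>Re s > 0\<close>; \<open>cpow\<close> itself does not take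
    this value there.\<close>
  define f where "f t = (if t = 0 then 0 else cpow t s / s)" for t
  have "((\<lambda>t. cpow t (s - 1)) has_integral (f D - f a)) {a..D}"
  proof (rule fundamental_theorem_of_calculus_interior)
    show "(f has_vector_derivative cpow t (s - 1)) (at t)" if "t \<in> {a<..<D}" for t
    proof (rule has_vector_derivative_transform_within_open)
      show "((\<lambda>t. cpow t s / s) has_vector_derivative cpow t (s - 1)) (at t)"
        by (rule cpow_derivative) (use that assms s0 in auto)
      show "open {(0::real)<..}" "t \<in> {0<..}" using that assms by auto
      show "cpow x s / s = f x" if "x \<in> {0<..}" for x using that by (simp add: f_def)
    qed
    have "isCont f t" if "t > 0" for t
    proof -
      have "isCont (\<lambda>t. cpow t s / s) t"
        by (rule has_vector_derivative_continuous[OF cpow_derivative[OF that s0]])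
      moreover have "\<forall>\<^sub>F x in nhds t. f x = cpow x s / s"
      proof -
        have "\<forall>\<^sub>F x in nhds t. x \<in> {0<..}"
          using that by (intro eventually_nhds_in_open) auto
        thus ?thesis by eventually_elim (simp add: f_def)
      qed
      ultimately show ?thesis using isCont_cong[of f "\<lambda>x. cpow x s / s" t] by simp
    qed
    moreover have "(f \<longlongrightarrow> f 0) (at 0 within {0..D})"
    proof -
      have "((\<lambda>t. t powr Re s / norm s) \<longlongrightarrow> 0 / norm s) (at 0 within {0..D})"
      proof (intro tendsto_intros)
        have "((\<lambda>t. t powr Re s) \<longlongrightarrow> 0 powr Re s) (at 0 within {0..D})"
          by (rule tendsto_powr2) (use assms in \<open>auto simp: eventually_at_filter intro!: tendsto_intros\<close>)
        thus "((\<lambda>t. t powr Re s) \<longlongrightarrow> 0) (at 0 within {0..D})" by simp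
      qed (use s0 in auto)
      hence lim: "((\<lambda>t. t powr Re s / norm s) \<longlongrightarrow> 0) (at 0 within {0..D})" by simp
      have "\<forall>\<^sub>F t in at 0 within {0..D}. norm (f t) \<le> t powr Re s / norm s"
        by (auto simp: eventually_at_filter f_def norm_divide norm_cpow)
      hence "(f \<longlongrightarrow> 0) (at 0 within {0..D})" using lim by (rule Lim_null_comparison)
      thus ?thesis by (simp add: f_def)
    qed
    ultimately have "continuous (at t within {0..D}) f" if "t \<in> {0..D}" for t
      using that by (cases "t = 0") (auto simp: continuous_within intro: continuous_at_imp_continuous_at_within[unfolded continuous_within])
    hence "continuous_on {0..D} f" by (simp add: continuous_on_eq_continuous_within)
    thus "continuous_on {a..D} f" by (rule continuous_on_subset) (use assms in auto)
  qed (use assms in auto)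
  hence "integral {a..D} (\<lambda>t. cpow t (s - 1)) = f D - f a" by (rule integral_unique)
  also have "integral {a..D} (\<lambda>t. cpow t (s - 1)) = integral {a<..D} (\<lambda>t. cpow t (s - 1))"
    by (rule integral_spike_set) (auto intro!: negligible_subset[OF negligible_sing[of a]])
  also have "\<dots> = (LINT t:{a<..D}|lborel. cpow t (s - 1))"
    by (rule set_borel_integral_eq_integral(2)[symmetric], rule set_integrable_subset[OF set_integrable_cpow[of s D]])
       (use assms in auto)
  finally show ?thesis using assms by (simp add: f_def)
qed

section \<open>Continuation of Mellin transforms\<close>

text \<open>Powers of \<open>t\<close> increase or decrease with the exponent according to whether
  \<open>t\<close> exceeds 1. The sum of the two extreme powers covers both cases and gives a
  majorant that is uniform over a disc of exponents.\<close>

lemma powr_le_add_powr: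
  fixes t :: real
  assumes "t > 0" "a \<le> b" "b \<le> c"
  shows "t powr b \<le> t powr a + t powr c"
proof (cases "t \<le> 1")
  case True
  hence "t powr b \<le> t powr a" using assms by (intro powr_mono') auto
  thus ?thesis by (simp add: add_increasing2)
next
  case False
  hence "t powr b \<le> t powr c" using assms by (intro powr_mono) auto
  thus ?thesis by (simp add: add_increasing)
qed

text \<open>An abstract form of the situation: \<open>F\<close> is the pair volume, \<beta> lists
  its expansion coefficients, and \<open>N\<close> is the total mass. The remainder bounds are
  required on all of \<open>{0<..D}\<close>, so that no separate treatment of the part away from 0
  is needed in the integrals.\<close>

context
  fixes F :: "real \<Rightarrow> real" and \<beta> :: "nat \<Rightarrow> real" and D N :: real and m :: nat
  assumes D: "D > 0" and Fm: "F \<in> borel_measurable borel"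
    and asym: "\<And>K. \<exists>C. \<forall>t\<in>{0<..D}. \<bar>F t - (\<Sum>i\<le>K. \<beta> i * t ^ i)\<bar> \<le> C * t ^ Suc K"
    and \<beta>0: "\<And>i. i < m \<Longrightarrow> \<beta> i = 0"
begin

definition remainder :: "nat \<Rightarrow> real \<Rightarrow> real" where
  "remainder K t = F t - (\<Sum>i\<le>K. \<beta> i * t ^ i)"

definition remainder_integral :: "nat \<Rightarrow> complex \<Rightarrow> complex" where
  "remainder_integral K z = (LINT t:{0<..D}|lborel. cpow t (z - 1) * of_real (remainder K t))"

text \<open>The monomials up to order \<open>K\<close> are integrated explicitly, which displays the
  poles; the rest converges for \<open>Re z > - real (Suc K)\<close>.\<close>

definition mellin_poly :: "nat \<Rightarrow> complex \<Rightarrow> complex" where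
  "mellin_poly K z = (\<Sum>i\<le>K. of_real (\<beta> i) * (cpow D (z + of_nat i) / (z + of_nat i))) + remainder_integral K z"

lemma measurable_remainder [measurable]: "remainder K \<in> borel_measurable borel"
  unfolding remainder_def[abs_def] using Fm by measurable

lemma norm_remainder_term_le:
  assumes "t \<in> {0<..D}" "\<bar>remainder K t\<bar> \<le> C * t ^ Suc K"
  shows "norm (cpow t (z - 1) * of_real (remainder K t)) \<le> C * t powr ((Re z + real (Suc K)) - 1)"
proof -
  have t: "t > 0" using assms by simp
  have "norm (cpow t (z - 1) * of_real (remainder K t)) \<le> t powr (Re z - 1) * (C * t ^ Suc K)"
    unfolding norm_mult using assms(2) t by (intro mult_mono) (auto simp: norm_cpow)
  also have "\<dots> = C * (t powr (Re z - 1) * t powr real (Suc K))"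
    using t by (simp add: powr_realpow del: power_Suc of_nat_Suc)
  also have "t powr (Re z - 1) * t powr real (Suc K) = t powr ((Re z + real (Suc K)) - 1)"
    by (simp add: powr_add[symmetric] algebra_simps)
  finally show ?thesis .
qed

lemma set_integrable_remainder:
  assumes "Re z > - real (Suc K)"
  shows "set_integrable lborel {0<..D} (\<lambda>t. cpow t (z - 1) * of_real (remainder K t))"
proof -
  obtain C where C: "\<And>t. t \<in> {0<..D} \<Longrightarrow> \<bar>remainder K t\<bar> \<le> C * t ^ Suc K"
    using asym[of K] unfolding remainder_def by blast
  have "set_integrable lborel {0<..D} (\<lambda>t. t powr ((Re z + real (Suc K)) - 1))"
    by (rule integrable_powr_0) (use assms D in auto)
  hence "set_integrable lborel {0<..D} (\<lambda>t. C * t powr ((Re z + real (Suc K)) - 1))" by simp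
  thus ?thesis unfolding set_integrable_def
  proof (rule Bochner_Integration.integrable_bound)
    show "AE t in lborel. norm (indicat_real {0<..D} t *\<^sub>R (cpow t (z - 1) * of_real (remainder K t)))
       \<le> norm (indicat_real {0<..D} t *\<^sub>R (C * t powr (Re z + real (Suc K) - 1)))"
    proof (rule AE_I2)
      fix t show "norm (indicat_real {0<..D} t *\<^sub>R (cpow t (z - 1) * of_real (remainder K t)))
       \<le> norm (indicat_real {0<..D} t *\<^sub>R (C * t powr (Re z + real (Suc K) - 1)))"
        using norm_remainder_term_le[OF _ C, of t z] by (cases "t \<in> {0<..D}") auto
    qed
  qed measurable
qed

lemma holomorphic_remainder_integral: "remainder_integral K holomorphic_on {z. Re z > - real (Suc K)}"
proof -
  obtain C where C: "\<And>t. t \<in> {0<..D} \<Longrightarrow> \<bar>remainder K t\<bar> \<le> C * t ^ Suc K"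
    using asym[of K] unfolding remainder_def by blast
  have C0: "C \<ge> 0"
  proof -
    have "0 \<le> C * D ^ Suc K" using C[of D] D abs_ge_zero[of "remainder K D"] by (metis greaterThanAtMost_iff order_refl order_trans)
    thus ?thesis using zero_less_power[OF D, of "Suc K"] by (simp add: zero_le_mult_iff del: power_Suc)
  qed
  have "(\<lambda>z. \<integral>t. indicator {0<..D} t *\<^sub>R (cpow t (z - 1) * of_real (remainder K t)) \<partial>lborel) holomorphic_on {z. Re z > - real (Suc K)}"
  proof (rule holomorphic_integral_dominated)
    fix z assume z: "z \<in> {z. Re z > - real (Suc K)}"
    \<comment> \<open>Half the distance to the boundary line: on \<open>cball z r\<close> the
      quantity \<open>Re w + real (Suc K)\<close> stays between \<open>r\<close> and
      \<open>3 * r\<close>, which are the exponents in the majorant.\<close>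
    define r where "r = (Re z + real (Suc K)) / 2"
    have r: "r > 0" using z by (simp add: r_def)
    have Rew: "Re z - r \<le> Re w" "Re w \<le> Re z + r" if "w \<in> cball z r" for w
      using that abs_Re_le_cmod[of "z - w"] by (auto simp: dist_norm)
    define g where "g t = indicator {0<..D} t *\<^sub>R (C * (t powr (r - 1) + t powr (3 * r - 1)))" for t
    show "\<exists>r>0. cball z r \<subseteq> {z. - real (Suc K) < Re z} \<and>
       (\<exists>g. integrable lborel g \<and> (\<forall>x\<in>space lborel. \<forall>w\<in>cball z r.
          norm (indicat_real {0<..D} x *\<^sub>R (cpow x (w - 1) * of_real (remainder K x))) \<le> g x))"
    proof (intro exI[of _ r] exI[of _ g] conjI ballI)
      show "cball z r \<subseteq> {z. - real (Suc K) < Re z}"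
      proof
        fix w assume "w \<in> cball z r"
        from Rew(1)[OF this] show "w \<in> {z. - real (Suc K) < Re z}" using z by (simp add: r_def field_simps)
      qed
      have "set_integrable lborel {0<..D} (\<lambda>t. C * (t powr (r - 1) + t powr (3 * r - 1)))"
        by (intro set_integrable_mult_right set_integral_add integrable_powr_0) (use r D in auto)
      thus "integrable lborel g" by (simp add: set_integrable_def g_def[abs_def])
      fix t w assume w: "w \<in> cball z r"
      show "norm (indicat_real {0<..D} t *\<^sub>R (cpow t (w - 1) * of_real (remainder K t))) \<le> g t"
      proof (cases "t \<in> {0<..D}")
        case True
        have "norm (cpow t (w - 1) * of_real (remainder K t)) \<le> C * t powr ((Re w + real (Suc K)) - 1)"
          by (rule norm_remainder_term_le[OF True C[OF True]])
        also have "\<dots> \<le> C * (t powr (r - 1) + t powr (3 * r - 1))"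
        proof (rule mult_left_mono[OF powr_le_add_powr C0])
          show "r - 1 \<le> Re w + real (Suc K) - 1" "Re w + real (Suc K) - 1 \<le> 3 * r - 1"
            using Rew[OF w] by (auto simp: r_def field_simps)
        qed (use True in auto)
        finally show ?thesis using True by (simp add: g_def)
      next
        case False
        thus ?thesis by (simp add: g_def)
      qed
    qed (use r in auto)
  next
    show "(\<lambda>z. indicat_real {0<..D} x *\<^sub>R (cpow x (z - 1) * of_real (remainder K x))) holomorphic_on {z. - real (Suc K) < Re z}" for x
      unfolding scaleR_conv_of_real by (intro holomorphic_intros)
  qed measurable
  thus ?thesis by (simp add: remainder_integral_def[abs_def] set_lebesgue_integral_def)
qed

text \<open>The alternative \<open>\<beta> i = 0\<close> admits \<open>z\<close> for which the
  monomial itself would diverge at 0; in the half plane of convergence this covers all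
  \<open>i < m\<close>.\<close>

lemma has_integral_monomial:
  assumes "Re z + real i > 0 \<or> \<beta> i = 0"
  shows "set_integrable lborel {0<..D} (\<lambda>t. cpow t (z - 1) * of_real (\<beta> i * t ^ i)) \<and>
    (LINT t:{0<..D}|lborel. cpow t (z - 1) * of_real (\<beta> i * t ^ i)) = of_real (\<beta> i) * (cpow D (z + of_nat i) / (z + of_nat i))"
proof (cases "\<beta> i = 0")
  case True
  thus ?thesis by (simp add: set_integrable_def set_lebesgue_integral_def)
next
  case False
  hence pos: "Re (z + of_nat i) > 0" using assms by simp
  have eq: "cpow t (z - 1) * of_real (\<beta> i * t ^ i) = of_real (\<beta> i) * cpow t (z + of_nat i - 1)" if "t \<in> {0<..D}" for t
    using cpow_add[of t "z - 1" "of_nat i"] cpow_of_nat[of t i] that by (simp add: algebra_simps)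
  have 1: "set_integrable lborel {0<..D} (\<lambda>t. of_real (\<beta> i) * cpow t (z + of_nat i - 1))"
    using set_integrable_cpow[OF pos, of D] D by simp
  have "set_integrable lborel {0<..D} (\<lambda>t. cpow t (z - 1) * of_real (\<beta> i * t ^ i))"
    using 1 by (subst set_integrable_cong[OF refl refl eq]) auto
  moreover have "(LINT t:{0<..D}|lborel. cpow t (z - 1) * of_real (\<beta> i * t ^ i)) =
      (LINT t:{0<..D}|lborel. of_real (\<beta> i) * cpow t (z + of_nat i - 1))"
    by (rule set_lebesgue_integral_cong) (use eq in auto)
  ultimately show ?thesis using integral_cpow[OF pos, of 0 D] D by simp
qed

text \<open>The two expressions differ by a single monomial being integrated explicitly, and its
  integral converges precisely because \<open>Re z + real (Suc K) > 0\<close>.\<close>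

lemma mellin_poly_Suc:
  assumes "Re z > - real (Suc K)"
  shows "mellin_poly K z = mellin_poly (Suc K) z"
proof -
  have mono: "set_integrable lborel {0<..D} (\<lambda>t. cpow t (z - 1) * of_real (\<beta> (Suc K) * t ^ Suc K))"
    "(LINT t:{0<..D}|lborel. cpow t (z - 1) * of_real (\<beta> (Suc K) * t ^ Suc K)) =
      of_real (\<beta> (Suc K)) * (cpow D (z + of_nat (Suc K)) / (z + of_nat (Suc K)))"
    using has_integral_monomial[of z "Suc K"] assms by auto
  have "remainder_integral K z = (LINT t:{0<..D}|lborel. cpow t (z - 1) * of_real (remainder (Suc K) t) +
      cpow t (z - 1) * of_real (\<beta> (Suc K) * t ^ Suc K))"
    unfolding remainder_integral_def
    by (intro set_lebesgue_integral_cong) (auto simp: remainder_def algebra_simps)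
  also have "\<dots> = remainder_integral (Suc K) z + of_real (\<beta> (Suc K)) * (cpow D (z + of_nat (Suc K)) / (z + of_nat (Suc K)))"
    unfolding remainder_integral_def mono(2)[symmetric]
    by (rule set_integral_add(2)[OF set_integrable_remainder mono(1)]) (use assms in auto)
  finally show ?thesis by (simp add: mellin_poly_def algebra_simps)
qed

lemma mellin_poly_le:
  assumes "Re z > - real (Suc K)" "K \<le> L"
  shows "mellin_poly K z = mellin_poly L z"
  using assms(2)
proof (induction L rule: dec_induct)
  case (step L)
  thus ?case using mellin_poly_Suc[of L z] assms(1) by simp
qed simp

text \<open>The order depends on \<open>z\<close> and is large enough for the remainder to converge;
  consistency of the truncations makes any other admissible order give the same value. At a pole,
  division by 0 leaves an arbitrary value, which does not affect meromorphy and is normalized at the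
  end.\<close>

definition mellin :: "complex \<Rightarrow> complex" where
  "mellin z = mellin_poly (nat \<lceil>\<bar>Re z\<bar>\<rceil>) z"

lemma mellin_eq:
  assumes "Re z > - real (Suc K)"
  shows "mellin z = mellin_poly K z"
proof -
  define L where "L = nat \<lceil>\<bar>Re z\<bar>\<rceil>"
  have "\<bar>Re z\<bar> \<le> real L" unfolding L_def by (rule real_nat_ceiling_ge)
  hence "Re z > - real (Suc L)" by simp
  hence "mellin_poly L z = mellin_poly (max K L) z" by (rule mellin_poly_le) simp
  moreover have "mellin_poly K z = mellin_poly (max K L) z" using assms by (rule mellin_poly_le) simp
  ultimately show ?thesis by (simp add: mellin_def L_def)
qed

lemma open_Re_half_plane: "open {z. a < Re z}"
  by (rule open_halfspace_Re_gt)

definition mellin_ext :: "complex \<Rightarrow> complex" where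
  "mellin_ext z = cpow D z * of_real N - z * mellin z"

lemma meromorphic_mellin_ext: "mellin_ext meromorphic_on UNIV"
proof -
  have "mellin_ext meromorphic_on {z}" for z
  proof -
    define K where "K = nat \<lceil>\<bar>Re z\<bar>\<rceil>"
    have "\<bar>Re z\<bar> \<le> real K" unfolding K_def by (rule real_nat_ceiling_ge)
    hence z: "z \<in> {z. Re z > - real (Suc K)}" by simp
    have hol: "f analytic_on {z}" if "f holomorphic_on {z. Re z > - real (Suc K)}" for f :: "complex \<Rightarrow> complex"
      using that z open_Re_half_plane analytic_at by blast
    have "(\<lambda>z. cpow D z * of_real N - z * mellin_poly K z) meromorphic_on {z}"
      unfolding mellin_poly_def
      by (intro meromorphic_intros analytic_on_imp_meromorphic_on[OF hol] holomorphic_intros holomorphic_remainder_integral)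
    moreover have "\<forall>\<^sub>F w in at z. mellin_ext w = cpow D w * of_real N - w * mellin_poly K w"
      using eventually_at_in_open'[OF open_Re_half_plane z]
      by eventually_elim (simp add: mellin_ext_def mellin_eq)
    ultimately show ?thesis using meromorphic_on_cong[of "{z}" mellin_ext _ "{z}"] by simp
  qed
  thus ?thesis by (auto simp: meromorphic_on_def)
qed

text \<open>A pole at \<open>- i\<close> with \<open>i < m\<close> is absent because its coefficient
  is 0, and the remaining candidates \<open>- i\<close> with \<open>i \<ge> m\<close> lie outside
  the half plane.\<close>

lemma analytic_mellin_ext:
  assumes "Re z > - real m"
  shows "mellin_ext analytic_on {z}"
proof -
  define K where "K = nat \<lceil>\<bar>Re z\<bar>\<rceil>"
  have K: "\<bar>Re z\<bar> \<le> real K" unfolding K_def by (rule real_nat_ceiling_ge)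
  define S where "S = {z. Re z > - real (Suc K)} \<inter> {z. Re z > - real m}"
  have S: "open S" "z \<in> S" using K assms unfolding S_def by (auto intro!: open_Int open_Re_half_plane)
  have "(\<lambda>w. of_real (\<beta> i) * (cpow D (w + of_nat i) / (w + of_nat i))) holomorphic_on S" for i
  proof (cases "i < m")
    case True
    thus ?thesis by (simp add: \<beta>0)
  next
    case False
    have "w + of_nat i \<noteq> 0" if "w \<in> S" for w
    proof
      assume "w + of_nat i = 0"
      hence "Re (w + of_nat i) = 0" by simp
      thus False using that False by (simp add: S_def)
    qed
    thus ?thesis by (intro holomorphic_intros) auto
  qed
  moreover have "remainder_integral K holomorphic_on S"
    using holomorphic_remainder_integral by (rule holomorphic_on_subset) (auto simp: S_def)
  ultimately have "mellin_poly K holomorphic_on S"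
    unfolding mellin_poly_def[abs_def] by (intro holomorphic_on_add holomorphic_on_sum)
  hence "(\<lambda>w. cpow D w * of_real N - w * mellin_poly K w) holomorphic_on S"
    by (intro holomorphic_intros)
  hence "mellin_ext holomorphic_on S"
    by (rule holomorphic_transform) (auto simp: mellin_ext_def mellin_eq S_def)
  thus ?thesis using S analytic_at by blast
qed

lemma mellin_ext_integral:
  assumes "Re z > - real m"
  shows "set_integrable lborel {0<..D} (\<lambda>t. cpow t (z - 1) * of_real (F t))"
    "mellin_ext z = cpow D z * of_real N - z * (LINT t:{0<..D}|lborel. cpow t (z - 1) * of_real (F t))"
proof -
  define K where "K = nat \<lceil>\<bar>Re z\<bar>\<rceil>"
  have "\<bar>Re z\<bar> \<le> real K" unfolding K_def by (rule real_nat_ceiling_ge)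
  hence K: "Re z > - real (Suc K)" by simp
  have mono: "Re z + real i > 0 \<or> \<beta> i = 0" for i using assms \<beta>0[of i] by (cases "i < m") auto
  have eq: "cpow t (z - 1) * of_real (F t) =
      (\<Sum>i\<le>K. cpow t (z - 1) * of_real (\<beta> i * t ^ i)) + cpow t (z - 1) * of_real (remainder K t)" for t
  proof -
    have "of_real (F t) = (\<Sum>i\<le>K. complex_of_real (\<beta> i * t ^ i)) + of_real (remainder K t)"
      by (simp add: remainder_def)
    thus ?thesis by (simp only: distrib_left sum_distrib_left)
  qed
  have int: "set_integrable lborel {0<..D} (\<lambda>t. \<Sum>i\<le>K. cpow t (z - 1) * of_real (\<beta> i * t ^ i))"
    unfolding set_integrable_def scaleR_sum_right
    using has_integral_monomial[OF mono] by (intro Bochner_Integration.integrable_sum) (simp add: set_integrable_def)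
  show "set_integrable lborel {0<..D} (\<lambda>t. cpow t (z - 1) * of_real (F t))"
    unfolding eq by (rule set_integral_add(1)[OF int set_integrable_remainder[OF K]])
  have "(LINT t:{0<..D}|lborel. \<Sum>i\<le>K. cpow t (z - 1) * of_real (\<beta> i * t ^ i)) =
      (\<Sum>i\<le>K. LINT t:{0<..D}|lborel. cpow t (z - 1) * of_real (\<beta> i * t ^ i))"
    unfolding set_lebesgue_integral_def scaleR_sum_right
    using has_integral_monomial[OF mono] by (intro Bochner_Integration.integral_sum) (simp add: set_integrable_def)
  also have "\<dots> = (\<Sum>i\<le>K. of_real (\<beta> i) * (cpow D (z + of_nat i) / (z + of_nat i)))"
    using has_integral_monomial[OF mono] by simp
  finally have "(LINT t:{0<..D}|lborel. cpow t (z - 1) * of_real (F t)) = mellin_poly K z"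
    unfolding eq mellin_poly_def remainder_integral_def
    by (subst set_integral_add(2)[OF int set_integrable_remainder[OF K]]) simp
  thus "mellin_ext z = cpow D z * of_real N - z * (LINT t:{0<..D}|lborel. cpow t (z - 1) * of_real (F t))"
    using K by (simp add: mellin_ext_def mellin_eq)
qed

text \<open>On the strip with real part between \<open>- real (Suc k)\<close> and
  \<open>1 - real k\<close> the truncation of order \<open>k\<close> is valid, and the terms of
  index below \<open>k\<close> have their poles at or to the right of its right edge. Only the term
  of index \<open>k\<close> can be singular.\<close>

lemma mellin_ext_singular_part:
  obtains S h where "open S" "- of_nat k \<in> S" "h holomorphic_on S"
    "\<And>z. z \<in> S \<Longrightarrow> mellin_ext z = h z - z * (of_real (\<beta> k) * (cpow D (z + of_nat k) / (z + of_nat k)))"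
proof -
  define S where "S = {z. Re z > - real (Suc k)} \<inter> {z. Re z < 1 - real k}"
  define h where "h z = cpow D z * of_real N - z * ((\<Sum>i<k. of_real (\<beta> i) * (cpow D (z + of_nat i) / (z + of_nat i))) +
    remainder_integral k z)" for z
  have S: "open S" "- of_nat k \<in> S"
    unfolding S_def by (auto intro!: open_Int open_halfspace_Re_lt open_Re_half_plane)
  have "(\<lambda>w. of_real (\<beta> i) * (cpow D (w + of_nat i) / (w + of_nat i))) holomorphic_on S" if "i < k" for i
  proof -
    have "w + of_nat i \<noteq> 0" if "w \<in> S" for w
    proof
      assume "w + of_nat i = 0"
      hence "Re (w + of_nat i) = 0" by simp
      moreover have "real i + 1 \<le> real k" using \<open>i < k\<close> by linarith
      ultimately show False using that by (simp add: S_def)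
    qed
    thus ?thesis by (intro holomorphic_intros) auto
  qed
  moreover have "remainder_integral k holomorphic_on S"
    using holomorphic_remainder_integral by (rule holomorphic_on_subset) (auto simp: S_def)
  ultimately have "(\<lambda>w. (\<Sum>i<k. of_real (\<beta> i) * (cpow D (w + of_nat i) / (w + of_nat i))) + remainder_integral k w) holomorphic_on S"
    by (intro holomorphic_on_add holomorphic_on_sum) auto
  hence h: "h holomorphic_on S"
    unfolding h_def[abs_def]
    by (intro holomorphic_on_diff[OF _ holomorphic_on_mult[OF holomorphic_on_ident]]) (auto intro!: holomorphic_intros)
  show ?thesis
  proof (rule that[OF S h])
    fix z assume "z \<in> S"
    hence "mellin_ext z = cpow D z * of_real N - z * mellin_poly k z"
      by (simp add: mellin_ext_def mellin_eq S_def)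
    thus "mellin_ext z = h z - z * (of_real (\<beta> k) * (cpow D (z + of_nat k) / (z + of_nat k)))"
      by (simp add: h_def mellin_poly_def lessThan_Suc_atMost[symmetric] algebra_simps)
  qed
qed

text \<open>At \<open>z = - k\<close> the prefactor \<open>- z\<close> becomes \<open>k\<close> and
  \<open>cpow D 0\<close> is 1, so \<open>D\<close> drops out of the residue. For
  \<open>k = 0\<close> the prefactor cancels the pole, in accordance with the value 0.\<close>

lemma residue_mellin_ext: "residue mellin_ext (- of_nat k) = of_real (real k * \<beta> k)"
proof -
  obtain S h where S: "open S" "- of_nat k \<in> S" "h holomorphic_on S"
    "\<And>z. z \<in> S \<Longrightarrow> mellin_ext z = h z - z * (of_real (\<beta> k) * (cpow D (z + of_nat k) / (z + of_nat k)))"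
    by (rule mellin_ext_singular_part[of k]) blast
  define g where "g z = (z + of_nat k) * h z - z * (of_real (\<beta> k) * cpow D (z + of_nat k))" for z
  have "\<forall>\<^sub>F z in at (- of_nat k). mellin_ext z = g z / (z - (- of_nat k))"
    using eventually_at_in_open[OF S(1,2)]
  proof eventually_elim
    case (elim z)
    hence "z + of_nat k \<noteq> 0" by (auto simp: add_eq_0_iff2)
    thus ?case using S(4)[of z] elim by (simp add: g_def field_simps)
  qed
  hence "residue mellin_ext (- of_nat k) = residue (\<lambda>z. g z / (z - (- of_nat k))) (- of_nat k)"
    by (rule residue_cong) simp
  also have "\<dots> = g (- of_nat k)"
    by (rule residue_simple[OF S(1,2)]) (auto simp: g_def[abs_def] intro!: holomorphic_intros S(3))
  also have "\<dots> = of_real (real k * \<beta> k)" by (simp add: g_def cpow_def)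
  finally show ?thesis .
qed

lemma not_is_pole_mellin_ext:
  assumes "\<beta> k = 0"
  shows "\<not> is_pole mellin_ext (- of_nat k)"
proof -
  obtain S h where S: "open S" "- of_nat k \<in> S" "h holomorphic_on S"
    "\<And>z. z \<in> S \<Longrightarrow> mellin_ext z = h z - z * (of_real (\<beta> k) * (cpow D (z + of_nat k) / (z + of_nat k)))"
    by (rule mellin_ext_singular_part[of k]) blast
  have "mellin_ext holomorphic_on S"
    using S(3) by (rule holomorphic_transform) (simp add: S(4) assms)
  thus ?thesis using not_is_pole_holomorphic[OF S(1,2)] by blast
qed

end

lemma mellin_continuation:
  fixes F :: "real \<Rightarrow> real" and \<beta> :: "nat \<Rightarrow> real"
  assumes "D > 0" "F \<in> borel_measurable borel"
    "\<And>K. \<exists>C. \<forall>t\<in>{0<..D}. \<bar>F t - (\<Sum>i\<le>K. \<beta> i * t ^ i)\<bar> \<le> C * t ^ Suc K"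
    "\<And>i. i < m \<Longrightarrow> \<beta> i = 0"
  shows "\<exists>B. B meromorphic_on UNIV \<and>
    (\<forall>z. Re z > - real m \<longrightarrow> B analytic_on {z} \<and> set_integrable lborel {0<..D} (\<lambda>t. cpow t (z - 1) * of_real (F t)) \<and>
       B z = cpow D z * of_real N - z * (LINT t:{0<..D}|lborel. cpow t (z - 1) * of_real (F t))) \<and>
    (\<forall>k. residue B (- of_nat k) = of_real (real k * \<beta> k)) \<and>
    (\<forall>k. \<beta> k = 0 \<longrightarrow> \<not> is_pole B (- of_nat k))"
  using meromorphic_mellin_ext[where N = N, OF assms] analytic_mellin_ext[where N = N, OF assms]
    mellin_ext_integral(1)[OF assms] mellin_ext_integral(2)[where N = N, OF assms] residue_mellin_ext[where N = N, OF assms] not_is_pole_mellin_ext[where N = N, OF assms]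
  by (intro exI[of _ "mellin_ext F \<beta> D N"]) blast

section \<open>The beta function\<close>

lemma integral_cpow_Icc:
  assumes "0 < a" "a \<le> D"
  shows "(\<integral>t. indicator {a..D} t *\<^sub>R (z * cpow t (z - 1)) \<partial>lborel) = cpow D z - cpow a z"
proof (cases "z = 0")
  case True
  thus ?thesis by (simp add: cpow_def)
next
  case False
  have der: "((\<lambda>t. cpow t z) has_vector_derivative z * cpow t (z - 1)) (at t)" if "t > 0" for t
  proof -
    have "((\<lambda>t. z * (cpow t z / z)) has_vector_derivative z * cpow t (z - 1)) (at t)"
      by (rule has_vector_derivative_mult_right[OF cpow_derivative[OF that False]])
    thus ?thesis using False by simp
  qed
  show ?thesis
  proof (rule integral_FTC_Icc[OF assms(2)])
    show "((\<lambda>t. cpow t z) has_vector_derivative z * cpow t (z - 1)) (at t within {a..D})" if "a \<le> t" "t \<le> D" for t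
      by (rule has_vector_derivative_at_within[OF der]) (use that assms in auto)
    show "continuous_on {a..D} (\<lambda>t. z * cpow t (z - 1))"
      unfolding cpow_def by (intro continuous_intros) (use assms in auto)
  qed
qed

text \<open>The layer cake formula: \<open>s\<close> to the power \<open>z\<close> is written as an integral over \<open>[s, D]\<close>, which
  converges for all \<open>z\<close>.\<close>
lemma integral_powr_layer_cake:
  fixes s :: "'b \<Rightarrow> real" and Q :: "'b measure"
  assumes fin: "finite_measure Q" and D: "D > 0" and sm [measurable]: "s \<in> borel_measurable Q"
    and s: "\<And>w. w \<in> space Q \<Longrightarrow> 0 \<le> s w \<and> s w \<le> D"
    and zero: "(AE w in Q. s w > 0) \<or> Re z > 0"
  defines "F \<equiv> \<lambda>t. measure Q {w \<in> space Q. s w \<le> t}"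
  assumes int: "set_integrable lborel {0<..D} (\<lambda>t. cpow t (z - 1) * of_real (F t))"
  shows "(\<integral>w. complex_of_real (s w) powr z \<partial>Q) =
    cpow D z * of_real (measure Q (space Q)) - z * (LINT t:{0<..D}|lborel. cpow t (z - 1) * of_real (F t))"
proof -
  interpret Q: finite_measure Q by fact
  interpret P: pair_sigma_finite lborel Q ..
  \<comment> \<open>The integrand lives on \<open>s w \<le> t \<le> D\<close>. Writing the lower
    limit as an indicator of \<open>t - s w\<close> keeps it visibly jointly measurable.\<close>
  define f where "f t w = (indicator {0<..D} t * indicator {0..} (t - s w)) *\<^sub>R (z * cpow t (z - 1))" for t w
  have fm [measurable]: "(\<lambda>(t, w). f t w) \<in> borel_measurable (lborel \<Otimes>\<^sub>M Q)"
    unfolding f_def by measurable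
  have ind: "(\<integral>w. indicat_real {0..} (t - s w) \<partial>Q) = F t" for t :: real
  proof -
    have "(\<integral>w. indicat_real {0..} (t - s w) \<partial>Q) = (\<integral>w. indicator {w \<in> space Q. s w \<le> t} w \<partial>Q)"
      by (rule Bochner_Integration.integral_cong) (auto split: split_indicator)
    thus ?thesis by (simp add: F_def)
  qed
  have indint: "integrable Q (\<lambda>w. indicator {0..} (t - s w) :: real)" for t
    by (rule Q.integrable_const_bound[of _ 1]) auto
  have inner: "(\<integral>w. f t w \<partial>Q) = z * (indicator {0<..D} t *\<^sub>R (cpow t (z - 1) * of_real (F t)))" for t
  proof -
    have "(\<integral>w. f t w \<partial>Q) = (\<integral>w. indicator {0..} (t - s w) *\<^sub>R (indicator {0<..D} t *\<^sub>R (z * cpow t (z - 1))) \<partial>Q)"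
      by (simp add: f_def mult.commute)
    also have "\<dots> = (\<integral>w. indicator {0..} (t - s w) \<partial>Q) *\<^sub>R (indicator {0<..D} t *\<^sub>R (z * cpow t (z - 1)))"
      by (rule integral_scaleR_left[OF indint])
    finally show ?thesis unfolding ind by (simp add: scaleR_conv_of_real mult_ac)
  qed
  have "integrable (lborel \<Otimes>\<^sub>M Q) (\<lambda>(t, w). f t w)"
  proof (rule P.Fubini_integrable[OF fm])
    \<comment> \<open>Integrating out \<open>w\<close> replaces the indicator by \<open>F t\<close>,
      so absolute convergence of the double integral is the assumed integrability of the Mellin
      integrand.\<close>
    have "(\<integral>w. norm (f t w) \<partial>Q) = norm (z * (indicator {0<..D} t *\<^sub>R (cpow t (z - 1) * of_real (F t))))" for t
    proof -
      have "(\<integral>w. norm (f t w) \<partial>Q) = (\<integral>w. indicator {0..} (t - s w) *\<^sub>R (norm (indicator {0<..D} t *\<^sub>R (z * cpow t (z - 1)))) \<partial>Q)"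
        by (simp add: f_def mult_ac)
      also have "\<dots> = (\<integral>w. indicator {0..} (t - s w) \<partial>Q) *\<^sub>R norm (indicator {0<..D} t *\<^sub>R (z * cpow t (z - 1)))"
        by (rule integral_scaleR_left[OF indint])
      finally show ?thesis unfolding ind by (simp add: norm_mult F_def mult_ac)
    qed
    moreover have "integrable lborel (\<lambda>t. norm (z * (indicator {0<..D} t *\<^sub>R (cpow t (z - 1) * of_real (F t)))))"
      using int unfolding set_integrable_def by (intro integrable_norm integrable_mult_right)
    ultimately show "integrable lborel (\<lambda>t. \<integral>w. norm (case (t, w) of (t, w) \<Rightarrow> f t w) \<partial>Q)" by simp
    show "AE t in lborel. integrable Q (\<lambda>w. case (t, w) of (t, w) \<Rightarrow> f t w)"
    proof (rule AE_I2)
      fix t :: real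
      have "integrable Q (\<lambda>w. indicator {0..} (t - s w) *\<^sub>R (indicator {0<..D} t *\<^sub>R (z * cpow t (z - 1))))"
        by (rule integrable_scaleR_left[OF indint])
      thus "integrable Q (\<lambda>w. case (t, w) of (t, w) \<Rightarrow> f t w)" by (simp add: f_def mult.commute)
    qed
  qed
  note fint = this
  have eq1: "(\<integral>w. (\<integral>t. f t w \<partial>lborel) \<partial>Q) = z * (LINT t:{0<..D}|lborel. cpow t (z - 1) * of_real (F t))"
  proof -
    have "(\<integral>w. (\<integral>t. f t w \<partial>lborel) \<partial>Q) = (\<integral>t. (\<integral>w. f t w \<partial>Q) \<partial>lborel)"
      using P.Fubini_integral[OF fint] by simp
    thus ?thesis unfolding inner set_lebesgue_integral_def by (simp only: integral_mult_right_zero)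
  qed
  have iint: "integrable Q (\<lambda>w. \<integral>t. f t w \<partial>lborel)"
    using P.integrable_snd[OF fint] by simp
  have val: "(\<integral>t. f t w \<partial>lborel) = cpow D z - complex_of_real (s w) powr z" if w: "w \<in> space Q" and pos: "s w > 0 \<or> Re z > 0" for w
  proof (cases "s w > 0")
    case True
    have "(\<integral>t. f t w \<partial>lborel) = (\<integral>t. indicator {s w..D} t *\<^sub>R (z * cpow t (z - 1)) \<partial>lborel)"
      unfolding f_def using True by (intro Bochner_Integration.integral_cong) (auto split: split_indicator)
    also have "\<dots> = cpow D z - cpow (s w) z" by (rule integral_cpow_Icc) (use True s[OF w] in auto)
    finally show ?thesis using True by (simp add: powr_eq_cpow)
  next
    case False
    \<comment> \<open>Here \<open>0 powr z = 0\<close>, and the integral over the whole interval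
      must equal \<open>cpow D z\<close>, which is true when \<open>Re z > 0\<close>. The assumption
      \<open>zero\<close> lets this case occur on a null set otherwise.\<close>
    hence s0: "s w = 0" and z: "Re z > 0" using s[OF w] pos by auto
    have "(\<integral>t. f t w \<partial>lborel) = (\<integral>t. z * (indicator {0<..D} t *\<^sub>R cpow t (z - 1)) \<partial>lborel)"
      unfolding f_def using s0 by (intro Bochner_Integration.integral_cong) (auto split: split_indicator)
    also have "\<dots> = z * (LINT t:{0<..D}|lborel. cpow t (z - 1))"
      unfolding set_lebesgue_integral_def by (rule integral_mult_right_zero)
    also have "\<dots> = cpow D z" using integral_cpow[OF z, of 0 D] D z by auto
    finally show ?thesis using s0 by simp
  qed
  have AEpos: "AE w in Q. s w > 0 \<or> Re z > 0" using zero by auto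
  have pm: "(\<lambda>w. complex_of_real (s w) powr z) \<in> borel_measurable Q"
  proof (subst measurable_cong)
    show "complex_of_real (s w) powr z = (if s w = 0 then 0 else cpow (s w) z)" if "w \<in> space Q" for w
      using s[OF that] by (auto simp: powr_eq_cpow)
    show "(\<lambda>w. if s w = 0 then 0 else cpow (s w) z) \<in> borel_measurable Q" by measurable
  qed
  have "(\<integral>w. complex_of_real (s w) powr z \<partial>Q) = (\<integral>w. cpow D z - (\<integral>t. f t w \<partial>lborel) \<partial>Q)"
  proof (rule integral_cong_AE[OF pm])
    show "(\<lambda>w. cpow D z - (\<integral>t. f t w \<partial>lborel)) \<in> borel_measurable Q"
      using borel_measurable_integrable[OF iint] by measurable
    show "AE w in Q. complex_of_real (s w) powr z = cpow D z - (\<integral>t. f t w \<partial>lborel)"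
      using AEpos AE_space by eventually_elim (simp add: val)
  qed
  also have "\<dots> = cpow D z * of_real (measure Q (space Q)) - (\<integral>w. (\<integral>t. f t w \<partial>lborel) \<partial>Q)"
    by (subst Bochner_Integration.integral_diff[OF _ iint]) (simp_all add: scaleR_conv_of_real mult.commute)
  finally show ?thesis unfolding eq1 .
qed

text \<open>By the identity theorem the difference, with its removable singularities filled,
  vanishes everywhere, so the functions agree in a punctured neighbourhood of each point. They then
  have the same poles and limits, and the normalization fixes the values at the points
  themselves.\<close>

lemma nicely_meromorphic_eqI:
  assumes f: "f nicely_meromorphic_on UNIV" and g: "g nicely_meromorphic_on UNIV"
    and U: "open U" "a \<in> U" and eq: "\<And>z. z \<in> U \<Longrightarrow> f z = g z"
  shows "f = g"
proof
  fix z
  define h where "h z = f z - g z" for z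
  have hm: "h meromorphic_on UNIV"
    using f g unfolding h_def nicely_meromorphic_on_def by (intro meromorphic_on_diff) auto
  have "remove_sings h w = 0" if "w \<in> U" for w
  proof (rule remove_sings_eqI)
    have "\<forall>\<^sub>F x in at w. h x = 0"
      using eventually_at_in_open'[OF U(1) that] by eventually_elim (simp add: h_def eq)
    thus "h \<midarrow>w\<rightarrow> 0" by (rule tendsto_eventually)
  qed
  hence "\<forall>\<^sub>F w in at a. remove_sings h w = 0"
    using eventually_at_in_open'[OF U] by (auto elim: eventually_mono)
  hence "\<exists>\<^sub>F w in at a. remove_sings h w = 0" by (intro eventually_frequently) auto
  from frequently_eq_meromorphic_imp_constant[OF this remove_sings_nicely_meromorphic[OF hm]]
  have rs: "remove_sings h w = 0" for w by auto
  have "isolated_singularity_at h z"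
    using hm by (intro meromorphic_on_isolated_singularity) (rule meromorphic_on_subset, auto)
  from eventually_remove_sings_eq_at[OF this]
  have ev: "\<forall>\<^sub>F w in at z. f w = g w" by eventually_elim (simp add: rs h_def)
  have pole: "is_pole f z \<longleftrightarrow> is_pole g z" by (rule is_pole_cong[OF ev refl])
  have lim: "f \<midarrow>z\<rightarrow> c \<longleftrightarrow> g \<midarrow>z\<rightarrow> c" for c by (rule tendsto_cong[OF ev])
  have fz: "is_pole f z \<and> f z = 0 \<or> f \<midarrow>z\<rightarrow> f z" and gz: "is_pole g z \<and> g z = 0 \<or> g \<midarrow>z\<rightarrow> g z"
    using f g by (auto simp: nicely_meromorphic_on_def)
  show "f z = g z"
  proof (cases "is_pole f z")
    case True
    have "\<not> f \<midarrow>z\<rightarrow> c" for c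
      using True not_tendsto_and_filterlim_at_infinity[of "at z" f c] by (auto simp: is_pole_def)
    thus ?thesis using True fz gz pole lim by auto
  next
    case False
    thus ?thesis using fz gz pole lim LIM_unique by metis
  qed
qed

context
  fixes m :: nat and M :: "'a::euclidean_space set"
  assumes M: "closed_submanifold m M"
begin

abbreviation (input) "vol \<equiv> riemannian_volume m M"

definition pair_volume :: "real \<Rightarrow> real" where
  "pair_volume t = (\<integral>x. ball_volume m M x t \<partial>vol)"

definition mean_coeff :: "nat \<Rightarrow> real" where
  "mean_coeff k = (\<integral>x. ball_coeff m M k x \<partial>vol)"

section \<open>Measurability of ball volumes and the volume of pairs\<close>

lemma finite_vol: "finite_measure vol"
  by (rule finite_measure_riemannian_volume[OF M])

lemma measurable_ident_vol [measurable]: "(\<lambda>x. x) \<in> vol \<rightarrow>\<^sub>M borel"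
proof -
  have "(\<lambda>x. x) \<in> restrict_space borel M \<rightarrow>\<^sub>M borel" by (intro measurable_restrict_space1) simp
  thus ?thesis using measurable_cong_sets[OF sets_riemannian_volume[OF M] refl] by blast
qed

lemma measurable_dist_vol [measurable]: "(\<lambda>w. norm (fst w - snd w)) \<in> borel_measurable (vol \<Otimes>\<^sub>M vol)"
proof -
  have [measurable]: "fst \<in> vol \<Otimes>\<^sub>M vol \<rightarrow>\<^sub>M borel" "snd \<in> vol \<Otimes>\<^sub>M vol \<rightarrow>\<^sub>M borel"
    using measurable_compose[OF measurable_fst measurable_ident_vol]
      measurable_compose[OF measurable_snd measurable_ident_vol] by auto
  show ?thesis by measurable
qed

lemma ball_volume_slice:
  assumes "x \<in> M"
  shows "ball_volume m M x t = measure vol (Pair x -` {w \<in> space (vol \<Otimes>\<^sub>M vol). norm (fst w - snd w) \<le> t})"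
proof -
  have "Pair x -` {w \<in> space (vol \<Otimes>\<^sub>M vol). norm (fst w - snd w) \<le> t} = M \<inter> cball x t"
    using assms by (auto simp: space_pair_measure space_riemannian_volume[OF M] dist_norm)
  thus ?thesis by (simp add: ball_volume_def)
qed

lemma measurable_ball_volume [measurable]: "(\<lambda>x. ball_volume m M x t) \<in> borel_measurable vol"
proof (subst measurable_cong)
  interpret finite_measure vol by (rule finite_vol)
  let ?A = "{w \<in> space (vol \<Otimes>\<^sub>M vol). norm (fst w - snd w) \<le> t}"
  show "ball_volume m M x t = measure vol (Pair x -` ?A)" if "x \<in> space vol" for x
    using that by (simp add: ball_volume_slice space_riemannian_volume[OF M])
  have "?A \<in> sets (vol \<Otimes>\<^sub>M vol)" by measurable
  thus "(\<lambda>x. measure vol (Pair x -` ?A)) \<in> borel_measurable vol"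
    unfolding measure_def by (intro borel_measurable_enn2real measurable_emeasure_Pair)
qed

lemma ball_volume_bounds: "0 \<le> ball_volume m M x t" "ball_volume m M x t \<le> measure vol (space vol)"
proof -
  interpret finite_measure vol by (rule finite_vol)
  show "0 \<le> ball_volume m M x t" by (simp add: ball_volume_def)
  show "ball_volume m M x t \<le> measure vol (space vol)" unfolding ball_volume_def by (rule bounded_measure)
qed

lemma integrable_ball_volume: "integrable vol (\<lambda>x. ball_volume m M x t)"
proof -
  interpret finite_measure vol by (rule finite_vol)
  show ?thesis using ball_volume_bounds by (intro integrable_const_bound[of _ "measure vol (space vol)"]) auto
qed

lemma pair_volume_eq: "pair_volume t = measure (vol \<Otimes>\<^sub>M vol) {w \<in> space (vol \<Otimes>\<^sub>M vol). norm (fst w - snd w) \<le> t}"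
proof -
  interpret finite_measure vol by (rule finite_vol)
  let ?A = "{w \<in> space (vol \<Otimes>\<^sub>M vol). norm (fst w - snd w) \<le> t}"
  have A: "?A \<in> sets (vol \<Otimes>\<^sub>M vol)" by measurable
  have "emeasure (vol \<Otimes>\<^sub>M vol) ?A = (\<integral>\<^sup>+x. emeasure vol (Pair x -` ?A) \<partial>vol)"
    by (rule emeasure_pair_measure_alt[OF A])
  also have "\<dots> = (\<integral>\<^sup>+x. ennreal (ball_volume m M x t) \<partial>vol)"
    by (intro nn_integral_cong) (simp add: ball_volume_slice space_riemannian_volume[OF M] emeasure_eq_measure)
  also have "\<dots> = ennreal (pair_volume t)"
    unfolding pair_volume_def
    by (rule nn_integral_eq_integral[OF integrable_ball_volume]) (simp add: ball_volume_bounds)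
  finally show ?thesis using ball_volume_bounds by (simp add: measure_def pair_volume_def)
qed

section \<open>Taylor coefficients and their means over the submanifold\<close>

lemma ball_coeff_taylor:
  "\<exists>\<delta>>0. \<exists>C. (\<forall>x\<in>M. \<forall>t\<in>{0..\<delta>}. \<bar>ball_volume m M x t - (\<Sum>i\<le>K. ball_coeff m M i x * t ^ i)\<bar> \<le> C * t ^ Suc K) \<and>
     (\<forall>x\<in>M. \<forall>i\<le>K. \<bar>ball_coeff m M i x\<bar> \<le> C)"
proof -
  obtain \<delta> where d: "\<delta> > 0" "unif_Ck (Suc K) M \<delta> (ball_volume m M)"
    using ball_volume_unif_Ck[OF M, of "Suc K"] by blast
  show ?thesis using unif_Ck_taylor[OF d(2,1)] d(1) unfolding ball_coeff_def[symmetric] by blast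
qed

text \<open>The uniform families carry no information on the dependence on \<open>x\<close>. The
  coefficient of order \<open>k\<close> is the limit of the ball volume minus its lower terms,
  divided by \<open>t ^ k\<close>, along a sequence of radii tending to 0; the lower coefficients
  are measurable by induction.\<close>

lemma measurable_ball_coeff [measurable]: "ball_coeff m M k \<in> borel_measurable vol"
proof (induction k rule: less_induct)
  case (less k)
  obtain \<delta> C where d: "\<delta> > 0" and C: "\<And>x t. x \<in> M \<Longrightarrow> t \<in> {0..\<delta>} \<Longrightarrow>
      \<bar>ball_volume m M x t - (\<Sum>i\<le>k. ball_coeff m M i x * t ^ i)\<bar> \<le> C * t ^ Suc k"
    using ball_coeff_taylor[of k] by blast
  define T where "T n = \<delta> / real (Suc n)" for n
  have T: "T n > 0" "T n \<le> \<delta>" for n using d by (auto simp: T_def field_simps)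
  have Tl: "T \<longlonglongrightarrow> 0" unfolding T_def by (intro LIMSEQ_Suc lim_const_over_n)
  show ?case
  proof (rule borel_measurable_LIMSEQ_real)
    fix x assume "x \<in> space vol"
    hence x: "x \<in> M" by (simp add: space_riemannian_volume[OF M])
    show "(\<lambda>n. (ball_volume m M x (T n) - (\<Sum>i<k. ball_coeff m M i x * T n ^ i)) / T n ^ k) \<longlonglongrightarrow> ball_coeff m M k x"
    proof (rule Lim_transform_bound[of _ "\<lambda>n. C * T n", THEN LIM_zero_cancel])
      show "\<forall>\<^sub>F n in sequentially. norm ((ball_volume m M x (T n) - (\<Sum>i<k. ball_coeff m M i x * T n ^ i)) / T n ^ k - ball_coeff m M k x)
         \<le> norm (C * T n)"
      proof (intro always_eventually allI)
        fix n
        have "(ball_volume m M x (T n) - (\<Sum>i<k. ball_coeff m M i x * T n ^ i)) / T n ^ k - ball_coeff m M k x =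
           (ball_volume m M x (T n) - (\<Sum>i\<le>k. ball_coeff m M i x * T n ^ i)) / T n ^ k"
          using T(1)[of n] by (simp add: lessThan_Suc_atMost[symmetric] field_simps)
        also have "norm \<dots> = \<bar>ball_volume m M x (T n) - (\<Sum>i\<le>k. ball_coeff m M i x * T n ^ i)\<bar> / T n ^ k"
          using T(1)[of n] by (simp add: abs_divide)
        also have "\<dots> \<le> C * T n ^ Suc k / T n ^ k"
          by (rule divide_right_mono[OF C[OF x]]) (use T[of n] in auto)
        also have "\<dots> = C * T n" using T(1)[of n] by simp
        finally show "norm ((ball_volume m M x (T n) - (\<Sum>i<k. ball_coeff m M i x * T n ^ i)) / T n ^ k - ball_coeff m M k x)
         \<le> norm (C * T n)" by simp
      qed
      show "(\<lambda>n. C * T n) \<longlonglongrightarrow> 0" using tendsto_mult_left[OF Tl, of C] by simp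
    qed
  next
    fix n
    have [measurable]: "ball_coeff m M i \<in> borel_measurable vol" if "i < k" for i using less that by blast
    have "(\<lambda>x. \<Sum>i<k. ball_coeff m M i x * T n ^ i) \<in> borel_measurable vol"
      by (intro borel_measurable_sum borel_measurable_times) auto
    thus "(\<lambda>x. (ball_volume m M x (T n) - (\<Sum>i<k. ball_coeff m M i x * T n ^ i)) / T n ^ k) \<in> borel_measurable vol"
      by measurable
  qed
qed

lemma integrable_ball_coeff: "integrable vol (ball_coeff m M k)"
proof -
  interpret finite_measure vol by (rule finite_vol)
  obtain C where "\<And>x. x \<in> M \<Longrightarrow> \<bar>ball_coeff m M k x\<bar> \<le> C" using ball_coeff_taylor[of k] by blast
  thus ?thesis by (intro integrable_const_bound[of _ C] AE_I2) (auto simp: space_riemannian_volume[OF M])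
qed

lemma pair_volume_taylor:
  "\<exists>\<delta>>0. \<exists>C. \<forall>t\<in>{0..\<delta>}. \<bar>pair_volume t - (\<Sum>i\<le>K. mean_coeff i * t ^ i)\<bar> \<le> C * t ^ Suc K"
proof -
  interpret finite_measure vol by (rule finite_vol)
  obtain \<delta> C where d: "\<delta> > 0" and C: "\<And>x t. x \<in> M \<Longrightarrow> t \<in> {0..\<delta>} \<Longrightarrow>
      \<bar>ball_volume m M x t - (\<Sum>i\<le>K. ball_coeff m M i x * t ^ i)\<bar> \<le> C * t ^ Suc K"
    using ball_coeff_taylor[of K] by blast
  have "\<bar>pair_volume t - (\<Sum>i\<le>K. mean_coeff i * t ^ i)\<bar> \<le> (C * measure vol (space vol)) * t ^ Suc K" if t: "t \<in> {0..\<delta>}" for t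
  proof -
    have int: "integrable vol (\<lambda>x. \<Sum>i\<le>K. ball_coeff m M i x * t ^ i)"
      using integrable_ball_coeff by (intro Bochner_Integration.integrable_sum integrable_mult_left) auto
    have "(\<Sum>i\<le>K. mean_coeff i * t ^ i) = (\<integral>x. (\<Sum>i\<le>K. ball_coeff m M i x * t ^ i) \<partial>vol)"
      unfolding mean_coeff_def using integrable_ball_coeff by (subst Bochner_Integration.integral_sum) auto
    hence "pair_volume t - (\<Sum>i\<le>K. mean_coeff i * t ^ i) =
        (\<integral>x. ball_volume m M x t - (\<Sum>i\<le>K. ball_coeff m M i x * t ^ i) \<partial>vol)"
      unfolding pair_volume_def using integrable_ball_volume int by simp
    also have "norm \<dots> \<le> (\<integral>x. norm (ball_volume m M x t - (\<Sum>i\<le>K. ball_coeff m M i x * t ^ i)) \<partial>vol)"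
      by (rule integral_norm_bound)
    also have "\<dots> \<le> (\<integral>x. C * t ^ Suc K \<partial>vol)"
      using C[OF _ t] integrable_ball_volume int
      by (intro integral_mono integrable_norm Bochner_Integration.integrable_diff) (auto simp: space_riemannian_volume[OF M])
    finally show ?thesis by (simp add: mult_ac)
  qed
  thus ?thesis using d by blast
qed

lemma pair_volume_bounds: "0 \<le> pair_volume t" "pair_volume t \<le> measure (vol \<Otimes>\<^sub>M vol) (space (vol \<Otimes>\<^sub>M vol))"
proof -
  interpret finite_measure vol by (rule finite_vol)
  interpret P: finite_measure "vol \<Otimes>\<^sub>M vol" by (rule finite_measure_pair_measure[OF finite_vol finite_vol])
  show "0 \<le> pair_volume t" by (simp add: pair_volume_eq)
  show "pair_volume t \<le> measure (vol \<Otimes>\<^sub>M vol) (space (vol \<Otimes>\<^sub>M vol))" unfolding pair_volume_eq by (rule P.bounded_measure)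
qed

text \<open>The expansion is known near 0 only. For \<open>t\<close> above \<delta> the difference
  is at most a constant \<open>B\<close>, and \<open>B\<close> is dominated by
  \<open>B * (t / \<delta>) ^ Suc K\<close>.\<close>

lemma pair_volume_asymptotics:
  assumes D: "D > 0"
  shows "\<exists>C. \<forall>t\<in>{0<..D}. \<bar>pair_volume t - (\<Sum>i\<le>K. mean_coeff i * t ^ i)\<bar> \<le> C * t ^ Suc K"
proof -
  obtain \<delta> C where d: "\<delta> > 0" and C: "\<And>t. t \<in> {0..\<delta>} \<Longrightarrow> \<bar>pair_volume t - (\<Sum>i\<le>K. mean_coeff i * t ^ i)\<bar> \<le> C * t ^ Suc K"
    using pair_volume_taylor[of K] by blast
  define B where "B = measure (vol \<Otimes>\<^sub>M vol) (space (vol \<Otimes>\<^sub>M vol)) + (\<Sum>i\<le>K. \<bar>mean_coeff i\<bar> * D ^ i)"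
  have B0: "B \<ge> 0" using D by (auto simp: B_def intro!: add_nonneg_nonneg sum_nonneg)
  have far: "\<bar>pair_volume t - (\<Sum>i\<le>K. mean_coeff i * t ^ i)\<bar> \<le> B" if t: "t \<in> {0<..D}" for t
  proof -
    have "\<bar>\<Sum>i\<le>K. mean_coeff i * t ^ i\<bar> \<le> (\<Sum>i\<le>K. \<bar>mean_coeff i * t ^ i\<bar>)" by (rule sum_abs)
    also have "\<dots> \<le> (\<Sum>i\<le>K. \<bar>mean_coeff i\<bar> * D ^ i)"
      using t by (intro sum_mono) (auto simp: abs_mult power_abs intro!: mult_left_mono power_mono)
    finally show ?thesis using pair_volume_bounds[of t] unfolding B_def by linarith
  qed
  show ?thesis
  proof (intro exI[of _ "\<bar>C\<bar> + B / \<delta> ^ Suc K"] ballI)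
    fix t assume t: "t \<in> {0<..D}"
    show "\<bar>pair_volume t - (\<Sum>i\<le>K. mean_coeff i * t ^ i)\<bar> \<le> (\<bar>C\<bar> + B / \<delta> ^ Suc K) * t ^ Suc K"
    proof (cases "t \<le> \<delta>")
      case True
      have "C * t ^ Suc K \<le> (\<bar>C\<bar> + B / \<delta> ^ Suc K) * t ^ Suc K"
        by (rule mult_right_mono) (use t d B0 in \<open>auto intro: add_increasing2\<close>)
      moreover have "\<bar>pair_volume t - (\<Sum>i\<le>K. mean_coeff i * t ^ i)\<bar> \<le> C * t ^ Suc K"
        by (rule C) (use True t in auto)
      ultimately show ?thesis by (rule order_trans[rotated])
    next
      case False
      have "B * 1 \<le> B * (t / \<delta>) ^ Suc K"
        using False d B0 by (intro mult_left_mono one_le_power) (auto simp: field_simps)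
      also have "\<dots> = B / \<delta> ^ Suc K * t ^ Suc K" by (simp add: power_divide)
      also have "\<dots> \<le> (\<bar>C\<bar> + B / \<delta> ^ Suc K) * t ^ Suc K"
        by (rule mult_right_mono) (use t in auto)
      finally show ?thesis using far[OF t] by simp
    qed
  qed
qed

lemma pair_volume_le: "\<exists>\<delta>>0. \<exists>C. \<forall>t\<in>{0..\<delta>}. pair_volume t \<le> C * t ^ m"
proof -
  interpret finite_measure vol by (rule finite_vol)
  obtain \<delta> C where d: "\<delta> > 0" and C: "\<And>x t. x \<in> M \<Longrightarrow> t \<in> {0..\<delta>} \<Longrightarrow> ball_volume m M x t \<le> C * t ^ m"
    using ball_volume_unif_Ck[OF M, of 0] by blast
  have "pair_volume t \<le> (C * measure vol (space vol)) * t ^ m" if t: "t \<in> {0..\<delta>}" for t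
  proof -
    have "pair_volume t \<le> (\<integral>x. C * t ^ m \<partial>vol)"
      unfolding pair_volume_def using C t
      by (intro integral_mono integrable_ball_volume) (auto simp: space_riemannian_volume[OF M])
    thus ?thesis by (simp add: mult_ac)
  qed
  thus ?thesis using d by blast
qed

text \<open>Once the lower coefficients are known to vanish, the leading term
  \<open>mean_coeff k * t ^ k\<close> is squeezed between the expansion and the bound by a multiple
  of \<open>t ^ m\<close>; both errors are of order \<open>t ^ Suc k\<close>, so division by
  \<open>t ^ k\<close> and \<open>t\<close> tending to 0 leave 0.\<close>

lemma mean_coeff_eq_0:
  assumes "k < m"
  shows "mean_coeff k = 0"
  using assms
proof (induction k rule: less_induct)
  case (less k)
  obtain \<delta>1 C1 where 1: "\<delta>1 > 0" "\<And>t. t \<in> {0..\<delta>1} \<Longrightarrow> \<bar>pair_volume t - (\<Sum>i\<le>k. mean_coeff i * t ^ i)\<bar> \<le> C1 * t ^ Suc k"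
    using pair_volume_taylor[of k] by blast
  obtain \<delta>2 C2 where 2: "\<delta>2 > 0" "\<And>t. t \<in> {0..\<delta>2} \<Longrightarrow> pair_volume t \<le> C2 * t ^ m"
    using pair_volume_le by blast
  define d where "d = min 1 (min \<delta>1 \<delta>2)"
  have d: "d > 0" "d \<le> 1" "d \<le> \<delta>1" "d \<le> \<delta>2" using 1 2 by (auto simp: d_def)
  have le: "\<bar>mean_coeff k\<bar> \<le> (\<bar>C2\<bar> + C1) * t" if t: "t \<in> {0<..d}" for t
  proof -
    have "(\<Sum>i\<le>k. mean_coeff i * t ^ i) = mean_coeff k * t ^ k"
      using less by (subst sum.remove[of _ k]) (auto intro!: sum.neutral)
    hence "\<bar>pair_volume t - mean_coeff k * t ^ k\<bar> \<le> C1 * t ^ Suc k"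
      using 1(2)[of t] t d by (simp del: power_Suc)
    hence "\<bar>mean_coeff k * t ^ k\<bar> \<le> \<bar>pair_volume t\<bar> + C1 * t ^ Suc k" by linarith
    also have "\<bar>pair_volume t\<bar> \<le> \<bar>C2\<bar> * t ^ Suc k"
    proof -
      have "\<bar>pair_volume t\<bar> \<le> C2 * t ^ m" using 2(2)[of t] pair_volume_bounds(1)[of t] t d by simp
      also have "\<dots> \<le> \<bar>C2\<bar> * t ^ m" using t by (intro mult_right_mono) auto
      also have "\<dots> \<le> \<bar>C2\<bar> * t ^ Suc k"
        using t d less.prems by (intro mult_left_mono power_decreasing) auto
      finally show ?thesis .
    qed
    finally have "\<bar>mean_coeff k\<bar> * t ^ k \<le> (\<bar>C2\<bar> + C1) * t * t ^ k"
      using t by (simp add: abs_mult power_abs algebra_simps)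
    thus ?thesis using t by simp
  qed
  have "\<bar>mean_coeff k\<bar> \<le> 0"
  proof (rule tendsto_lowerbound[of _ _ "at_right 0"])
    have "((\<lambda>t. (\<bar>C2\<bar> + C1) * t) \<longlongrightarrow> (\<bar>C2\<bar> + C1) * 0) (at_right 0)" by (intro tendsto_intros)
    thus "((\<lambda>t. (\<bar>C2\<bar> + C1) * t) \<longlongrightarrow> 0) (at_right 0)" by simp
    show "\<forall>\<^sub>F t in at_right 0. \<bar>mean_coeff k\<bar> \<le> (\<bar>C2\<bar> + C1) * t"
      using eventually_at_right_field[of _ "0::real"] d(1) le by (auto intro!: exI[of _ d])
  qed simp
  thus ?case by simp
qed

lemma measurable_pair_volume [measurable]: "pair_volume \<in> borel_measurable borel"
proof (rule borel_measurable_mono)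
  interpret P: finite_measure "vol \<Otimes>\<^sub>M vol" by (rule finite_measure_pair_measure[OF finite_vol finite_vol])
  show "mono pair_volume"
    unfolding pair_volume_eq by (intro monoI P.finite_measure_mono) auto
qed

text \<open>The layer cake formula for the distance on \<open>M \<times> M\<close>. Its condition at
  distance 0 holds for two different reasons: for \<open>m = 0\<close> the half plane is
  \<open>Re z > 0\<close>, and for \<open>m > 0\<close> the diagonal is a null set because the pair
  volume at 0 is bounded by \<open>C * 0 ^ m\<close>.\<close>

lemma beta_integral_eq:
  assumes D: "D > 0" "\<And>x y. x \<in> M \<Longrightarrow> y \<in> M \<Longrightarrow> norm (x - y) \<le> D" and z: "Re z > - real m"
    and int: "set_integrable lborel {0<..D} (\<lambda>t. cpow t (z - 1) * of_real (pair_volume t))"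
  shows "(LINT (x, y)|(vol \<Otimes>\<^sub>M vol). complex_of_real (norm (x - y)) powr z) =
    cpow D z * of_real (measure (vol \<Otimes>\<^sub>M vol) (space (vol \<Otimes>\<^sub>M vol))) -
      z * (LINT t:{0<..D}|lborel. cpow t (z - 1) * of_real (pair_volume t))"
proof -
  have fin: "finite_measure (vol \<Otimes>\<^sub>M vol)" by (rule finite_measure_pair_measure[OF finite_vol finite_vol])
  interpret P: finite_measure "vol \<Otimes>\<^sub>M vol" by fact
  have "(\<integral>w. complex_of_real (norm (fst w - snd w)) powr z \<partial>(vol \<Otimes>\<^sub>M vol)) =
    cpow D z * of_real (measure (vol \<Otimes>\<^sub>M vol) (space (vol \<Otimes>\<^sub>M vol))) -
      z * (LINT t:{0<..D}|lborel. cpow t (z - 1) * of_real (pair_volume t))"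
    unfolding pair_volume_eq
  proof (rule integral_powr_layer_cake[OF fin D(1)])
    show "0 \<le> norm (fst w - snd w) \<and> norm (fst w - snd w) \<le> D" if "w \<in> space (vol \<Otimes>\<^sub>M vol)" for w
      using that D(2) by (auto simp: space_pair_measure space_riemannian_volume[OF M])
    show "(AE w in vol \<Otimes>\<^sub>M vol. norm (fst w - snd w) > 0) \<or> Re z > 0"
    proof (cases "m = 0")
      case True
      thus ?thesis using z by simp
    next
      case False
      obtain \<delta> C where "\<delta> > 0" "\<And>t. t \<in> {0..\<delta>} \<Longrightarrow> pair_volume t \<le> C * t ^ m"
        using pair_volume_le by blast
      from this(2)[of 0] this(1) have "pair_volume 0 \<le> 0" using False by (simp add: zero_power)
      hence "pair_volume 0 = 0" using pair_volume_bounds(1) by (rule antisym)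
      hence "measure (vol \<Otimes>\<^sub>M vol) {w \<in> space (vol \<Otimes>\<^sub>M vol). norm (fst w - snd w) \<le> 0} = 0"
        unfolding pair_volume_eq .
      hence "emeasure (vol \<Otimes>\<^sub>M vol) {w \<in> space (vol \<Otimes>\<^sub>M vol). norm (fst w - snd w) \<le> 0} = 0"
        by (simp only: P.emeasure_eq_measure) simp
      hence "AE w in vol \<Otimes>\<^sub>M vol. \<not> norm (fst w - snd w) \<le> 0"
        by (subst AE_iff_measurable[OF _ refl]) (auto intro: measurable_dist_vol)
      thus ?thesis by (simp add: not_le)
    qed
    show "set_integrable lborel {0<..D} (\<lambda>t. cpow t (z - 1) *
        of_real (measure (vol \<Otimes>\<^sub>M vol) {w \<in> space (vol \<Otimes>\<^sub>M vol). norm (fst w - snd w) \<le> t}))"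
      using int unfolding pair_volume_eq .
  qed (rule measurable_dist_vol)
  thus ?thesis by (simp add: case_prod_beta')
qed

text \<open>The continuation \<open>B\<close> is only meromorphic and may have arbitrary values at
  singular points. \<open>remove_sings\<close> normalizes it without changing residues or poles, and
  the result is the unique function described by \<open>beta_function\<close>.\<close>

lemma beta_function_properties:
  "residue (beta_function m M) (- of_nat k) = of_real (real k * mean_coeff k)"
  "mean_coeff k = 0 \<Longrightarrow> \<not> is_pole (beta_function m M) (- of_nat k)"
proof -
  have "bounded M" using M by (simp add: closed_submanifold_def compact_imp_bounded)
  then obtain R where R: "R > 0" "\<And>x. x \<in> M \<Longrightarrow> norm x \<le> R" by (auto simp: bounded_pos)
  \<comment> \<open>An upper bound for the diameter that is positive also when \<open>M\<close> is
    empty or a single point.\<close>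
  define D where "D = 2 * R"
  have D: "D > 0" "norm (x - y) \<le> D" if "x \<in> M" "y \<in> M" for x y
    using R norm_triangle_ineq4[of x y] R(2)[OF that(1)] R(2)[OF that(2)] by (auto simp: D_def)
  have D0: "D > 0" using R by (simp add: D_def)
  obtain B where B: "B meromorphic_on UNIV"
    "\<And>z. Re z > - real m \<Longrightarrow> B analytic_on {z}"
    "\<And>z. Re z > - real m \<Longrightarrow> set_integrable lborel {0<..D} (\<lambda>t. cpow t (z - 1) * of_real (pair_volume t))"
    "\<And>z. Re z > - real m \<Longrightarrow> B z = cpow D z * of_real (measure (vol \<Otimes>\<^sub>M vol) (space (vol \<Otimes>\<^sub>M vol))) -
        z * (LINT t:{0<..D}|lborel. cpow t (z - 1) * of_real (pair_volume t))"
    "\<And>k. residue B (- of_nat k) = of_real (real k * mean_coeff k)"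
    "\<And>k. mean_coeff k = 0 \<Longrightarrow> \<not> is_pole B (- of_nat k)"
    using mellin_continuation[OF D0 measurable_pair_volume pair_volume_asymptotics[OF D0] mean_coeff_eq_0] by blast
  have val: "remove_sings B z = (LINT (x, y)|(vol \<Otimes>\<^sub>M vol). complex_of_real (norm (x - y)) powr z)"
    if "Re z > - real m" for z
    using beta_integral_eq[OF D0 D(2) that B(3)[OF that]] B(4)[OF that] remove_sings_at_analytic[OF B(2)[OF that]] by simp
  have "beta_function m M = remove_sings B"
    unfolding beta_function_def
  proof (rule the_equality)
    show "remove_sings B nicely_meromorphic_on UNIV \<and> (\<forall>z. - real m < Re z \<longrightarrow>
      remove_sings B z = (LINT (x, y)|(vol \<Otimes>\<^sub>M vol). complex_of_real (norm (x - y)) powr z))"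
      using remove_sings_nicely_meromorphic[OF B(1)] val by blast
    fix B' assume B': "B' nicely_meromorphic_on UNIV \<and> (\<forall>z. - real m < Re z \<longrightarrow>
      B' z = (LINT (x, y)|(vol \<Otimes>\<^sub>M vol). complex_of_real (norm (x - y)) powr z))"
    show "B' = remove_sings B"
    \<comment> \<open>Any other candidate is given by the same integral on the half plane, which is
      open and contains 1 for every \<open>m\<close>.\<close>
    proof (rule nicely_meromorphic_eqI[of _ _ "{z. Re z > - real m}" 1])
      show "open {z. Re z > - real m}" by (rule open_halfspace_Re_gt)
    qed (use B' remove_sings_nicely_meromorphic[OF B(1)] val in auto)
  qed
  moreover have "isolated_singularity_at B z" for z
    using B(1) by (intro meromorphic_on_isolated_singularity) (rule meromorphic_on_subset, auto)
  moreover have "B meromorphic_on {z}" for z using B(1) by (rule meromorphic_on_subset) auto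
  ultimately show "residue (beta_function m M) (- of_nat k) = of_real (real k * mean_coeff k)"
    "mean_coeff k = 0 \<Longrightarrow> \<not> is_pole (beta_function m M) (- of_nat k)"
    using B(5,6) by simp_all
qed

end

theorem proposition3p4:
  fixes M :: "'a::euclidean_space set" and m :: nat
  assumes "closed_submanifold m M"
  shows "(\<forall>j::nat. residue (beta_function m M) (- of_nat (m + 2 * j)) =
             complex_of_real (real (m + 2 * j) *
               (LINT x|riemannian_volume m M. ball_coeff m M (m + 2 * j) x))) \<and>
         (\<forall>k::nat. (LINT x|riemannian_volume m M. ball_coeff m M k x) = 0 \<longrightarrow>
             \<not> is_pole (beta_function m M) (- of_nat k))"
  using beta_function_properties[OF assms] unfolding mean_coeff_def[OF assms] by blast

end
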